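(* Let $T>0$, let $\phi:\mathbb{R}^n\to[0,+\infty)$ be differentiable, and let $F:[0,T]\times\mathbb{R}^n\to\mathbb{R}$ be such that $F(\cdot,x)$ is measurable for every $x\in\mathbb{R}^n$. Assume: (1) $\phi$ is a strictly convex $G$-function, and both $\phi$ and its conjugate $\phi^\star$ satisfy the $\Delta_2$-condition. (2) For a.e. $t\in[0,T]$, the function $F(t,\cdot)$ is locally Lipschitz and regular on $\mathbb{R}^n$. (3) There exist $b\in L^1([0,T];[0,\infty))$ and $c:\mathbb{R}^n\to\mathbb{R}$, with $c$ bounded on bounded subsets, such that for every $x\in\mathbb{R}^n$, for a.e. $t\in[0,T]$ and for every $\xi_t\in\partial F(t,x)$, $$|F(t,x)|+|\xi_t|\le c(x)\,b(t).$$ (4) (Quasi-subadditivity) There exist constants $\lambda,\mu>0$ such that for a.e. $t\in[0,T]$ and all $x,y\in\mathbb{R}^n$, $$F(t,\lambda(x+y))\le\mu\big(F(t,x)+F(t,y)\big).$$ (5) There exist a $G$-function $\phi_0\ll\phi$ and a function $b_1\in L^1([0,T],\mathbb{R})$ such that for a.e. $t\in[0,T]$ and all $x\in\mathbb{R}^n$, $$F(t,x)\le b_1(t)\big(\phi_0(x)+1\big).$$ (6) $$\lim_{|x|\to\infty}\int_0^TF(t,x)\,dt=\infty.$$ Then the functional $$\mathcal{I}(u)=\int_0^T\phi(u'(t))\,dt+\int_0^TF(t,u(t))\,dt$$ admits a minimizer $u$ on $W^1L^\phi_T$, and $u$ solves the problem $$\frac{d}{dt}\nabla\phi(u'(t))\in\partial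 F(t,u(t))\ \text{ for a.e. } t\in(0,T),\qquad u(0)-u(T)=u'(0)-u'(T)=0.$$
   Context: $|\cdot|$ is the Euclidean norm on $\mathbb{R}^n$. A function $\phi:\mathbb{R}^n\to[0,+\infty]$ is a $G$-function if it is convex, lower semicontinuous, bounded in some neighborhood of $0$, $\phi(0)=0$, $\phi(-x)=\phi(x)$, and $\lim_{|x|\to\infty}\phi(x)=\infty$. Its conjugate (complementary function) is $\phi^\star(\xi)=\sup_{x\in\mathbb{R}^n}\big(\langle\xi,x\rangle-\phi(x)\big)$. A $G$-function $\phi:\mathbb{R}^n\to[0,+\infty)$ satisfies the $\Delta_2$-condition if there is $C>0$ with $\phi(2x)\le C\phi(x)+1$ for all $x$ (in particular, to say that $\phi^\star$ satisfies it includes that $\phi^\star$ is finite-valued). We write $\phi_1\ll\phi_2$ if for every $k>0$ there exists $C>0$ such that $\phi_1(x)\le C+\phi_2(kx)$ for all $x$. For a locally Lipschitz $f:\mathbb{R}^n\to\mathbb{R}$, $f^0(x;v)=\limsup_{y\to x,\ \lambda\searrow0}\frac{f(y+\lambda v)-f(y)}{\lambda}$ and the Clarke generalized gradient is $\partial f(x)=\{\xi: f^0(x;v)\ge\langle\xi,v\rangle\ \forall v\}$. $f$ is regular if the usual (one-sided) directional derivative exists and equals $f^0(x;v)$ for all $x,v$. $\partial F(t,x)$ denotes the Clarke generalized gradient of $F(t,\cdot)$ at $x$. $L^\phi=L^\phi([0,T],\mathbb{R}^n)$ is the set of measurable $u:[0,T]\to\mathbb{R}^n$ with $\int_0^T\phi(\lambda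 u)\,dt<\infty$ for some $\lambda>0$, with Luxemburg norm $\|u\|_{L^\phi}=\inf\{\lambda>0:\int_0^T\phi(u/\lambda)\,dt\le1\}$. $W^1L^\phi$ is the space of absolutely continuous $u:[0,T]\to\mathbb{R}^n$ with $u'\in L^\phi$, normed by $\|u\|_{L^\phi}+\|u'\|_{L^\phi}$, and $W^1L^\phi_T=\{u\in W^1L^\phi:u(0)=u(T)\}$. Solving the problem means: after modification of $u'$ on a null set, $t\mapsto\nabla\phi(u'(t))$ is absolutely continuous on $[0,T]$, the inclusion holds a.e., and the boundary conditions hold (for this representative of $u'$). *)

theory Defs
  imports "HOL-Analysis.Analysis"
begin

section \<open>G-functions\<close>

text \<open>Functions into $[0,+\infty]$ are rendered as nonnegative \<^typ>\<open>ereal\<close>-valued functions.\<close>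

definition G_function :: "('a::euclidean_space \<Rightarrow> ereal) \<Rightarrow> bool" where
  "G_function \<phi> \<longleftrightarrow>
     (\<forall>x. 0 \<le> \<phi> x) \<and>
     (\<forall>x y. \<forall>t\<in>{0..1}.
        \<phi> ((1 - t) *\<^sub>R x + t *\<^sub>R y) \<le> ereal (1 - t) * \<phi> x + ereal t * \<phi> y) \<and>
     (\<forall>x. \<phi> x \<le> Liminf (at x) \<phi>) \<and>
     (\<exists>r>0. \<exists>M::real. \<forall>x\<in>ball 0 r. \<phi> x \<le> ereal M) \<and>
     \<phi> 0 = 0 \<and>
     (\<forall>x. \<phi> (- x) = \<phi> x) \<and>
     (\<phi> \<longlongrightarrow> \<infinity>) at_infinity"

definition strictly_convex :: "('a::real_vector \<Rightarrow> real) \<Rightarrow> bool" where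
  "strictly_convex \<phi> \<longleftrightarrow>
     (\<forall>x y t. x \<noteq> y \<and> 0 < t \<and> t < 1 \<longrightarrow>
        \<phi> ((1 - t) *\<^sub>R x + t *\<^sub>R y) < (1 - t) * \<phi> x + t * \<phi> y)"

definition conjugate :: "('a::real_inner \<Rightarrow> ereal) \<Rightarrow> 'a \<Rightarrow> ereal" where
  "conjugate \<phi> \<xi> = (SUP x. ereal (\<xi> \<bullet> x) - \<phi> x)"

definition Delta2 :: "('a::real_vector \<Rightarrow> ereal) \<Rightarrow> bool" where
  "Delta2 \<phi> \<longleftrightarrow>
     (\<forall>x. \<bar>\<phi> x\<bar> \<noteq> \<infinity>) \<and>
     (\<exists>C::real. C > 0 \<and> (\<forall>x. \<phi> (2 *\<^sub>R x) \<le> ereal C * \<phi> x + 1))"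

definition much_less :: "('a::real_vector \<Rightarrow> ereal) \<Rightarrow> ('a \<Rightarrow> ereal) \<Rightarrow> bool"
    (infix "\<lless>" 50) where
  "\<phi>\<^sub>1 \<lless> \<phi>\<^sub>2 \<longleftrightarrow>
     (\<forall>k>0. \<exists>C::real. C > 0 \<and> (\<forall>x. \<phi>\<^sub>1 x \<le> ereal C + \<phi>\<^sub>2 (k *\<^sub>R x)))"

section \<open>Gradients\<close>

definition gradient :: "('a::real_inner \<Rightarrow> real) \<Rightarrow> 'a \<Rightarrow> 'a" where
  "gradient f x = (THE D. GDERIV f x :> D)"

definition locally_lipschitz :: "('a::metric_space \<Rightarrow> real) \<Rightarrow> bool" where
  "locally_lipschitz f \<longleftrightarrow> (\<forall>x. \<exists>r>0. \<exists>L. L-lipschitz_on (ball x r) f)"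

text \<open>The filter lets \<open>y\<close> tend to \<open>x\<close> with \<open>y = x\<close> allowed, and \<open>h\<close> decrease to \<open>0\<close>.\<close>

definition clarke_derivative :: "('a::real_normed_vector \<Rightarrow> real) \<Rightarrow> 'a \<Rightarrow> 'a \<Rightarrow> ereal" where
  "clarke_derivative f x v =
     Limsup (nhds x \<times>\<^sub>F at_right 0) (\<lambda>(y, h). ereal ((f (y + h *\<^sub>R v) - f y) / h))"

definition clarke_gradient :: "('a::real_inner \<Rightarrow> real) \<Rightarrow> 'a \<Rightarrow> 'a set" where
  "clarke_gradient f x = {\<xi>. \<forall>v. clarke_derivative f x v \<ge> ereal (\<xi> \<bullet> v)}"

definition clarke_regular :: "('a::real_normed_vector \<Rightarrow> real) \<Rightarrow> bool" where
  "clarke_regular f \<longleftrightarrow>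
     (\<forall>x v. \<exists>d. ((\<lambda>h. (f (x + h *\<^sub>R v) - f x) / h) \<longlongrightarrow> d) (at_right 0) \<and>
                clarke_derivative f x v = ereal d)"

section \<open>Orlicz and Orlicz--Sobolev spaces\<close>

text \<open>A finite family of intervals \<open>[a, b]\<close> is a finite set of pairs \<open>(a, b)\<close>.\<close>

definition abs_continuous_on :: "real set \<Rightarrow> (real \<Rightarrow> 'a::metric_space) \<Rightarrow> bool" where
  "abs_continuous_on S f \<longleftrightarrow>
     (\<forall>e>0. \<exists>d>0. \<forall>P.
        finite P \<and>
        (\<forall>(a, b)\<in>P. a \<le> b \<and> {a..b} \<subseteq> S) \<and>
        disjoint_family_on (\<lambda>(a, b). {a<..<b}) P \<and>
        (\<Sum>(a, b)\<in>P. b - a) < d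
        \<longrightarrow> (\<Sum>(a, b)\<in>P. dist (f a) (f b)) < e)"

definition L_phi :: "('a::euclidean_space \<Rightarrow> ereal) \<Rightarrow> real \<Rightarrow> (real \<Rightarrow> 'a) set" where
  "L_phi \<phi> T =
     {u. u \<in> borel_measurable (lebesgue_on {0..T}) \<and>
         (\<exists>l>0. (\<integral>\<^sup>+ t. e2ennreal (\<phi> (l *\<^sub>R u t)) \<partial>lebesgue_on {0..T}) < \<infinity>)}"

text \<open>Elements are functions on the whole line of which only the values on \<open>[0, T]\<close> matter.
  Differentiability almost everywhere is implied by absolute continuity; it is stated because
  \<^const>\<open>vector_derivative\<close> is total and represents $u'$ only where $u'$ exists.\<close>

definition W1L_phi :: "('a::euclidean_space \<Rightarrow> ereal) \<Rightarrow> real \<Rightarrow> (real \<Rightarrow> 'a) set" where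
  "W1L_phi \<phi> T =
     {u. abs_continuous_on {0..T} u \<and>
         (AE t in lebesgue_on {0..T}. u differentiable (at t within {0..T})) \<and>
         (\<lambda>t. vector_derivative u (at t within {0..T})) \<in> L_phi \<phi> T}"

definition W1L_phi_per :: "('a::euclidean_space \<Rightarrow> ereal) \<Rightarrow> real \<Rightarrow> (real \<Rightarrow> 'a) set" where
  "W1L_phi_per \<phi> T = {u \<in> W1L_phi \<phi> T. u 0 = u T}"

section \<open>The variational problem\<close>

definition action ::
    "('a::euclidean_space \<Rightarrow> real) \<Rightarrow> (real \<Rightarrow> 'a \<Rightarrow> real) \<Rightarrow> real \<Rightarrow> (real \<Rightarrow> 'a) \<Rightarrow> real" where
  "action \<phi> F T u =
     (LINT t|lebesgue_on {0..T}. \<phi> (vector_derivative u (at t within {0..T}))) +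
     (LINT t|lebesgue_on {0..T}. F t (u t))"

text \<open>The function \<open>v\<close> is the representative of $u'$ for which $\nabla\phi(v)$ is absolutely
  continuous and the periodicity condition on the derivative is read.\<close>

definition solves_problem ::
    "('a::euclidean_space \<Rightarrow> real) \<Rightarrow> (real \<Rightarrow> 'a \<Rightarrow> real) \<Rightarrow> real \<Rightarrow> (real \<Rightarrow> 'a) \<Rightarrow> bool" where
  "solves_problem \<phi> F T u \<longleftrightarrow>
     (\<exists>v. (AE t in lebesgue_on {0..T}. (u has_vector_derivative v t) (at t within {0..T})) \<and>
          abs_continuous_on {0..T} (\<lambda>t. gradient \<phi> (v t)) \<and>
          (AE t in lebesgue_on {0<..<T}. \<exists>w \<in> clarke_gradient (F t) (u t).
             ((\<lambda>s. gradient \<phi> (v s)) has_vector_derivative w) (at t)) \<and>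
          u 0 - u T = 0 \<and> v 0 - v T = 0)"

end

theory Submission
  imports Defs "HOL-Complex_Analysis.Great_Picard"
begin

text \<open>Existence is the direct method with all weak topologies avoided. Writing a periodic \<open>u\<close> as
  \<open>u t = c + \<integral>\<^sub>0\<^sup>t v\<close>, quasi-subadditivity gives \<open>F(t, l c) \<le> m (F(t, u) + F(t, c - u))\<close>, and Jensen's
  inequality with \<open>\<phi>\<^sub>0 \<lless> \<phi>\<close> absorbs the last term into half of the energy; so energy and \<open>c\<close> stay
  bounded along a minimizing sequence. Finiteness of the conjugate makes \<open>\<phi>\<close> superlinear, so the
  sequence is equicontinuous and converges uniformly along a subsequence; strict convexity provides a
  derivative for the limit and lower semicontinuity of the energy.

  For the Euler--Lagrange inclusion put \<open>q = \<nabla>\<phi>(u')\<close>. One-sided variations by \<open>e\<close> times a trapezoid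
  give \<open>\<langle>q t - q s, e\<rangle> \<le> \<integral>\<^sub>s\<^sup>t F\<^sup>0(\<tau>, u \<tau>; e) d\<tau>\<close> for Lebesgue points \<open>s < t\<close> and every direction \<open>e\<close>.
  Hence \<open>q\<close> extends to an absolutely continuous function, and differentiating the inequality for
  countably many \<open>e\<close> gives \<open>q' t \<in> \<partial>F(t, u t)\<close> without measurable selection. Complementary
  trapezoids give periodicity of \<open>q\<close>, and \<open>\<nabla>\<phi>\<close> is a bijection.\<close>

section \<open>Absolutely continuous functions\<close>

text \<open>The growth bound comes with a null set for each \<open>x\<close>, whereas a Lipschitz
  estimate has to hold on a whole ball for one \<open>t\<close>. Only countably many
  \<open>x\<close> share a null set, so subgradients are bounded on a countable dense set first and
  the bound is then spread to the ball; at the exceptional times \<open>F\<close> is replaced by 0.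
  Regularity makes F^0(t, x; .) a one-sided limit, hence measurable along curves and accessible to
  variations. It is merely positively homogeneous, so the multipliers of \<open>e\<close> must be
  nonnegative and minimality yields inequalities. The complementary trapezoids bound the difference
  of q at s and at t along \<open>e\<close> by the integral of F^0 outside [s, t]; this vanishes for
  s = 0, t = T, and varying \<open>e\<close> gives equality of the end values. The derivative of the
  extended q is found coordinatewise: a primitive of F^0(., u; e) minus the inner product of q and
  \<open>e\<close> is nondecreasing and dominated by a multiple of a primitive of \<open>b\<close>,
  so it has a Radon-Nikodym density, to which Lebesgue differentiation applies.\<close>

lemma integral_Icc_diff:
  fixes w :: "real \<Rightarrow> 'a::euclidean_space"
  assumes w: "w integrable_on {a..b}" and st: "a \<le> s" "s \<le> t" "t \<le> b"
  shows "integral {a..t} w - integral {a..s} w = integral {s..t} w"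
proof -
  have "w integrable_on {a..t}" by (rule integrable_subinterval_real[OF w]) (use st in auto)
  then have "integral {a..s} w + integral {s..t} w = integral {a..t} w"
    using st by (intro Henstock_Kurzweil_Integration.integral_combine) auto
  then show ?thesis by (simp add: algebra_simps)
qed

text \<open>The intervals on which the difference quotient is off by more than \<open>\<eta>\<close> form a Vitali cover of
  the exceptional set; Henstock's lemma bounds the total length of disjoint ones.\<close>

lemma negligible_non_differentiable_integral:
  fixes f :: "real \<Rightarrow> 'a::euclidean_space"
  assumes f: "f integrable_on {a..b}"
  shows "negligible {t \<in> {a..b}. \<not> ((\<lambda>t. integral {a..t} f) has_vector_derivative f t) (at t within {a..b})}"
proof -
  define F where "F = (\<lambda>t. integral {a..t} f)"
  define E where "E \<eta> = {t \<in> {a..b}. \<forall>\<delta>>0. \<exists>y\<in>{a..b}. y \<noteq> t \<and> \<bar>y - t\<bar> < \<delta> \<and>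
      norm (F y - F t - (y - t) *\<^sub>R f t) > \<eta> * \<bar>y - t\<bar>}" for \<eta>
  have neg: "negligible (E \<eta>)" if \<eta>: "\<eta> > 0" for \<eta>
    unfolding negligible_outer_le
  proof (intro allI impI)
    fix \<epsilon> :: real assume \<epsilon>: "\<epsilon> > 0"
    \<comment> \<open>Every chosen interval will contribute more than \<open>\<eta>\<close> times
      its length to this sum, so the tolerance \<open>\<eta> * \<epsilon>\<close> bounds the total
      length by \<open>\<epsilon>\<close>.\<close>
    obtain \<gamma> where \<gamma>: "gauge \<gamma>" and fine: "\<And>p. p tagged_partial_division_of (cbox a b) \<Longrightarrow> \<gamma> fine p \<Longrightarrow>
             sum (\<lambda>(x,k). norm (measure lborel k *\<^sub>R f x - integral k f)) p < \<eta> * \<epsilon>"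
      using Henstock_lemma[of f a b "\<eta> * \<epsilon>"] f \<eta> \<epsilon> by (auto simp: box_real)
    define K where "K = {(t, y). t \<in> {a..b} \<and> y \<in> {a..b} \<and> y \<noteq> t \<and> {min t y..max t y} \<subseteq> \<gamma> t \<and>
        norm (F y - F t - (y - t) *\<^sub>R f t) > \<eta> * \<bar>y - t\<bar>}"
    \<comment> \<open>The covering theorem speaks of closed balls, so the interval between
      \<open>t\<close> and \<open>y\<close> is given by midpoint and half length. The index still
      remembers which end is the tag.\<close>
    define c where "c = (\<lambda>(t::real, y::real). (t + y) / 2)"
    define r where "r = (\<lambda>(t::real, y::real). \<bar>y - t\<bar> / 2)"
    have cb: "cball (c (t, y)) (r (t, y)) = {min t y..max t y}" for t y
      unfolding c_def r_def cball_eq_atLeastAtMost by (auto simp: min_def max_def field_simps abs_if)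
    have "\<exists>C. countable C \<and> C \<subseteq> K \<and> pairwise (\<lambda>i j. disjnt (cball (c i) (r i)) (cball (c j) (r j))) C \<and>
        negligible (E \<eta> - (\<Union>i \<in> C. cball (c i) (r i)))"
    proof -
      have 1: "\<And>i. i \<in> K \<Longrightarrow> 0 < r i" by (auto simp: K_def r_def)
      have 2: "\<exists>i. i \<in> K \<and> x \<in> cball (c i) (r i) \<and> r i < d" if x: "x \<in> E \<eta>" and d: "0 < d" for x d
      proof -
        obtain \<rho> where \<rho>: "\<rho> > 0" "ball x \<rho> \<subseteq> \<gamma> x"
          using \<gamma> unfolding gauge_def by (meson open_contains_ball)
        have "0 < min \<rho> d" using \<rho>(1) d by simp
        moreover from x have "\<forall>\<delta>>0. \<exists>y\<in>{a..b}. y \<noteq> x \<and> \<bar>y - x\<bar> < \<delta> \<and>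
            norm (F y - F x - (y - x) *\<^sub>R f x) > \<eta> * \<bar>y - x\<bar>" by (simp add: E_def)
        ultimately have "\<exists>y\<in>{a..b}. y \<noteq> x \<and> \<bar>y - x\<bar> < min \<rho> d \<and>
            norm (F y - F x - (y - x) *\<^sub>R f x) > \<eta> * \<bar>y - x\<bar>" by blast
        then obtain y where y: "y \<in> {a..b}" "y \<noteq> x" "\<bar>y - x\<bar> < min \<rho> d"
            "norm (F y - F x - (y - x) *\<^sub>R f x) > \<eta> * \<bar>y - x\<bar>" by blast
        have "{min x y..max x y} \<subseteq> ball x \<rho>"
          using y by (auto simp: dist_real_def)
        then have "(x, y) \<in> K" using y x \<rho> by (auto simp: K_def E_def)
        moreover have "x \<in> cball (c (x, y)) (r (x, y))" unfolding cb by auto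
        moreover have "r (x, y) < d" using y d by (auto simp: r_def)
        ultimately show ?thesis by blast
      qed
      show ?thesis by (rule Vitali_covering_theorem_cballs[of K r "E \<eta>" c, OF 1 2]) blast+
    qed
    then obtain C where C: "countable C" "C \<subseteq> K"
       "pairwise (\<lambda>i j. disjnt (cball (c i) (r i)) (cball (c j) (r j))) C"
       "negligible (E \<eta> - (\<Union>i \<in> C. cball (c i) (r i)))" by blast
    \<comment> \<open>Henstock's lemma concerns finite partial divisions; the bound passes to the
      countable family because it is uniform over finite subfamilies.\<close>
    have fin: "measure lebesgue (\<Union>i\<in>C'. cball (c i) (r i)) \<le> \<epsilon>" if C': "C' \<subseteq> C" "finite C'" for C'
    proof -
      define J where "J i = cball (c i) (r i)" for i
      have J: "J (t, y) = {min t y..max t y}" for t y unfolding J_def cb ..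
      have disj: "J i \<inter> J j = {}" if "i \<in> C'" "j \<in> C'" "i \<noteq> j" for i j
        using C(3) C' that unfolding pairwise_def disjnt_def J_def by blast
      have ne: "J i \<noteq> {}" if "i \<in> C'" for i using J by (cases i) auto
      define p where "p = (\<lambda>i. (fst i, J i)) ` C'"
      have inj: "inj_on (\<lambda>i. (fst i, J i)) C'"
        using disj ne by (intro inj_onI) (metis Int_absorb prod.inject)
      have CK: "C' \<subseteq> K" using C C' by auto
      have pd: "p tagged_partial_division_of (cbox a b)"
        unfolding tagged_partial_division_of_def
      proof (intro conjI allI impI)
        show "finite p" unfolding p_def using C' by auto
        fix x k assume "(x, k) \<in> p"
        then obtain y where y: "(x, y) \<in> C'" "k = J (x, y)" by (auto simp: p_def)
        show "x \<in> k" unfolding y(2) J by auto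
        show "k \<subseteq> cbox a b" using CK y(1) unfolding y(2) J K_def by auto
        show "\<exists>a b. k = cbox a b" unfolding y(2) J by (auto simp: box_real)
      next
        fix x1 k1 x2 k2 assume *: "(x1, k1) \<in> p \<and> (x2, k2) \<in> p \<and> (x1, k1) \<noteq> (x2, k2)"
        then have xp: "(x1, k1) \<in> p" "(x2, k2) \<in> p" by auto
        obtain y1 where y1: "(x1, y1) \<in> C'" "k1 = J (x1, y1)" using xp(1) by (auto simp: p_def)
        obtain y2 where y2: "(x2, y2) \<in> C'" "k2 = J (x2, y2)" using xp(2) by (auto simp: p_def)
        note y = y1 y2
        have "k1 \<inter> k2 = {}" using y disj[of "(x1,y1)" "(x2,y2)"] * by auto
        then show "interior k1 \<inter> interior k2 = {}" using interior_subset by blast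
      qed
      have "\<gamma> fine p"
      proof (rule fineI)
        fix x k assume "(x, k) \<in> p"
        then obtain y where y: "(x, y) \<in> C'" "k = J (x, y)" by (auto simp: p_def)
        then have "(x, y) \<in> K" using CK by blast
        then show "k \<subseteq> \<gamma> x" unfolding y(2) J by (simp add: K_def)
      qed
      from fine[OF pd this] have "(\<Sum>i\<in>C'. norm (measure lborel (J i) *\<^sub>R f (fst i) - integral (J i) f)) < \<eta> * \<epsilon>"
        unfolding p_def by (subst (asm) sum.reindex[OF inj]) (simp add: o_def)
      moreover have "\<eta> * (2 * r i) \<le> norm (measure lborel (J i) *\<^sub>R f (fst i) - integral (J i) f)" if "i \<in> C'" for i
      proof -
        obtain t y where i: "i = (t, y)" by (cases i)
        then have ty: "t \<in> {a..b}" "y \<in> {a..b}" "y \<noteq> t" "norm (F y - F t - (y - t) *\<^sub>R f t) > \<eta> * \<bar>y - t\<bar>"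
          using that CK by (auto simp: K_def)
        have *: "integral {s..u} f = F u - F s" if "s \<in> {a..b}" "u \<in> {a..b}" "s \<le> u" for s u
          unfolding F_def using integral_Icc_diff[OF f, of s u] that by simp
        have "norm (measure lborel (J i) *\<^sub>R f (fst i) - integral (J i) f) = norm (F y - F t - (y - t) *\<^sub>R f t)"
        proof (cases "t \<le> y")
          case True
          then have "J i = {t..y}" unfolding i J by simp
          then show ?thesis using True ty *[of t y] by (simp add: i norm_minus_commute)
        next
          case False
          then have "J i = {y..t}" unfolding i J by simp
          then have "norm (measure lborel (J i) *\<^sub>R f (fst i) - integral (J i) f) = norm ((t - y) *\<^sub>R f t - (F t - F y))"
            using False ty *[of y t] by (simp add: i)
          moreover have "(t - y) *\<^sub>R f t - (F t - F y) = F y - F t - (y - t) *\<^sub>R f t" by (simp add: algebra_simps)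
          ultimately show ?thesis by simp
        qed
        then show ?thesis using ty by (simp add: i r_def)
      qed
      then have "(\<Sum>i\<in>C'. \<eta> * (2 * r i)) \<le> (\<Sum>i\<in>C'. norm (measure lborel (J i) *\<^sub>R f (fst i) - integral (J i) f))"
        by (rule sum_mono)
      ultimately have "(\<Sum>i\<in>C'. \<eta> * (2 * r i)) < \<eta> * \<epsilon>" by (rule order_le_less_trans[rotated])
      then have "(\<Sum>i\<in>C'. 2 * r i) < \<epsilon>" using \<eta> by (simp add: sum_distrib_left[symmetric])
      moreover have "measure lebesgue (\<Union>i\<in>C'. J i) \<le> (\<Sum>i\<in>C'. measure lebesgue (J i))"
        by (rule measure_UNION_le) (use C' in \<open>auto simp: J_def\<close>)
      moreover have "(\<Sum>i\<in>C'. measure lebesgue (J i)) = (\<Sum>i\<in>C'. 2 * r i)"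
        by (rule sum.cong) (auto simp: J r_def)
      ultimately show ?thesis unfolding J_def by linarith
    qed
    let ?U = "\<Union>i\<in>C. cball (c i) (r i)"
    have U: "?U \<in> lmeasurable" "measure lebesgue ?U \<le> \<epsilon>"
      by (intro fmeasurable_UN_bound[of C _ lebesgue \<epsilon>] measure_UN_bound[of C _ lebesgue \<epsilon>] C(1) fin; auto)+
    show "\<exists>T. E \<eta> \<subseteq> T \<and> T \<in> lmeasurable \<and> measure lebesgue T \<le> \<epsilon>"
    proof (intro exI conjI)
      let ?N = "E \<eta> - ?U"
      show "E \<eta> \<subseteq> ?U \<union> ?N" by auto
      have N: "?N \<in> lmeasurable" "measure lebesgue ?N = 0" using C(4) by (auto simp: negligible_iff_measure)
      show "?U \<union> ?N \<in> lmeasurable" by (rule fmeasurable.Un[OF U(1) N(1)])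
      show "measure lebesgue (?U \<union> ?N) \<le> \<epsilon>" using measure_Un_le[of ?U lebesgue ?N] U N
        by (auto simp: fmeasurableD)
    qed
  qed
  have "negligible (\<Union>n. E (1 / Suc n))"
    by (intro negligible_countable_Union countable_image) (auto simp: neg)
  then show ?thesis
  proof (rule negligible_subset, safe)
    fix t assume t: "t \<in> {a..b}" and nd: "\<not> ((\<lambda>t. integral {a..t} f) has_vector_derivative f t) (at t within {a..b})"
    show "t \<in> (\<Union>n. E (1 / Suc n))"
    proof (rule ccontr)
      assume no: "t \<notin> (\<Union>n. E (1 / Suc n))"
      have "(F has_vector_derivative f t) (at t within {a..b})"
        unfolding has_vector_derivative_def has_derivative_within_alt
      proof (intro conjI allI impI)
        show "bounded_linear (\<lambda>x. x *\<^sub>R f t)" by (rule bounded_linear_scaleR_left)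
        fix e :: real assume "e > 0"
        then obtain n where n: "1 / real (Suc n) < e" using nat_approx_posE by blast
        from no have "t \<notin> E (1 / Suc n)" by blast
        then obtain \<delta> where \<delta>: "\<delta> > 0" "\<And>y. y\<in>{a..b} \<Longrightarrow> y \<noteq> t \<Longrightarrow> \<bar>y - t\<bar> < \<delta> \<Longrightarrow>
            norm (F y - F t - (y - t) *\<^sub>R f t) \<le> 1 / Suc n * \<bar>y - t\<bar>"
          using t unfolding E_def by (force simp: not_less)
        show "\<exists>d>0. \<forall>y\<in>{a..b}. norm (y - t) < d \<longrightarrow> norm (F y - F t - (y - t) *\<^sub>R f t) \<le> e * norm (y - t)"
        proof (intro exI[of _ \<delta>] conjI ballI impI \<delta>(1))
          fix y assume y: "y \<in> {a..b}" "norm (y - t) < \<delta>"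
          have "1 / Suc n * \<bar>y - t\<bar> \<le> e * \<bar>y - t\<bar>" using n by (intro mult_right_mono) auto
          then show "norm (F y - F t - (y - t) *\<^sub>R f t) \<le> e * norm (y - t)"
            using \<delta>(2)[of y] y by (cases "y = t") auto
        qed
      qed
      then show False using nd by (simp add: F_def)
    qed
  qed
qed

section \<open>Absolute continuity and the fundamental theorem of calculus\<close>

lemma sum_integral_disjoint_le:
  fixes g :: "real \<Rightarrow> real"
  assumes g: "g integrable_on {a..b}" and nn: "\<And>x. x \<in> {a..b} \<Longrightarrow> 0 \<le> g x"
    and P: "finite P" "\<And>c d. (c, d) \<in> P \<Longrightarrow> {c..d} \<subseteq> {a..b}"
    and disj: "disjoint_family_on (\<lambda>(c, d). {c<..<d}) P"
  shows "(\<Sum>(c, d)\<in>P. integral {c..d} g) \<le> integral {a..b} g"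
proof -
  \<comment> \<open>Dropping the end points leaves the integrals unchanged and makes the supports
    disjoint, so at each point at most one summand is nonzero.\<close>
  let ?h = "\<lambda>q x. if x \<in> {fst q<..<snd q} then g x else 0"
  have hi: "(?h q has_integral integral {fst q..snd q} g) {a..b}" if "q \<in> P" for q
  proof -
    have sub: "{fst q..snd q} \<subseteq> {a..b}" using P(2)[of "fst q" "snd q"] that by auto
    have "(g has_integral integral {fst q..snd q} g) {fst q..snd q}"
      using integrable_subinterval_real[OF g sub] by (rule integrable_integral)
    then have "(g has_integral integral {fst q..snd q} g) {fst q<..<snd q}"
      using has_integral_interior[of "{fst q..snd q}" g] by (simp add: has_integral_Icc_iff_Ioo)
    moreover have "{fst q<..<snd q} \<subseteq> {a..b}" using sub by (auto simp: subset_iff)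
    ultimately show ?thesis using has_integral_restrict[of "{fst q<..<snd q}" "{a..b}" g] by blast
  qed
  have "((\<lambda>x. \<Sum>q\<in>P. ?h q x) has_integral (\<Sum>q\<in>P. integral {fst q..snd q} g)) {a..b}"
    by (intro has_integral_sum P(1) hi)
  then have "(\<Sum>q\<in>P. integral {fst q..snd q} g) \<le> integral {a..b} g"
  proof (rule has_integral_le[OF _ integrable_integral[OF g]])
    fix x assume x: "x \<in> {a..b}"
    show "(\<Sum>q\<in>P. ?h q x) \<le> g x"
    proof (cases "\<exists>q\<in>P. x \<in> {fst q<..<snd q}")
      case True
      then obtain q where q: "q \<in> P" "x \<in> {fst q<..<snd q}" by blast
      have "?h r x = 0" if "r \<in> P - {q}" for r
        using disjoint_family_onD[OF disj, of q r] q that by (auto simp: split_beta)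
      then have "(\<Sum>q\<in>P. ?h q x) = ?h q x"
        using q P(1) by (subst sum.remove[of _ q]) (auto intro: sum.neutral)
      then show ?thesis using q by simp
    next
      case False
      then have "(\<Sum>q\<in>P. ?h q x) = 0" by (intro sum.neutral) auto
      then show ?thesis using nn[OF x] by linarith
    qed
  qed
  then show ?thesis by (simp add: split_beta)
qed

text \<open>Truncation: \<open>g\<close> is at most a constant \<open>n\<close> plus its excess over
  \<open>n\<close>. By dominated convergence the excess has small integral for large
  \<open>n\<close>, and the constant part is controlled by the total length of the
  intervals.\<close>

lemma abs_continuous_on_dominated:
  fixes g :: "real \<Rightarrow> real" and u :: "real \<Rightarrow> 'a::metric_space"
  assumes g: "g integrable_on {a..b}" and nn: "\<And>x. x \<in> {a..b} \<Longrightarrow> 0 \<le> g x"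
    and le: "\<And>s t. a \<le> s \<Longrightarrow> s \<le> t \<Longrightarrow> t \<le> b \<Longrightarrow> dist (u s) (u t) \<le> integral {s..t} g"
  shows "abs_continuous_on {a..b} u"
  unfolding abs_continuous_on_def
proof (intro allI impI)
  fix e :: real assume e: "e > 0"
  define h where "h n x = max 0 (g x - real n)" for n x
  have ga: "g absolutely_integrable_on {a..b}"
    using nonnegative_absolutely_integrable_1[OF g nn] by simp
  have ha: "h n absolutely_integrable_on {a..b}" for n
    unfolding h_def by (intro absolutely_integrable_max_1 set_integral_diff ga) auto
  then have hi: "h n integrable_on {a..b}" for n
    using set_lebesgue_integral_eq_integral(1) by blast
  have "(\<lambda>n. integral {a..b} (h n)) \<longlonglongrightarrow> integral {a..b} (\<lambda>x. 0)"
  proof (rule dominated_convergence(2)[OF hi g])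
    show "norm (h n x) \<le> g x" if "x \<in> {a..b}" for n x using nn[OF that] by (auto simp: h_def)
    show "(\<lambda>n. h n x) \<longlonglongrightarrow> 0" for x
    proof (rule tendsto_eventually)
      obtain N :: nat where "g x \<le> real N" using real_arch_simple by blast
      then show "\<forall>\<^sub>F n in sequentially. h n x = 0"
        unfolding eventually_sequentially h_def by (intro exI[of _ N]) auto
    qed
  qed
  then have "(\<lambda>n. integral {a..b} (h n)) \<longlonglongrightarrow> 0" by simp
  then obtain n where n: "integral {a..b} (h n) < e / 2"
    using e order_tendstoD(2)[of _ 0 sequentially "e / 2"] eventually_happens' [OF sequentially_bot] half_gt_zero by metis
  show "\<exists>d>0. \<forall>P. finite P \<and> (\<forall>(c, d)\<in>P. c \<le> d \<and> {c..d} \<subseteq> {a..b}) \<and>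
      disjoint_family_on (\<lambda>(a, b). {a<..<b}) P \<and> (\<Sum>(a, b)\<in>P. b - a) < d
        \<longrightarrow> (\<Sum>(a, b)\<in>P. dist (u a) (u b)) < e"
  proof (intro exI conjI allI impI)
    \<comment> \<open>The \<open>+ 1\<close> covers \<open>n = 0\<close>.\<close>
    show "0 < e / (2 * (real n + 1))" using e by simp
    fix P :: "(real \<times> real) set"
    assume P: "finite P \<and> (\<forall>(c, d)\<in>P. c \<le> d \<and> {c..d} \<subseteq> {a..b}) \<and>
      disjoint_family_on (\<lambda>(a, b). {a<..<b}) P \<and> (\<Sum>(a, b)\<in>P. b - a) < e / (2 * (real n + 1))"
    have "(\<Sum>(c, d)\<in>P. dist (u c) (u d)) \<le> (\<Sum>(c, d)\<in>P. integral {c..d} (h n) + real n * (d - c))"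
    proof (rule sum_mono, safe)
      fix c d assume cd: "(c, d) \<in> P"
      then have cd': "c \<le> d" "{c..d} \<subseteq> {a..b}" using P by auto
      then have "dist (u c) (u d) \<le> integral {c..d} g" by (intro le) auto
      also have "\<dots> \<le> integral {c..d} (\<lambda>x. h n x + real n)"
        by (rule integral_le) (use cd' in \<open>auto intro!: integrable_add integrable_subinterval_real[OF g]
            integrable_subinterval_real[OF hi]\<close>, auto simp: h_def)
      also have "\<dots> = integral {c..d} (h n) + real n * (d - c)"
        using cd' by (subst Henstock_Kurzweil_Integration.integral_add) (auto intro!: integrable_subinterval_real[OF hi])
      finally show "dist (u c) (u d) \<le> integral {c..d} (h n) + real n * (d - c)" .
    qed
    also have "\<dots> = (\<Sum>(c, d)\<in>P. integral {c..d} (h n)) + real n * (\<Sum>(c, d)\<in>P. d - c)"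
      by (simp add: split_beta sum.distrib sum_distrib_left)
    also have "\<dots> \<le> integral {a..b} (h n) + real n * (\<Sum>(c, d)\<in>P. d - c)"
    proof -
      have "(\<Sum>(c, d)\<in>P. integral {c..d} (h n)) \<le> integral {a..b} (h n)"
        by (rule sum_integral_disjoint_le[OF hi]) (use P in \<open>auto simp: h_def\<close>)
      then show ?thesis by simp
    qed
    also have "\<dots> < e / 2 + e / 2"
    proof -
      have "real n * (\<Sum>(c, d)\<in>P. d - c) \<le> (real n + 1) * (e / (2 * (real n + 1)))"
        using P by (intro mult_mono) (auto intro!: sum_nonneg)
      also have "\<dots> = e / 2" by (simp add: field_simps)
      finally show ?thesis using n by linarith
    qed
    finally show "(\<Sum>(c, d)\<in>P. dist (u c) (u d)) < e" by simp
  qed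
qed

lemma abs_continuous_on_integral:
  fixes f :: "real \<Rightarrow> 'a::euclidean_space"
  assumes f: "f absolutely_integrable_on {a..b}"
  shows "abs_continuous_on {a..b} (\<lambda>t. c + integral {a..t} f)"
proof (rule abs_continuous_on_dominated)
  have fi: "f integrable_on {a..b}" and ni: "(\<lambda>x. norm (f x)) integrable_on {a..b}"
    using f by (auto simp: absolutely_integrable_on_def)
  show "(\<lambda>x. norm (f x)) integrable_on {a..b}" by (fact ni)
  fix s t assume st: "a \<le> s" "s \<le> t" "t \<le> b"
  have "dist (c + integral {a..s} f) (c + integral {a..t} f) = norm (integral {s..t} f)"
    using integral_Icc_diff[OF fi st] by (simp add: dist_norm norm_minus_commute[of "integral {a..s} f"])
  also have "\<dots> \<le> integral {s..t} (\<lambda>x. norm (f x))"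
    by (rule integral_norm_bound_integral) (use st in \<open>auto intro: integrable_subinterval_real[OF fi] integrable_subinterval_real[OF ni]\<close>)
  finally show "dist (c + integral {a..s} f) (c + integral {a..t} f) \<le> integral {s..t} (\<lambda>x. norm (f x))" .
qed simp

text \<open>The gauge integral lets integrability of \<open>f\<close> come out together with the
  value. Off \<open>N\<close> the gauge is given by differentiability. At tags in \<open>N\<close>
  it is an open set of measure below the \<open>\<delta>\<close> of absolute continuity, so the
  intervals tagged there carry only a small increment of \<open>u\<close>.\<close>

lemma abs_continuous_on_has_integral:
  fixes u :: "real \<Rightarrow> 'a::euclidean_space"
  assumes ab: "a \<le> b" and ac: "abs_continuous_on {a..b} u" and N: "negligible N"
    and der: "\<And>t. t \<in> {a..b} - N \<Longrightarrow> (u has_vector_derivative f t) (at t within {a..b})"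
  shows "(f has_integral (u b - u a)) {a..b}"
proof -
  define g where "g t = (if t \<in> N then 0 else f t)" for t
  have "(g has_integral (u b - u a)) (cbox a b)"
    unfolding has_integral
  proof (intro allI impI)
    fix e :: real assume e: "e > 0"
    \<comment> \<open>The differentiability errors add up to at most \<open>e' * (b - a)\<close>,
      which is below \<open>e / 2\<close>; the \<open>+ 1\<close> keeps the quotient meaningful for
      \<open>a = b\<close>.\<close>
    define e' where "e' = e / (2 * (b - a + 1))"
    have e': "e' > 0" using e ab by (simp add: e'_def)
    obtain \<delta> where \<delta>: "\<delta> > 0" and ac': "\<forall>P. finite P \<and> (\<forall>(c, d)\<in>P. c \<le> d \<and> {c..d} \<subseteq> {a..b}) \<and>
        disjoint_family_on (\<lambda>(a, b). {a<..<b}) P \<and> (\<Sum>(a, b)\<in>P. b - a) < \<delta> \<longrightarrow>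
        (\<Sum>(a, b)\<in>P. dist (u a) (u b)) < e / 2"
      using ac[unfolded abs_continuous_on_def, rule_format, OF half_gt_zero[OF e]] by (elim exE conjE) (rule that)
    have "N \<in> sets lebesgue" using N negligible_imp_sets by blast
    then obtain O' where O': "open O'" "N \<subseteq> O'" "O' - N \<in> lmeasurable" "emeasure lebesgue (O' - N) < ennreal \<delta>"
      using sets_lebesgue_outer_open[of N \<delta>] \<delta> by metis
    have Om: "O' \<in> lmeasurable" "measure lebesgue O' < \<delta>"
    proof -
      have eq: "O' = (O' - N) \<union> N" using O' by auto
      have N': "N \<in> lmeasurable" "measure lebesgue N = 0" using N by (auto simp: negligible_iff_measure)
      show "O' \<in> lmeasurable" using fmeasurable.Un[OF O'(3) N'(1)] eq by simp
      have "measure lebesgue (O' - N) < \<delta>"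
        using O'(3,4) \<delta> by (simp add: emeasure_eq_measure2 ennreal_less_iff)
      then show "measure lebesgue O' < \<delta>"
        using measure_Un_le[of "O' - N" lebesgue N] N' O'(3) eq by (auto simp: fmeasurableD)
    qed
    have "\<exists>d>0. x \<in> {a..b} - N \<longrightarrow>
         (\<forall>y\<in>{a..b}. norm (y-x) < d \<longrightarrow> norm (u y - u x - (y-x) *\<^sub>R f x) \<le> e' * norm (y-x))" for x
    proof (cases "x \<in> {a..b} - N")
      case True
      then show ?thesis using der[OF True, unfolded has_vector_derivative_def has_derivative_within_alt] e' by blast
    qed (auto intro: exI[of _ 1])
    then obtain d where d: "\<And>x. 0 < d x"
                 "\<And>x y. \<lbrakk>x \<in> {a..b} - N; y \<in> {a..b}; norm (y-x) < d x\<rbrakk>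
                        \<Longrightarrow> norm (u y - u x - (y-x) *\<^sub>R f x) \<le> e' * norm (y-x)"
      by metis
    define \<gamma> where "\<gamma> x = (if x \<in> N then O' else ball x (d x))" for x
    show "\<exists>\<gamma>. gauge \<gamma> \<and> (\<forall>p. p tagged_division_of (cbox a b) \<and> \<gamma> fine p \<longrightarrow>
        norm ((\<Sum>(x, k)\<in>p. measure lborel k *\<^sub>R g x) - (u b - u a)) < e)"
    proof (intro exI conjI allI impI)
      show "gauge \<gamma>" using O' d(1) by (auto simp: gauge_def \<gamma>_def)
      fix p assume p: "p tagged_division_of (cbox a b) \<and> \<gamma> fine p"
      then have pt: "p tagged_division_of {a..b}" and pf: "\<gamma> fine p" by auto
      have fp: "finite p" using tagged_division_ofD(1)[OF pt] .
      have tel: "(\<Sum>(x, k)\<in>p. u (Sup k) - u (Inf k)) = u b - u a"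
        using additive_tagged_division_1[OF ab pt, of u] .
      have tel1: "(\<Sum>(x, k)\<in>p. Sup k - Inf k) = b - a"
        using additive_tagged_division_1[OF ab pt, of "\<lambda>x. x"] .
      have k: "\<exists>c d. k = {c..d} \<and> c \<le> x \<and> x \<le> d \<and> Inf k = c \<and> Sup k = d \<and> a \<le> c \<and> d \<le> b \<and> measure lborel k = d - c"
        if xk: "(x, k) \<in> p" for x k
      proof -
        have "x \<in> k" "k \<subseteq> {a..b}" using tagged_division_ofD(2,3)[OF pt xk] by auto
        moreover obtain c d where "k = cbox c d" using tagged_division_ofD(4)[OF pt xk] by auto
        ultimately show ?thesis by (intro exI[of _ c] exI[of _ d]) (auto simp: box_real)
      qed
      define A where "A = {q \<in> p. fst q \<in> N}"
      have fA: "finite A" using fp by (simp add: A_def)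
      have bA: "norm (\<Sum>(x, k)\<in>A. u (Sup k) - u (Inf k)) < e / 2"
      proof -
        define I where "I = (\<lambda>(x::real, k::real set). (Inf k, Sup k))"
        \<comment> \<open>Two members of the division can have the same interval only if it is a
          single point, and then their tags agree too.\<close>
        have inj: "inj_on I A"
        proof (rule inj_onI)
          fix q q' assume q: "q \<in> A" "q' \<in> A" "I q = I q'"
          obtain x K x' K' where qq: "q = (x, K)" "q' = (x', K')" by (cases q, cases q')
          have qp: "(x, K) \<in> p" "(x', K') \<in> p" using q qq by (auto simp: A_def)
          obtain c d where 1: "K = {c..d}" "c \<le> x" "x \<le> d" "Inf K = c" "Sup K = d" using k[OF qp(1)] by auto
          obtain c' d' where 2: "K' = {c'..d'}" "c' \<le> x'" "x' \<le> d'" "Inf K' = c'" "Sup K' = d'" using k[OF qp(2)] by auto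
          have KK: "K = K'" using 1 2 q(3) qq by (auto simp: I_def)
          show "q = q'"
          proof (rule ccontr)
            assume "q \<noteq> q'"
            then have "interior K \<inter> interior K' = {}" using tagged_division_ofD(5)[OF pt qp] qq by blast
            moreover have "interior K = {c<..<d}" unfolding 1(1) by simp
            ultimately have "{c<..<d} = {}" using KK by blast
            then have "c = d" using 1(2,3) by simp
            then have "x = x'" using 1 2 KK by auto
            then show False using \<open>q \<noteq> q'\<close> qq KK by simp
          qed
        qed
        have sub: "\<forall>(c, d)\<in>I ` A. c \<le> d \<and> {c..d} \<subseteq> {a..b}"
        proof safe
          fix c d x K assume q: "(c, d) = I (x, K)" "(x, K) \<in> A"
          then have "(x, K) \<in> p" by (simp add: A_def)
          from k[OF this] q have *: "c \<le> x" "x \<le> d" "a \<le> c" "d \<le> b" by (auto simp: I_def)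
          show "c \<le> d" using * by simp
          show "y \<in> {a..b}" if "y \<in> {c..d}" for y using * that by auto
        qed
        have disj: "disjoint_family_on (\<lambda>(a, b). {a<..<b}) (I ` A)"
          unfolding disjoint_family_on_def
        proof (intro ballI impI)
          fix m n assume mn: "m \<in> I ` A" "n \<in> I ` A" "m \<noteq> n"
          then obtain x K x' K' where q: "(x, K) \<in> A" "(x', K') \<in> A" "m = I (x, K)" "n = I (x', K')" by auto
          then have qp: "(x, K) \<in> p" "(x', K') \<in> p" "(x, K) \<noteq> (x', K')" using mn by (auto simp: A_def)
          then have "interior K \<inter> interior K' = {}" using tagged_division_ofD(5)[OF pt] by blast
          note disjK = this
          show "(case m of (a, b) \<Rightarrow> {a<..<b}) \<inter> (case n of (a, b) \<Rightarrow> {a<..<b}) = {}"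
          proof -
            have "interior K = {Inf K<..<Sup K}" "interior K' = {Inf K'<..<Sup K'}"
              using k[OF qp(1)] k[OF qp(2)] by (metis interior_atLeastAtMost_real)+
            then show ?thesis using disjK q by (simp only: I_def split_conv)
          qed
        qed
        have oi: "(indicat_real O') integrable_on {a..b}"
          using Om(1) by (simp add: integrable_on_indicator fmeasurable.Int)
        have "(\<Sum>(c, d)\<in>I ` A. d - c) = (\<Sum>(c, d)\<in>I ` A. integral {c..d} (indicat_real O'))"
        proof (rule sum.cong[OF refl], safe)
          fix c d x K assume q: "(c, d) = I (x, K)" "(x, K) \<in> A"
          then have xp: "(x, K) \<in> p" "x \<in> N" by (auto simp: A_def)
          then have "K \<subseteq> O'" using pf unfolding fine_def \<gamma>_def by fastforce
          moreover have K: "K = {c..d}" "c \<le> d" using k[OF xp(1)] q by (auto simp: I_def)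
          ultimately have "integral {c..d} (indicat_real O') = integral {c..d} (\<lambda>x. 1)"
            by (intro Henstock_Kurzweil_Integration.integral_cong) (auto simp: indicator_def)
          then show "d - c = integral {c..d} (indicat_real O')" using K by simp
        qed
        also have "\<dots> \<le> integral {a..b} (indicat_real O')"
          by (rule sum_integral_disjoint_le[OF oi]) (use sub fA disj in auto)
        also have "\<dots> \<le> measure lebesgue O'"
        proof -
          have "O' \<inter> {a..b} \<in> lmeasurable" using Om(1) by (simp add: fmeasurable.Int)
          moreover have "measure lebesgue (O' \<inter> {a..b}) \<le> measure lebesgue O'"
            by (rule measure_mono_fmeasurable) (use Om in auto)
          ultimately show ?thesis by (simp add: integral_indicator)
        qed
        finally have "(\<Sum>(c, d)\<in>I ` A. d - c) < \<delta>" using Om by linarith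
        with spec[OF ac', of "I ` A"] fA sub disj have "(\<Sum>(c, d)\<in>I ` A. dist (u c) (u d)) < e / 2" by blast
        then have "(\<Sum>(x, k)\<in>A. dist (u (Inf k)) (u (Sup k))) < e / 2"
          by (subst (asm) sum.reindex[OF inj]) (simp add: o_def I_def split_beta)
        moreover have "norm (\<Sum>(x, k)\<in>A. u (Sup k) - u (Inf k)) \<le> (\<Sum>(x, k)\<in>A. dist (u (Inf k)) (u (Sup k)))"
          by (rule sum_norm_le) (auto simp: dist_norm norm_minus_commute)
        ultimately show ?thesis by linarith
      qed
      have bC: "norm (\<Sum>(x, k)\<in>p - A. measure lborel k *\<^sub>R f x - (u (Sup k) - u (Inf k))) \<le> e / 2"
      proof -
        have "norm (\<Sum>(x, k)\<in>p - A. measure lborel k *\<^sub>R f x - (u (Sup k) - u (Inf k)))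
            \<le> (\<Sum>(x, k)\<in>p - A. e' * (Sup k - Inf k))"
        proof (rule sum_norm_le, safe)
          fix x K assume xk: "(x, K) \<in> p" "(x, K) \<notin> A"
          obtain c d' where 1: "K = {c..d'}" "c \<le> x" "x \<le> d'" "Inf K = c" "Sup K = d'" "a \<le> c" "d' \<le> b"
             "measure lborel K = d' - c" using k[OF xk(1)] by auto
          have x: "x \<in> {a..b} - N" using xk 1 by (auto simp: A_def)
          have "K \<subseteq> ball x (d x)" using pf xk x unfolding fine_def \<gamma>_def by fastforce
          moreover have "c \<in> K" "d' \<in> K" unfolding 1(1) using 1(2,3) by auto
          ultimately have "c \<in> ball x (d x)" "d' \<in> ball x (d x)" by blast+
          then have cd: "norm (c - x) < d x" "norm (d' - x) < d x"
            by (simp_all add: dist_norm norm_minus_commute)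
          have "norm ((d' - c) *\<^sub>R f x - (u d' - u c)) = norm ((u c - u x - (c - x) *\<^sub>R f x) - (u d' - u x - (d' - x) *\<^sub>R f x))"
            by (simp add: algebra_simps)
          also have "\<dots> \<le> norm (u c - u x - (c - x) *\<^sub>R f x) + norm (u d' - u x - (d' - x) *\<^sub>R f x)"
            by (rule norm_triangle_ineq4)
          also have "\<dots> \<le> e' * norm (c - x) + e' * norm (d' - x)"
            by (intro add_mono d(2) x cd) (use 1 in auto)
          also have "\<dots> = e' * (d' - c)" using 1 by (simp add: algebra_simps)
          finally show "norm (measure lborel K *\<^sub>R f x - (u (Sup K) - u (Inf K))) \<le> e' * (Sup K - Inf K)"
            using 1 by simp
        qed
        also have "\<dots> \<le> (\<Sum>(x, k)\<in>p. e' * (Sup k - Inf k))"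
          by (rule sum_mono2[OF fp]) (use e' k in \<open>fastforce simp: A_def\<close>)+
        also have "\<dots> = e' * (b - a)" using tel1 by (simp add: split_beta sum_distrib_left[symmetric])
        also have "\<dots> \<le> e / 2" using ab e unfolding e'_def by (simp add: field_simps)
        finally show ?thesis .
      qed
      have eq: "(\<Sum>(x, k)\<in>p. measure lborel k *\<^sub>R g x) - (u b - u a) =
          (\<Sum>(x, k)\<in>p - A. measure lborel k *\<^sub>R f x - (u (Sup k) - u (Inf k))) - (\<Sum>(x, k)\<in>A. u (Sup k) - u (Inf k))"
      proof -
        have "(\<Sum>(x, k)\<in>p. measure lborel k *\<^sub>R g x) - (u b - u a) =
          (\<Sum>(x, k)\<in>p. measure lborel k *\<^sub>R g x - (u (Sup k) - u (Inf k)))"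
          unfolding tel[symmetric] by (simp add: sum_subtractf split_beta)
        also have "\<dots> = (\<Sum>(x, k)\<in>p - A. measure lborel k *\<^sub>R g x - (u (Sup k) - u (Inf k)))
            + (\<Sum>(x, k)\<in>A. measure lborel k *\<^sub>R g x - (u (Sup k) - u (Inf k)))"
          by (rule sum.subset_diff) (auto simp: A_def fp)
        also have "(\<Sum>(x, k)\<in>p - A. measure lborel k *\<^sub>R g x - (u (Sup k) - u (Inf k))) =
            (\<Sum>(x, k)\<in>p - A. measure lborel k *\<^sub>R f x - (u (Sup k) - u (Inf k)))"
          by (rule sum.cong) (auto simp: A_def g_def)
        also have "(\<Sum>(x, k)\<in>A. measure lborel k *\<^sub>R g x - (u (Sup k) - u (Inf k))) =
            - (\<Sum>(x, k)\<in>A. u (Sup k) - u (Inf k))"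
          unfolding sum_negf[symmetric] by (rule sum.cong) (auto simp: A_def g_def)
        finally show ?thesis by simp
      qed
      show "norm ((\<Sum>(x, k)\<in>p. measure lborel k *\<^sub>R g x) - (u b - u a)) < e"
        unfolding eq using bA bC norm_triangle_ineq4[of "\<Sum>(x, k)\<in>p - A. measure lborel k *\<^sub>R f x - (u (Sup k) - u (Inf k))"
          "\<Sum>(x, k)\<in>A. u (Sup k) - u (Inf k)"] by linarith
    qed
  qed
  then have "(g has_integral (u b - u a)) {a..b}" by simp
  then show ?thesis by (rule has_integral_spike[OF N, rotated]) (auto simp: g_def)
qed

section \<open>Stieltjes measures and densities of monotone functions\<close>

lemma UN_Ioc_eq_UNIV: "(\<Union>n::nat. {- real n<..real n}) = (UNIV :: real set)"
proof (intro set_eqI iffI UNIV_I)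
  fix x :: real
  obtain n :: nat where "\<bar>x\<bar> < real n" using reals_Archimedean2 by blast
  then show "x \<in> (\<Union>n::nat. {- real n<..real n})" by (intro UN_I[of n]) auto
qed

lemma interval_measure_bounded:
  fixes G :: "real \<Rightarrow> real"
  assumes mono: "\<And>x y. x \<le> y \<Longrightarrow> G x \<le> G y" and cont: "\<And>a. continuous (at_right a) G"
    and bd: "\<And>x. \<bar>G x\<bar> \<le> K"
  shows "finite_measure (interval_measure G)"
proof
  note un = UN_Ioc_eq_UNIV
  have "emeasure (interval_measure G) (\<Union>n::nat. {- real n<..real n}) =
      (SUP n. emeasure (interval_measure G) {- real n<..real n})"
    by (rule SUP_emeasure_incseq[symmetric]) (auto simp: incseq_def)
  also have "\<dots> \<le> ennreal (2 * K)"
  proof (rule SUP_least)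
    fix n :: nat
    have "emeasure (interval_measure G) {- real n<..real n} = ennreal (G (real n) - G (- real n))"
      by (rule emeasure_interval_measure_Ioc[OF _ mono cont]) auto
    also have "\<dots> \<le> ennreal (2 * K)" using bd[of "real n"] bd[of "- real n"] by (intro ennreal_leI) linarith
    finally show "emeasure (interval_measure G) {- real n<..real n} \<le> ennreal (2 * K)" .
  qed
  finally show "emeasure (interval_measure G) (space (interval_measure G)) \<noteq> \<infinity>"
    unfolding un by (auto simp: top_unique)
qed

text \<open>The interval measures of \<open>G\<close> and \<open>B - G\<close> add up to that of \<open>B\<close>.\<close>

lemma interval_measure_le:
  fixes G B :: "real \<Rightarrow> real"
  assumes mono: "\<And>x y. x \<le> y \<Longrightarrow> G x \<le> G y" "\<And>x y. x \<le> y \<Longrightarrow> G y - G x \<le> B y - B x"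
    and cont: "\<And>a. continuous (at_right a) G" "\<And>a. continuous (at_right a) B"
    and bd: "\<And>x. \<bar>G x\<bar> \<le> K" "\<And>x. \<bar>B x\<bar> \<le> K"
    and A: "A \<in> sets borel"
  shows "measure (interval_measure G) A \<le> measure (interval_measure B) A"
proof -
  let ?C = "\<lambda>x. B x - G x"
  have mB: "\<And>x y. x \<le> y \<Longrightarrow> B x \<le> B y" using mono by (smt (verit))
  have mC: "\<And>x y. x \<le> y \<Longrightarrow> ?C x \<le> ?C y" using mono(2) by (smt (verit))
  have cC: "continuous (at_right a) ?C" for a using cont by (intro continuous_intros)
  have bC: "\<bar>?C x\<bar> \<le> 2 * K" for x using bd[of x] by linarith
  interpret mG: finite_measure "interval_measure G" by (rule interval_measure_bounded[OF mono(1) cont(1) bd(1)])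
  interpret mB: finite_measure "interval_measure B" by (rule interval_measure_bounded[OF mB cont(2) bd(2)])
  interpret mC: finite_measure "interval_measure ?C" by (rule interval_measure_bounded[OF mC cC bC])
  define P where "P A \<longleftrightarrow> measure (interval_measure G) A + measure (interval_measure ?C) A = measure (interval_measure B) A" for A
  have ioc: "P {s<..t}" for s t
  proof (cases "s \<le> t")
    case True
    then show ?thesis unfolding P_def
      by (simp add: measure_interval_measure_Ioc[OF _ mono(1) cont(1)] measure_interval_measure_Ioc[OF _ mB cont(2)]
        measure_interval_measure_Ioc[OF _ mC cC])
  qed (auto simp: P_def)
  note un = UN_Ioc_eq_UNIV
  have univ: "P UNIV"
  proof -
    have r: "range (\<lambda>n::nat. {- real n<..real n}) \<subseteq> sets (interval_measure f)" for f by auto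
    have inc: "incseq (\<lambda>n::nat. {- real n<..real n})" by (auto simp: incseq_def)
    have "(\<lambda>n. measure (interval_measure G) {- real n<..real n}) \<longlonglongrightarrow> measure (interval_measure G) UNIV"
      using mG.finite_Lim_measure_incseq[OF r inc] un by simp
    moreover have "(\<lambda>n. measure (interval_measure ?C) {- real n<..real n}) \<longlonglongrightarrow> measure (interval_measure ?C) UNIV"
      using mC.finite_Lim_measure_incseq[OF r inc] un by simp
    ultimately have "(\<lambda>n. measure (interval_measure G) {- real n<..real n} + measure (interval_measure ?C) {- real n<..real n})
       \<longlonglongrightarrow> measure (interval_measure G) UNIV + measure (interval_measure ?C) UNIV" by (rule tendsto_add)
    moreover have "(\<lambda>n. measure (interval_measure B) {- real n<..real n}) \<longlonglongrightarrow> measure (interval_measure B) UNIV"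
      using mB.finite_Lim_measure_incseq[OF r inc] un by simp
    ultimately show ?thesis
      using ioc unfolding P_def by (metis (no_types, lifting) LIMSEQ_unique ext)
  qed
  have gen: "sets borel = sigma_sets UNIV (range (\<lambda>(a, b). {a <.. b::real}))"
    by (subst borel_sigma_sets_Ioc) (simp add: sets_measure_of)
  have "P A"
  proof (rule sigma_sets_induct_disjoint[of "range (\<lambda>(a, b). {a <.. b::real})" UNIV A P])
    show "Int_stable (range (\<lambda>(a, b). {a <.. b::real}))"
      by (auto simp: Int_stable_def image_iff intro!: exI)
    show "A \<in> sigma_sets UNIV (range (\<lambda>(a, b). {a <.. b::real}))" using A gen by simp
    show "P {}" by (simp add: P_def)
    show "P (UNIV - A)" if "A \<in> sigma_sets UNIV (range (\<lambda>(a, b). {a <.. b::real}))" "P A" for A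
    proof -
      have "A \<in> sets borel" using that gen by simp
      then show ?thesis using that univ mG.finite_measure_compl[of A] mB.finite_measure_compl[of A] mC.finite_measure_compl[of A]
        unfolding P_def by simp
    qed
    show "P (\<Union>i::nat. A i)" if d: "disjoint_family A" and r: "range A \<subseteq> sigma_sets UNIV (range (\<lambda>(a, b). {a <.. b::real}))"
      and P: "\<And>i. P (A i)" for A
    proof -
      have r': "range A \<subseteq> sets borel" using r gen by simp
      have "(\<lambda>i. measure (interval_measure G) (A i) + measure (interval_measure ?C) (A i)) sums
          (measure (interval_measure G) (\<Union>i. A i) + measure (interval_measure ?C) (\<Union>i. A i))"
        by (intro sums_add mG.finite_measure_UNION mC.finite_measure_UNION d) (use r' in auto)
      moreover have "(\<lambda>i. measure (interval_measure B) (A i)) sums measure (interval_measure B) (\<Union>i. A i)"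
        by (intro mB.finite_measure_UNION d) (use r' in auto)
      ultimately show ?thesis using P unfolding P_def by (simp add: sums_unique2)
    qed
  qed (auto simp: ioc)
  then show ?thesis unfolding P_def using measure_nonneg[of "interval_measure ?C" A] by linarith
qed

text \<open>The Stieltjes measure of \<open>G\<close> lies below that of a primitive of
  \<open>\<beta>\<close>, which has a density. It is therefore absolutely continuous with respect to
  Lebesgue measure, and \<open>r\<close> is its Radon-Nikodym derivative. This is how the derivative
  in the Euler-Lagrange inclusion is found.\<close>

lemma monotone_dominated_eq_integral:
  fixes G \<beta> :: "real \<Rightarrow> real"
  assumes ab: "a \<le> b" and \<beta>: "\<beta> integrable_on {a..b}" and nn: "\<And>x. x \<in> {a..b} \<Longrightarrow> 0 \<le> \<beta> x"
    and G: "\<And>s t. a \<le> s \<Longrightarrow> s \<le> t \<Longrightarrow> t \<le> b \<Longrightarrow> 0 \<le> G t - G s \<and> G t - G s \<le> integral {s..t} \<beta>"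
  obtains r where "r integrable_on {a..b}" "\<And>t. t \<in> {a..b} \<Longrightarrow> G t - G a = integral {a..t} r"
proof -
  \<comment> \<open>Clamping extends both functions to the whole line by constants, which adds no
    mass outside the interval.\<close>
  define cl where "cl x = max a (min b x)" for x
  have cl: "cl x \<in> {a..b}" "x \<in> {a..b} \<Longrightarrow> cl x = x" "x \<le> y \<Longrightarrow> cl x \<le> cl y" for x y
    using ab by (auto simp: cl_def)
  define B0 where "B0 t = integral {a..t} \<beta>" for t
  have B0: "B0 t - B0 s = integral {s..t} \<beta>" if "a \<le> s" "s \<le> t" "t \<le> b" for s t
    unfolding B0_def by (rule integral_Icc_diff[OF \<beta> that])
  define B where "B x = B0 (cl x)" for x
  define g where "g x = G (cl x)" for x
  have contcl: "continuous_on UNIV cl" unfolding cl_def by (intro continuous_intros)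
  have contB0: "continuous_on {a..b} B0" unfolding B0_def by (rule indefinite_integral_continuous_1[OF \<beta>])
  have contB: "continuous_on UNIV B" unfolding B_def
    by (rule continuous_on_compose2[OF contB0 contcl]) (use cl in auto)
  have mono: "0 \<le> g y - g x" "g y - g x \<le> B y - B x" if "x \<le> y" for x y
    using G[of "cl x" "cl y"] B0[of "cl x" "cl y"] cl that unfolding g_def B_def by auto
  have contg: "continuous_on UNIV g"
    unfolding continuous_on_iff
  proof (intro ballI allI impI)
    fix x e :: real assume "e > 0"
    then obtain d where d: "d > 0" "\<And>y. dist y x < d \<Longrightarrow> dist (B y) (B x) < e"
      using contB unfolding continuous_on_iff by blast
    show "\<exists>d>0. \<forall>x'\<in>UNIV. dist x' x < d \<longrightarrow> dist (g x') (g x) < e"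
    proof (intro exI[of _ d] conjI ballI impI d(1))
      fix y assume "dist y x < d"
      then have "dist (B y) (B x) < e" by (rule d(2))
      then show "dist (g y) (g x) < e"
        using mono[of x y] mono[of y x] by (cases "x \<le> y") (auto simp: dist_real_def)
    qed
  qed
  have cr: "continuous (at_right x) g" "continuous (at_right x) B" for x
    using contg contB by (auto simp: continuous_on_eq_continuous_at intro: continuous_at_imp_continuous_at_within)
  have bd: "\<bar>g x\<bar> \<le> \<bar>G a\<bar> + \<bar>B0 b\<bar>" "\<bar>B x\<bar> \<le> \<bar>G a\<bar> + \<bar>B0 b\<bar>" for x
  proof -
    have "0 \<le> G (cl x) - G a" "G (cl x) - G a \<le> B0 (cl x) - B0 a" "B0 (cl x) - B0 a \<ge> 0" "B0 b - B0 (cl x) \<ge> 0" "B0 a = 0"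
      using G[of a "cl x"] G[of "cl x" b] B0[of a "cl x"] B0[of "cl x" b] cl(1)[of x] by (auto simp: B0_def)
    then show "\<bar>g x\<bar> \<le> \<bar>G a\<bar> + \<bar>B0 b\<bar>" "\<bar>B x\<bar> \<le> \<bar>G a\<bar> + \<bar>B0 b\<bar>"
      unfolding g_def B_def by auto
  qed
  define h where "h x = ennreal (indicator {a..b} x * \<beta> x)" for x
  have "(\<lambda>x. indicator {a..b} x * \<beta> x) \<in> borel_measurable lebesgue"
    using has_integral_implies_lebesgue_measurable[OF integrable_integral[OF \<beta>]] by simp
  then have "h \<in> borel_measurable (completion lborel)" unfolding h_def by measurable
  \<comment> \<open>\<open>density lborel\<close> calls for a Borel function, while \<open>h\<close>
    is only known to be Lebesgue measurable.\<close>
  then obtain h' where h': "h' \<in> borel_measurable lborel" "AE x in lborel. h x = h' x"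
    using completion_ex_borel_measurable by blast
  have eqB: "interval_measure B = density lborel h'"
  proof (rule measure_eqI_generator_eq[where \<Omega>=UNIV and E="range (\<lambda>(a, b). {a <.. b::real})" and A="\<lambda>n::nat. {- real n<..real n}"])
    show "Int_stable (range (\<lambda>(a, b). {a <.. b::real}))"
      by (auto simp: Int_stable_def image_iff intro!: exI)
    show "sets (interval_measure B) = sigma_sets UNIV (range (\<lambda>(a, b). {a <.. b::real}))"
      "sets (density lborel h') = sigma_sets UNIV (range (\<lambda>(a, b). {a <.. b::real}))"
      by (simp_all add: borel_sigma_sets_Ioc sets_measure_of)
    have ioc: "emeasure (interval_measure B) {s<..t} = ennreal (B t - B s)" if "s \<le> t" for s t
      by (rule emeasure_interval_measure_Ioc[OF that _ cr(2)]) (use mono in \<open>smt (verit)\<close>)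
    show "emeasure (interval_measure B) {- real n<..real n} \<noteq> \<infinity>" for n :: nat
      by (subst ioc) auto
    show "(\<Union>n::nat. {- real n<..real n}) = (UNIV :: real set)"
      by (rule UN_Ioc_eq_UNIV)
    show "emeasure (interval_measure B) X = emeasure (density lborel h') X" if "X \<in> range (\<lambda>(a, b). {a <.. b::real})" for X
    proof -
      from that obtain s t where X: "X = {s<..t}" by auto
      show ?thesis
      proof (cases "s \<le> t")
        case True
        have i1: "(\<beta> has_integral (B t - B s)) {cl s..cl t}"
          using B0[of "cl s" "cl t"] cl True integrable_integral[OF integrable_subinterval_real[OF \<beta>, of "cl s" "cl t"]]
          by (auto simp: B_def)
        have "emeasure (density lborel h') X = (\<integral>\<^sup>+x. h' x * indicator X x \<partial>lborel)"
          using h' X by (simp add: emeasure_density)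
        also have "\<dots> = (\<integral>\<^sup>+x. h x * indicator X x \<partial>lborel)"
          using h'(2) by (intro nn_integral_cong_AE) (auto elim: eventually_mono)
        also have "\<dots> = (\<integral>\<^sup>+x. ennreal (indicator {cl s..cl t} x * \<beta> x) \<partial>lborel)"
        proof (rule nn_integral_cong_AE)
          \<comment> \<open>Off these points the half-open interval cut down to
            \<open>{a..b}\<close> and the closed interval between the clamped ends coincide; if
            \<open>{s<..t}\<close> lies outside, the latter is a single excluded point.\<close>
          have "AE x in lborel. x \<notin> {s, t, a, b}"
            by (intro AE_not_in finite_imp_null_set_lborel) auto
          then show "AE x in lborel. h x * indicator X x = ennreal (indicator {cl s..cl t} x * \<beta> x)"
          proof (rule eventually_mono)
            fix x assume "x \<notin> {s, t, a, b}"
            then have "x \<in> {cl s..cl t} \<longleftrightarrow> x \<in> {a..b} \<and> x \<in> {s<..t}"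
              using True ab unfolding cl_def by (auto simp: max_def min_def split: if_splits)
            then show "h x * indicator X x = ennreal (indicator {cl s..cl t} x * \<beta> x)"
              unfolding h_def X by (auto simp: indicator_def)
          qed
        qed
        also have "\<dots> = ennreal (B t - B s)"
          by (rule nn_integral_has_integral_lebesgue[OF _ i1]) (use cl(1)[of s] cl(1)[of t] nn in auto)
        finally show ?thesis using ioc[OF True] X by simp
      qed (auto simp: X)
    qed
  qed auto
  have mg: "\<And>x y. x \<le> y \<Longrightarrow> g x \<le> g y" using mono(1) by (smt (verit))
  have mB: "\<And>x y. x \<le> y \<Longrightarrow> B x \<le> B y" using mono by (smt (verit))
  interpret mG: finite_measure "interval_measure g" by (rule interval_measure_bounded[OF mg cr(1) bd(1)])
  have "absolutely_continuous lborel (interval_measure g)"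
    unfolding absolutely_continuous_def
  proof
    fix A assume A: "A \<in> null_sets (lborel :: real measure)"
    then have Ab: "A \<in> sets borel" by auto
    have "absolutely_continuous lborel (density lborel h')" using h'(1) by (rule absolutely_continuousI_density)
    then have "A \<in> null_sets (interval_measure B)" using A unfolding absolutely_continuous_def eqB by blast
    then have "measure (interval_measure B) A = 0" by (simp add: measure_eq_0_null_sets)
    then have "measure (interval_measure g) A \<le> 0"
      using interval_measure_le[OF mg mono(2) cr bd Ab] by simp
    then have "measure (interval_measure g) A = 0" using measure_nonneg[of "interval_measure g" A] by linarith
    then show "A \<in> null_sets (interval_measure g)"
      using Ab by (auto simp: null_sets_def mG.emeasure_eq_measure)
  qed
  then obtain f where f: "f \<in> borel_measurable lborel" "density lborel f = interval_measure g"
    using sigma_finite_measure.Radon_Nikodym[OF sigma_finite_lborel] by (metis sets_interval_measure sets_lborel)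
  have fin: "(\<integral>\<^sup>+x. f x \<partial>lborel) \<noteq> \<infinity>"
  proof -
    have "(\<integral>\<^sup>+x. f x \<partial>lborel) = emeasure (density lborel f) UNIV" using f(1) by (simp add: emeasure_density)
    then show ?thesis unfolding f(2) by simp
  qed
  have fAE: "AE x in lborel. f x \<noteq> \<infinity>" by (rule nn_integral_noteq_infinite[OF f(1) fin])
  define r where "r x = enn2real (f x)" for x
  have r: "r \<in> borel_measurable borel" "\<And>x. 0 \<le> r x" using f(1) by (auto simp: r_def[abs_def])
  have hi: "(r has_integral (G t - G a)) {a..t}" if t: "t \<in> {a..b}" for t
  proof -
    have "(\<integral>\<^sup>+x. ennreal (indicator {a..t} x * r x) \<partial>lborel) = (\<integral>\<^sup>+x. f x * indicator {a<..t} x \<partial>lborel)"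
    proof (rule nn_integral_cong_AE)
      have "AE x in lborel. x \<notin> {a}" by (intro AE_not_in finite_imp_null_set_lborel) auto
      with fAE show "AE x in lborel. ennreal (indicator {a..t} x * r x) = f x * indicator {a<..t} x"
        by eventually_elim (auto simp: r_def indicator_def less_top)
    qed
    also have "\<dots> = emeasure (density lborel f) {a<..t}" using f(1) by (simp add: emeasure_density)
    also have "\<dots> = ennreal (g t - g a)" unfolding f(2)
      by (rule emeasure_interval_measure_Ioc[OF _ mg cr(1)]) (use t in auto)
    also have "g t - g a = G t - G a" using cl(2)[of t] cl(2)[of a] t ab by (simp add: g_def)
    finally have "((\<lambda>x. indicator {a..t} x * r x) has_integral (G t - G a)) UNIV"
      using r G[of a t] t by (intro nn_integral_has_integral) auto
    moreover have "(\<lambda>x. indicator {a..t} x * r x) = (\<lambda>x. if x \<in> {a..t} then r x else 0)"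
      by (auto simp: indicator_def)
    ultimately show ?thesis using has_integral_restrict_UNIV[of "{a..t}" r] by simp
  qed
  show thesis
  proof (rule that)
    show "r integrable_on {a..b}" using hi[of b] ab by (auto intro: has_integral_integrable)
    show "G t - G a = integral {a..t} r" if "t \<in> {a..b}" for t using hi[OF that] by (simp add: integral_unique)
  qed
qed

section \<open>Differentiable strictly convex G-functions\<close>

text \<open>\<open>superlinear\<close> is the form in which finiteness of the conjugate enters: for
  a set of functions with bounded energy it amounts to uniform integrability.\<close>

locale smooth_G_function =
  fixes \<phi> :: "'a::euclidean_space \<Rightarrow> real"
  assumes conv: "0 \<le> t \<Longrightarrow> t \<le> 1 \<Longrightarrow> \<phi> ((1 - t) *\<^sub>R x + t *\<^sub>R y) \<le> (1 - t) * \<phi> x + t * \<phi> y"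
    and zero [simp]: "\<phi> 0 = 0"
    and nonneg [simp]: "0 \<le> \<phi> x"
    and even [simp]: "\<phi> (- x) = \<phi> x"
    and diff: "\<phi> differentiable (at x)"
    and strict: "strictly_convex \<phi>"
    and Delta2_ex: "\<exists>C. \<forall>x. \<phi> (2 *\<^sub>R x) \<le> C * \<phi> x + 1"
    and superlinear: "e > 0 \<Longrightarrow> \<exists>K. \<forall>x. norm x \<le> e * \<phi> x + K"
begin

section \<open>First-order and growth estimates\<close>

lemma continuous: "continuous_on S \<phi>"
  using diff by (meson continuous_at_imp_continuous_on differentiable_imp_continuous_within)

lemma borel [measurable]: "\<phi> \<in> borel_measurable borel"
  using continuous by (rule borel_measurable_continuous_onI)

text \<open>\<open>gradient\<close> is a definite description, so uniqueness is shown along with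
  existence. The representing vector is read off from the derivative on the basis.\<close>

lemma GDERIV_gradient: "GDERIV \<phi> x :> gradient \<phi> x"
proof -
  obtain f' where f': "(\<phi> has_derivative f') (at x)" using diff by (auto simp: differentiable_def)
  then have lin: "linear f'" by (rule has_derivative_linear)
  have "f' h = h \<bullet> (\<Sum>b\<in>Basis. f' b *\<^sub>R b)" for h
  proof -
    have "f' h = f' (\<Sum>b\<in>Basis. (h \<bullet> b) *\<^sub>R b)" by (simp add: euclidean_representation)
    also have "\<dots> = (\<Sum>b\<in>Basis. (h \<bullet> b) * f' b)"
      by (simp add: linear_sum[OF lin] linear_scale[OF lin])
    also have "\<dots> = h \<bullet> (\<Sum>b\<in>Basis. f' b *\<^sub>R b)"
      by (simp add: inner_sum_right algebra_simps)
    finally show ?thesis .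
  qed
  then have "f' = (\<lambda>h. h \<bullet> (\<Sum>b\<in>Basis. f' b *\<^sub>R b))" by (rule ext)
  then have D: "GDERIV \<phi> x :> (\<Sum>b\<in>Basis. f' b *\<^sub>R b)"
    using f' unfolding gderiv_def by simp
  moreover have "D = D'" if "GDERIV \<phi> x :> D" "GDERIV \<phi> x :> D'" for D D'
  proof -
    have "(\<lambda>h. h \<bullet> D) = (\<lambda>h. h \<bullet> D')" using that unfolding gderiv_def by (rule has_derivative_unique)
    then have "(D - D') \<bullet> D = (D - D') \<bullet> D'" by meson
    then have "(D - D') \<bullet> (D - D') = 0" by (simp add: inner_diff_right)
    then show ?thesis by simp
  qed
  ultimately have "\<exists>!D. GDERIV \<phi> x :> D" by blast
  then show ?thesis unfolding gradient_def by (rule theI')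
qed

lemma directional_derivative:
  "((\<lambda>h. (\<phi> (x + h *\<^sub>R v) - \<phi> x) / h) \<longlongrightarrow> gradient \<phi> x \<bullet> v) (at 0)"
proof -
  have "((\<lambda>h. \<phi> (x + h *\<^sub>R v)) has_derivative (\<lambda>h. (h *\<^sub>R v) \<bullet> gradient \<phi> x)) (at 0)"
    by (rule has_derivative_compose[of "\<lambda>h. x + h *\<^sub>R v", where g=\<phi>])
      (use GDERIV_gradient[of x] in \<open>auto intro!: derivative_eq_intros simp: gderiv_def\<close>)
  then have "((\<lambda>h. \<phi> (x + h *\<^sub>R v)) has_field_derivative gradient \<phi> x \<bullet> v) (at 0)"
    by (simp add: has_field_derivative_def inner_commute mult_commute_abs)
  then show ?thesis by (simp add: DERIV_def)
qed

lemma scale_le: "0 \<le> t \<Longrightarrow> t \<le> 1 \<Longrightarrow> \<phi> (t *\<^sub>R x) \<le> t * \<phi> x"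
  using conv[of t 0 x] by simp

lemma scale_le_abs: "\<bar>t\<bar> \<le> 1 \<Longrightarrow> \<phi> (t *\<^sub>R x) \<le> \<phi> x"
proof (cases "t \<ge> 0")
  case True
  assume "\<bar>t\<bar> \<le> 1"
  then have "\<phi> (t *\<^sub>R x) \<le> t * \<phi> x" using scale_le True by simp
  also have "\<dots> \<le> 1 * \<phi> x" using \<open>\<bar>t\<bar> \<le> 1\<close> by (intro mult_right_mono) auto
  finally show ?thesis by simp
next
  case False
  assume t: "\<bar>t\<bar> \<le> 1"
  have "\<phi> (t *\<^sub>R x) = \<phi> ((- t) *\<^sub>R x)" using even[of "t *\<^sub>R x"] by simp
  also have "\<dots> \<le> (- t) * \<phi> x" using False t by (intro scale_le) auto
  also have "\<dots> \<le> 1 * \<phi> x" using t by (intro mult_right_mono) auto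
  finally show ?thesis by simp
qed

text \<open>These bounds do not depend on \<open>h\<close>; they supply the dominating function for
  the first variation of the energy.\<close>

lemma difference_bounds:
  assumes "0 < h" "h \<le> 1"
  shows "(\<phi> (x + h *\<^sub>R v) - \<phi> x) / h \<le> \<phi> (x + v) - \<phi> x"
    and "\<phi> x - \<phi> (x - v) \<le> (\<phi> (x + h *\<^sub>R v) - \<phi> x) / h"
proof -
  have "(1 - h) *\<^sub>R x + h *\<^sub>R (x + v) = x + h *\<^sub>R v" by (simp add: algebra_simps)
  then have "\<phi> (x + h *\<^sub>R v) \<le> (1 - h) * \<phi> x + h * \<phi> (x + v)"
    using conv[of h x "x + v"] assms by simp
  then show "(\<phi> (x + h *\<^sub>R v) - \<phi> x) / h \<le> \<phi> (x + v) - \<phi> x"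
    using assms by (simp add: field_simps)
  \<comment> \<open>With this weight \<open>x\<close> itself is the convex combination of
    \<open>x + h *\<^sub>R v\<close> and \<open>x - v\<close>.\<close>
  define t where "t = h / (1 + h)"
  have t: "0 \<le> t" "t \<le> 1" "1 - t = 1 / (1 + h)" using assms by (auto simp: t_def field_simps)
  have "(1 - t) *\<^sub>R (x + h *\<^sub>R v) + t *\<^sub>R (x - v) = (1 / (1 + h)) *\<^sub>R ((x + h *\<^sub>R v) + h *\<^sub>R (x - v))"
    unfolding t(3) by (simp add: t_def algebra_simps)
  also have "(x + h *\<^sub>R v) + h *\<^sub>R (x - v) = (1 + h) *\<^sub>R x" by (simp add: algebra_simps)
  finally have "\<phi> x \<le> (1 - t) * \<phi> (x + h *\<^sub>R v) + t * \<phi> (x - v)"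
    using conv[of t "x + h *\<^sub>R v" "x - v"] t assms by simp
  also have "\<dots> = (\<phi> (x + h *\<^sub>R v) + h * \<phi> (x - v)) / (1 + h)"
    unfolding t(3) by (simp add: t_def add_divide_distrib)
  finally have "(1 + h) * \<phi> x \<le> \<phi> (x + h *\<^sub>R v) + h * \<phi> (x - v)"
    using assms by (simp add: pos_le_divide_eq mult.commute)
  then show "\<phi> x - \<phi> (x - v) \<le> (\<phi> (x + h *\<^sub>R v) - \<phi> x) / h"
    using assms by (simp add: field_simps)
qed

lemma gradient_le: "\<phi> x + gradient \<phi> x \<bullet> (y - x) \<le> \<phi> y"
proof -
  have "((\<lambda>h. (\<phi> (x + h *\<^sub>R (y - x)) - \<phi> x) / h) \<longlongrightarrow> gradient \<phi> x \<bullet> (y - x)) (at_right 0)"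
    by (rule tendsto_mono[OF _ directional_derivative]) (simp add: at_within_le_at)
  moreover have "\<forall>\<^sub>F h in at_right 0. (\<phi> (x + h *\<^sub>R (y - x)) - \<phi> x) / h \<le> \<phi> y - \<phi> x"
    unfolding eventually_at_right_field
    by (intro exI[of _ 1]) (use difference_bounds(1)[of _ x "y - x"] in auto)
  ultimately have "gradient \<phi> x \<bullet> (y - x) \<le> \<phi> y - \<phi> x"
    by (intro tendsto_upperbound) auto
  then show ?thesis by simp
qed

text \<open>The Delta2 condition is spent on \<open>x\<close> alone. In applications
  \<open>y\<close> is bounded, so the term with \<open>2 *\<^sub>R y\<close> is controlled by
  continuity on a ball.\<close>

lemma sum_bound: obtains C where "C \<ge> 0" "\<And>x y. \<phi> (x + y) \<le> C * \<phi> x + \<phi> (2 *\<^sub>R y) + 1"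
proof -
  obtain C where C: "\<And>x. \<phi> (2 *\<^sub>R x) \<le> C * \<phi> x + 1" using Delta2_ex by blast
  show thesis
  proof (rule that[of "\<bar>C\<bar>"])
    fix x y :: 'a
    have "(1 - 1/2) *\<^sub>R (2 *\<^sub>R x) + (1/2) *\<^sub>R (2 *\<^sub>R y) = x + y" by simp
    then have "\<phi> (x + y) \<le> (1 - 1/2) * \<phi> (2 *\<^sub>R x) + (1/2) * \<phi> (2 *\<^sub>R y)"
      using conv[of "1/2" "2 *\<^sub>R x" "2 *\<^sub>R y"] by simp
    also have "\<dots> \<le> \<phi> (2 *\<^sub>R x) + \<phi> (2 *\<^sub>R y)" using nonneg[of "2 *\<^sub>R x"] nonneg[of "2 *\<^sub>R y"] by argo
    also have "\<phi> (2 *\<^sub>R x) \<le> \<bar>C\<bar> * \<phi> x + 1"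
      using C[of x] mult_right_mono[of C "\<bar>C\<bar>" "\<phi> x"] nonneg[of x] by linarith
    finally show "\<phi> (x + y) \<le> \<bar>C\<bar> * \<phi> x + \<phi> (2 *\<^sub>R y) + 1" by simp
  qed simp
qed

text \<open>Iterating Delta2 reaches every power of 2, and smaller factors only decrease
  \<open>\<phi>\<close>. The bound is needed because membership in \<open>L_phi\<close> speaks of
  some multiple of a function.\<close>

lemma scale_bound: obtains C where "C \<ge> 0" "\<And>x. \<phi> (m *\<^sub>R x) \<le> C * (\<phi> x + 1)"
proof -
  obtain D where D0: "\<And>x. \<phi> (2 *\<^sub>R x) \<le> D * \<phi> x + 1" using Delta2_ex by blast
  define C where "C = \<bar>D\<bar> + 1"
  have C: "\<phi> (2 *\<^sub>R x) \<le> C * \<phi> x + 1" for x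
    using D0[of x] mult_right_mono[of D C "\<phi> x"] nonneg[of x] unfolding C_def by linarith
  have pow: "\<exists>C'\<ge>0. \<forall>x. \<phi> ((2 ^ n) *\<^sub>R x) \<le> C' * (\<phi> x + 1)" for n :: nat
  proof (induction n)
    case 0
    then show ?case by (intro exI[of _ 1]) auto
  next
    case (Suc n)
    then obtain C' where C': "C' \<ge> 0" "\<And>x. \<phi> ((2 ^ n) *\<^sub>R x) \<le> C' * (\<phi> x + 1)" by blast
    have "\<phi> ((2 ^ Suc n) *\<^sub>R x) \<le> (C * C' + 1) * (\<phi> x + 1)" for x
    proof -
      have "\<phi> ((2 ^ Suc n) *\<^sub>R x) \<le> C * \<phi> ((2 ^ n) *\<^sub>R x) + 1" using C[of "(2 ^ n) *\<^sub>R x"] by simp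
      also have "\<dots> \<le> C * (C' * (\<phi> x + 1)) + 1" using C'(2)[of x] by (simp add: C_def mult_left_mono)
      also have "\<dots> \<le> (C * C' + 1) * (\<phi> x + 1)" by (simp add: algebra_simps)
      finally show ?thesis .
    qed
    moreover have "C * C' + 1 \<ge> 0" using C' by (simp add: C_def)
    ultimately show ?case by blast
  qed
  obtain n :: nat where n: "\<bar>m\<bar> < 2 ^ n" using real_arch_pow[of 2 "\<bar>m\<bar>"] by auto
  obtain C' where C': "C' \<ge> 0" "\<And>x. \<phi> ((2 ^ n) *\<^sub>R x) \<le> C' * (\<phi> x + 1)" using pow by blast
  show thesis
  proof (rule that[OF C'(1)])
    fix x
    have "\<phi> (m *\<^sub>R x) = \<phi> ((m / 2 ^ n) *\<^sub>R ((2 ^ n) *\<^sub>R x))" by simp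
    also have "\<dots> \<le> \<phi> ((2 ^ n) *\<^sub>R x)" by (rule scale_le_abs) (use n in \<open>simp add: abs_divide\<close>)
    finally show "\<phi> (m *\<^sub>R x) \<le> C' * (\<phi> x + 1)" using C'(2)[of x] by linarith
  qed
qed

lemma bounded_on_cball: obtains K where "K \<ge> 0" "\<And>x. norm x \<le> R \<Longrightarrow> \<phi> x \<le> K"
proof -
  have "compact (\<phi> ` cball 0 R)" by (intro compact_continuous_image continuous compact_cball)
  then obtain K where "\<And>y. y \<in> \<phi> ` cball 0 R \<Longrightarrow> norm y \<le> K" using compact_imp_bounded bounded_iff by metis
  then have "\<phi> x \<le> \<bar>K\<bar>" if "norm x \<le> R" for x using that by fastforce
  then show thesis using that[of "\<bar>K\<bar>"] by auto
qed

text \<open>Test the supporting hyperplane at \<open>x\<close> one unit step away in the direction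
  of the gradient: the gain is the norm of the gradient, and Delta2 bounds \<open>\<phi>\<close>
  there by its value at \<open>x\<close>.\<close>

lemma norm_gradient_le: obtains C where "C \<ge> 0" "\<And>x. norm (gradient \<phi> x) \<le> C * \<phi> x + C"
proof -
  obtain C where C: "C \<ge> 0" "\<And>x y. \<phi> (x + y) \<le> C * \<phi> x + \<phi> (2 *\<^sub>R y) + 1" using sum_bound by blast
  obtain K where K: "K \<ge> 0" "\<And>x. norm x \<le> 2 \<Longrightarrow> \<phi> x \<le> K" using bounded_on_cball by blast
  have b: "norm (gradient \<phi> x) \<le> C * \<phi> x + (K + 1)" for x
  proof -
    define e where "e = sgn (gradient \<phi> x)"
    have "norm (gradient \<phi> x) = gradient \<phi> x \<bullet> e"
      by (cases "gradient \<phi> x = 0") (auto simp: e_def sgn_div_norm power2_norm_eq_inner[symmetric] power2_eq_square)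
    also have "\<dots> \<le> \<phi> (x + e)" using gradient_le[of x "x + e"] nonneg[of x] by (simp del: nonneg)
    also have "\<dots> \<le> C * \<phi> x + \<phi> (2 *\<^sub>R e) + 1" by (rule C)
    also have "\<phi> (2 *\<^sub>R e) \<le> K" by (rule K) (simp add: e_def norm_sgn)
    finally show ?thesis by simp
  qed
  show thesis
  proof (rule that[of "C + K + 1"])
    fix x
    have "C * \<phi> x \<le> (C + K + 1) * \<phi> x" using K by (intro mult_right_mono) auto
    then show "norm (gradient \<phi> x) \<le> (C + K + 1) * \<phi> x + (C + K + 1)" using b[of x] C by linarith
  qed (use C K in auto)
qed

section \<open>Bijectivity of the gradient and uniform strict convexity on balls\<close>

lemma gradient_inj: assumes "gradient \<phi> x = gradient \<phi> y" shows "x = y"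
proof (rule ccontr)
  assume ne: "x \<noteq> y"
  let ?m = "(1 - 1/2) *\<^sub>R x + (1/2) *\<^sub>R y" and ?g = "gradient \<phi> x"
  have "\<phi> ?m < (1 - 1/2) * \<phi> x + (1/2) * \<phi> y"
    using strict ne unfolding strictly_convex_def by (smt (verit) field_sum_of_halves half_gt_zero_iff)
  moreover have "\<phi> x + ?g \<bullet> (?m - x) \<le> \<phi> ?m" "\<phi> y + ?g \<bullet> (?m - y) \<le> \<phi> ?m"
    using gradient_le[of x ?m] gradient_le[of y ?m] assms by auto
  \<comment> \<open>The linear terms cancel when the two supporting inequalities are averaged, which
    leaves the midpoint value at least the mean.\<close>
  moreover have "?g \<bullet> (?m - x) = - (?g \<bullet> (?m - y))"
    by (simp add: inner_diff_right inner_add_right algebra_simps)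
  ultimately show False by argo
qed

text \<open>A minimum of \<open>\<phi>\<close> minus the linear functional of \<open>\<xi>\<close>
  is a point with gradient \<open>\<xi>\<close>; superlinearity makes this function
  coercive.\<close>

lemma gradient_surj: "\<exists>x. gradient \<phi> x = \<xi>"
proof -
  define f where "f x = \<phi> x - x \<bullet> \<xi>" for x
  \<comment> \<open>This slope makes the linear functional at most half of \<open>\<phi>\<close>
    plus a constant; the \<open>+ 1\<close> admits \<open>\<xi> = 0\<close>.\<close>
  obtain K where K: "\<And>x. norm x \<le> 1 / (2 * (norm \<xi> + 1)) * \<phi> x + K"
    using superlinear[of "1 / (2 * (norm \<xi> + 1))"] by (auto simp: add_nonneg_pos)
  obtain K1 where K1: "\<And>x. norm x \<le> 1 * \<phi> x + K1" using superlinear[of 1] by auto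
  have lower: "f x \<ge> \<phi> x / 2 - norm \<xi> * K" for x
  proof -
    have "x \<bullet> \<xi> \<le> norm \<xi> * norm x" using norm_cauchy_schwarz[of x \<xi>] by (simp add: mult.commute)
    also have "\<dots> \<le> norm \<xi> * (1 / (2 * (norm \<xi> + 1)) * \<phi> x + K)" by (intro mult_left_mono K) auto
    also have "\<dots> = (norm \<xi> / (norm \<xi> + 1)) * (\<phi> x / 2) + norm \<xi> * K"
      by (simp add: algebra_simps)
    also have "(norm \<xi> / (norm \<xi> + 1)) * (\<phi> x / 2) \<le> 1 * (\<phi> x / 2)"
      by (intro mult_right_mono) (auto simp: divide_le_eq add_nonneg_pos)
    finally show ?thesis unfolding f_def by simp
  qed
  \<comment> \<open>Beyond this radius the lower bound exceeds \<open>f 0 = 0\<close>, so a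
    minimiser on the ball is a global one.\<close>
  define R where "R = \<bar>2 * norm \<xi> * K + K1\<bar>"
  have outside: "f 0 \<le> f x" if "norm x > R" for x
  proof -
    have "2 * norm \<xi> * K + K1 < \<phi> x + K1" using that K1[of x] by (simp add: R_def)
    then show ?thesis using lower[of x] by (simp add: f_def)
  qed
  have "continuous_on (cball 0 R) f" unfolding f_def by (intro continuous_intros continuous)
  then obtain x where x: "x \<in> cball 0 R" "\<And>y. y \<in> cball 0 R \<Longrightarrow> f x \<le> f y"
    using continuous_attains_inf[of "cball 0 R" f] by (auto simp: R_def)
  have min: "f x \<le> f y" for y
    using x(2)[of y] x(2)[of 0] outside[of y] by (cases "norm y \<le> R") (auto simp: R_def)
  have "(f has_derivative (\<lambda>h. h \<bullet> gradient \<phi> x - h \<bullet> \<xi>)) (at x)"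
    unfolding f_def using GDERIV_gradient[of x] unfolding gderiv_def
    by (intro has_derivative_diff has_derivative_inner_left has_derivative_ident) auto
  then have "(\<lambda>h. h \<bullet> gradient \<phi> x - h \<bullet> \<xi>) = (\<lambda>h. 0)"
    using differential_zero_maxmin[of x UNIV f] min by auto
  then have "(gradient \<phi> x - \<xi>) \<bullet> gradient \<phi> x - (gradient \<phi> x - \<xi>) \<bullet> \<xi> = 0" by meson
  then have "(gradient \<phi> x - \<xi>) \<bullet> (gradient \<phi> x - \<xi>) = 0" by (simp add: inner_diff_right)
  then show ?thesis by auto
qed

lemma gradient_measurable [measurable]: "gradient \<phi> \<in> borel_measurable borel"
  unfolding borel_measurable_euclidean_space[of "gradient \<phi>"]
proof
  fix i :: 'a
  show "(\<lambda>x. gradient \<phi> x \<bullet> i) \<in> borel_measurable borel"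
  proof (rule borel_measurable_LIMSEQ_real)
    fix x
    have "filterlim (\<lambda>n. 1 / real (Suc n)) (at 0) sequentially"
      using LIMSEQ_inverse_real_of_nat by (auto simp: filterlim_at inverse_eq_divide)
    from filterlim_compose[OF directional_derivative this]
    show "(\<lambda>n. (\<phi> (x + (1 / real (Suc n)) *\<^sub>R i) - \<phi> x) / (1 / real (Suc n))) \<longlonglongrightarrow> gradient \<phi> x \<bullet> i" .
  qed measurable
qed

text \<open>The convexity gap is continuous and positive on the compact set of pairs in the ball at
  distance at least \<open>\<epsilon>\<close>, hence bounded below there. It replaces uniform
  convexity in the compactness argument.\<close>

lemma midpoint_gap:
  assumes "\<epsilon> > 0"
  obtains \<delta> where "\<delta> > 0"
    "\<And>x y. norm x \<le> R \<Longrightarrow> norm y \<le> R \<Longrightarrow> dist x y \<ge> \<epsilon> \<Longrightarrow>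
      \<delta> \<le> \<phi> x / 2 + \<phi> y / 2 - \<phi> ((1/2) *\<^sub>R x + (1/2) *\<^sub>R y)"
proof -
  define S where "S = {p :: 'a \<times> 'a. p \<in> cball 0 R \<times> cball 0 R \<and> dist (fst p) (snd p) \<ge> \<epsilon>}"
  define D where "D p = \<phi> (fst p) / 2 + \<phi> (snd p) / 2 - \<phi> ((1/2) *\<^sub>R fst p + (1/2) *\<^sub>R snd p)" for p :: "'a \<times> 'a"
  have "closed {p :: 'a \<times> 'a. dist (fst p) (snd p) \<ge> \<epsilon>}"
    by (intro closed_Collect_le continuous_intros)
  then have "compact (cball 0 R \<times> cball 0 R \<inter> {p :: 'a \<times> 'a. dist (fst p) (snd p) \<ge> \<epsilon>})"
    by (intro compact_Int_closed compact_Times compact_cball)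
  moreover have "cball 0 R \<times> cball 0 R \<inter> {p :: 'a \<times> 'a. dist (fst p) (snd p) \<ge> \<epsilon>} = S"
    by (auto simp: S_def)
  ultimately have cS: "compact S" by simp
  have cD: "continuous_on S D" unfolding D_def
    by (intro continuous_intros continuous_on_compose2[OF continuous[of UNIV]]) auto
  have pos: "D p > 0" if "p \<in> S" for p
  proof -
    have "fst p \<noteq> snd p" using that assms by (auto simp: S_def)
    then have "\<phi> ((1 - 1/2) *\<^sub>R fst p + (1/2) *\<^sub>R snd p) < (1 - 1/2) * \<phi> (fst p) + (1/2) * \<phi> (snd p)"
      using strict unfolding strictly_convex_def by (metis half_gt_zero_iff less_half_sum one_add_one zero_less_one field_sum_of_halves half_gt_zero less_add_same_cancel1)
    then show ?thesis by (simp add: D_def)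
  qed
  show thesis
  proof (cases "S = {}")
    case True
    show thesis by (rule that[of 1]) (use True in \<open>force simp: S_def\<close>)+
  next
    case False
    obtain p where p: "p \<in> S" "\<And>q. q \<in> S \<Longrightarrow> D p \<le> D q"
      using continuous_attains_inf[OF cS False cD] by blast
    show thesis
    proof (rule that[OF pos[OF p(1)]])
      fix x y :: 'a assume "norm x \<le> R" "norm y \<le> R" "dist x y \<ge> \<epsilon>"
      then have "(x, y) \<in> S" by (auto simp: S_def)
      from p(2)[OF this] show "D p \<le> \<phi> x / 2 + \<phi> y / 2 - \<phi> ((1/2) *\<^sub>R x + (1/2) *\<^sub>R y)"
        by (simp add: D_def)
    qed
  qed
qed

end

section \<open>Regular functions\<close>

text \<open>Regularity with the limit superior of the Clarke derivative unfolded: \<open>d x v\<close> is the one-sided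
  directional derivative, and it bounds the difference quotients at all points near \<open>x\<close>.\<close>

definition regular_derivative :: "('a::real_normed_vector \<Rightarrow> real) \<Rightarrow> ('a \<Rightarrow> 'a \<Rightarrow> real) \<Rightarrow> bool" where
  "regular_derivative f d \<longleftrightarrow>
     (\<forall>x v. ((\<lambda>h. (f (x + h *\<^sub>R v) - f x) / h) \<longlongrightarrow> d x v) (at_right 0) \<and>
        (\<forall>e>0. \<exists>\<delta>>0. \<forall>y h. dist y x < \<delta> \<longrightarrow> 0 < h \<longrightarrow> h < \<delta> \<longrightarrow> (f (y + h *\<^sub>R v) - f y) / h < d x v + e))"

lemma clarke_regular_imp_regular_derivative:
  fixes f :: "'a::real_inner \<Rightarrow> real"
  assumes "clarke_regular f"
  obtains d where "regular_derivative f d" "\<And>x. clarke_gradient f x = {\<xi>. \<forall>v. \<xi> \<bullet> v \<le> d x v}"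
proof -
  define A where "A x v c \<longleftrightarrow> ((\<lambda>h. (f (x + h *\<^sub>R v) - f x) / h) \<longlongrightarrow> c) (at_right 0) \<and>
      clarke_derivative f x v = ereal c" for x v c
  define d where "d x v = (SOME c. A x v c)" for x v
  have "A x v (d x v)" for x v
  proof -
    have "\<exists>c. A x v c" using assms unfolding clarke_regular_def A_def by blast
    then show ?thesis unfolding d_def by (rule someI_ex)
  qed
  then have d: "((\<lambda>h. (f (x + h *\<^sub>R v) - f x) / h) \<longlongrightarrow> d x v) (at_right 0)"
      "clarke_derivative f x v = ereal (d x v)" for x v
    by (simp_all only: A_def)
  have "\<exists>\<delta>>0. \<forall>y h. dist y x < \<delta> \<longrightarrow> 0 < h \<longrightarrow> h < \<delta> \<longrightarrow> (f (y + h *\<^sub>R v) - f y) / h < d x v + e"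
    if e: "e > 0" for x v e
  proof -
    have "Limsup (nhds x \<times>\<^sub>F at_right 0) (\<lambda>(y, h). ereal ((f (y + h *\<^sub>R v) - f y) / h)) < ereal (d x v + e)"
      using d(2)[of x v] e unfolding clarke_derivative_def by simp
    then have "\<forall>\<^sub>F p in nhds x \<times>\<^sub>F at_right 0. (\<lambda>(y, h). ereal ((f (y + h *\<^sub>R v) - f y) / h)) p < ereal (d x v + e)"
      by (rule Limsup_lessD)
    then obtain P Q where PQ: "eventually P (nhds x)" "eventually Q (at_right (0::real))"
        "\<And>y h. P y \<Longrightarrow> Q h \<Longrightarrow> (f (y + h *\<^sub>R v) - f y) / h < d x v + e"
      unfolding eventually_prod_filter by auto
    obtain \<delta>1 where 1: "\<delta>1 > 0" "\<And>y. dist y x < \<delta>1 \<Longrightarrow> P y" using PQ(1) unfolding eventually_nhds_metric by blast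
    obtain \<delta>2 where 2: "\<delta>2 > 0" "\<And>h. 0 < h \<Longrightarrow> h < \<delta>2 \<Longrightarrow> Q h" using PQ(2) unfolding eventually_at_right_field by blast
    show ?thesis by (rule exI[of _ "min \<delta>1 \<delta>2"]) (use 1 2 PQ(3) in auto)
  qed
  then have "regular_derivative f d" using d(1) unfolding regular_derivative_def by blast
  moreover have "clarke_gradient f x = {\<xi>. \<forall>v. \<xi> \<bullet> v \<le> d x v}" for x
    unfolding clarke_gradient_def by (simp add: d(2))
  ultimately show thesis by (rule that)
qed

lemma regular_derivativeD:
  assumes "regular_derivative f d"
  shows "((\<lambda>h. (f (x + h *\<^sub>R v) - f x) / h) \<longlongrightarrow> d x v) (at_right 0)"
    and "e > 0 \<Longrightarrow> \<exists>\<delta>>0. \<forall>y h. dist y x < \<delta> \<longrightarrow> 0 < h \<longrightarrow> h < \<delta> \<longrightarrow> (f (y + h *\<^sub>R v) - f y) / h < d x v + e"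
  using assms unfolding regular_derivative_def by blast+

text \<open>Serves the exceptional times, at which the integrand is replaced by zero.\<close>

lemma regular_derivative_zero: "regular_derivative (\<lambda>_. 0) (\<lambda>_ _. 0)"
  unfolding regular_derivative_def by (auto intro: exI[of _ 1])

lemma regular_derivative_0:
  assumes "regular_derivative f d" shows "d x 0 = 0"
  using regular_derivativeD(1)[OF assms, of x 0] by (simp add: tendsto_const_iff)

text \<open>Substitute \<open>h * t\<close> for the step. The limit form is used for variations
  whose size depends on time.\<close>

lemma regular_derivative_scale:
  assumes "regular_derivative f d" "t \<ge> 0"
  shows "((\<lambda>h. (f (x + h *\<^sub>R (t *\<^sub>R v)) - f x) / h) \<longlongrightarrow> t * d x v) (at_right 0)"
proof (cases "t = 0")
  case False
  then have t: "t > 0" using assms by simp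
  have "filterlim (\<lambda>h. h * t) (at_right 0) (at_right 0)"
  proof -
    have "((\<lambda>h::real. h * t) \<longlongrightarrow> 0) (at_right 0)" by (auto intro!: tendsto_eq_intros)
    moreover have "\<forall>\<^sub>F h in at_right 0. h * t \<in> {0<..}" unfolding eventually_at_right_field using t by (intro exI[of _ 1]) auto
    ultimately show ?thesis by (intro tendsto_imp_filterlim_at_right) auto
  qed
  from tendsto_mult[OF tendsto_const[of t] filterlim_compose[OF regular_derivativeD(1)[OF assms(1), of x v] this]]
  have "((\<lambda>h. t * ((f (x + (h * t) *\<^sub>R v) - f x) / (h * t))) \<longlongrightarrow> t * d x v) (at_right 0)" .
  moreover have "(\<lambda>h. t * ((f (x + (h * t) *\<^sub>R v) - f x) / (h * t))) = (\<lambda>h. (f (x + h *\<^sub>R (t *\<^sub>R v)) - f x) / h)"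
    by (rule ext) (use t in simp)
  ultimately show ?thesis by simp
qed simp

lemma regular_derivative_pos_homogeneous:
  assumes "regular_derivative f d" "t \<ge> 0"
  shows "d x (t *\<^sub>R v) = t * d x v"
  by (rule tendsto_unique[OF _ regular_derivativeD(1)[OF assms(1)] regular_derivative_scale[OF assms]]) simp

text \<open>Split the increment into one along \<open>v\<close> from \<open>x\<close> and one along
  \<open>w\<close> from \<open>x + h *\<^sub>R v\<close>. The second base point moves with
  \<open>h\<close>, and it is the uniform bound for base points near \<open>x\<close> that covers
  it.\<close>

lemma regular_derivative_subadditive:
  assumes f: "regular_derivative f d"
  shows "d x (v + w) \<le> d x v + d x w"
proof (rule field_le_epsilon)
  fix e :: real assume e: "e > 0"
  obtain \<delta>1 where 1: "\<delta>1 > 0" "\<And>y h. dist y x < \<delta>1 \<Longrightarrow> 0 < h \<Longrightarrow> h < \<delta>1 \<Longrightarrow> (f (y + h *\<^sub>R v) - f y) / h < d x v + e / 2"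
    using regular_derivativeD(2)[OF f half_gt_zero[OF e]] by blast
  obtain \<delta>2 where 2: "\<delta>2 > 0" "\<And>y h. dist y x < \<delta>2 \<Longrightarrow> 0 < h \<Longrightarrow> h < \<delta>2 \<Longrightarrow> (f (y + h *\<^sub>R w) - f y) / h < d x w + e / 2"
    using regular_derivativeD(2)[OF f half_gt_zero[OF e]] by blast
  \<comment> \<open>The last entry keeps the shifted base point within \<open>\<delta>2\<close> of
    \<open>x\<close>; the \<open>+ 1\<close> admits \<open>v = 0\<close>.\<close>
  define \<delta> where "\<delta> = min (min \<delta>1 \<delta>2) (\<delta>2 / (norm v + 1))"
  have \<delta>: "\<delta> > 0" using 1 2 by (simp add: \<delta>_def add_nonneg_pos)
  have "(f (x + h *\<^sub>R (v + w)) - f x) / h \<le> d x v + d x w + e" if h: "0 < h" "h < \<delta>" for h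
  proof -
    have "h * norm v \<le> h * (norm v + 1)" using h by (intro mult_left_mono) auto
    also have "\<dots> < \<delta>2" using h by (simp add: \<delta>_def pos_less_divide_eq[symmetric] add_nonneg_pos)
    finally have "dist (x + h *\<^sub>R v) x < \<delta>2" using h by (simp add: dist_norm)
    then have "(f (x + h *\<^sub>R v + h *\<^sub>R w) - f (x + h *\<^sub>R v)) / h < d x w + e / 2" using h by (intro 2) (auto simp: \<delta>_def)
    moreover have "(f (x + h *\<^sub>R v) - f x) / h < d x v + e / 2" using h 1 by (intro 1) (auto simp: \<delta>_def)
    moreover have "(f (x + h *\<^sub>R (v + w)) - f x) / h =
        (f (x + h *\<^sub>R v + h *\<^sub>R w) - f (x + h *\<^sub>R v)) / h + (f (x + h *\<^sub>R v) - f x) / h"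
      by (simp add: scaleR_add_right add.assoc diff_divide_distrib)
    ultimately show ?thesis by linarith
  qed
  then have "\<forall>\<^sub>F h in at_right 0. (f (x + h *\<^sub>R (v + w)) - f x) / h \<le> d x v + d x w + e"
    unfolding eventually_at_right_field using \<delta> by blast
  with regular_derivativeD(1)[OF f] show "d x (v + w) \<le> d x v + d x w + e"
    by (rule tendsto_upperbound) simp
qed

text \<open>Let the step tend to 0 in the bound that holds for all base points near
  \<open>x\<close>.\<close>

lemma regular_derivative_usc:
  assumes f: "regular_derivative f d" and e: "e > 0"
  obtains \<delta> where "\<delta> > 0" "\<And>y. dist y x < \<delta> \<Longrightarrow> d y v \<le> d x v + e"
proof -
  obtain \<delta> where \<delta>: "\<delta> > 0" "\<And>y h. dist y x < \<delta> \<Longrightarrow> 0 < h \<Longrightarrow> h < \<delta> \<Longrightarrow> (f (y + h *\<^sub>R v) - f y) / h < d x v + e"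
    using regular_derivativeD(2)[OF f e] by blast
  show thesis
  proof (rule that[OF \<delta>(1)])
    fix y assume "dist y x < \<delta>"
    then have "\<forall>\<^sub>F h in at_right 0. (f (y + h *\<^sub>R v) - f y) / h \<le> d x v + e"
      unfolding eventually_at_right_field using \<delta> by (intro exI[of _ \<delta>]) (auto intro: less_imp_le)
    with regular_derivativeD(1)[OF f] show "d y v \<le> d x v + e" by (rule tendsto_upperbound) simp
  qed
qed

text \<open>A finite-dimensional Hahn-Banach argument: \<open>d x\<close> is sublinear, so its
  strict epigraph is convex and misses the origin; a separating hyperplane, scaled to have last
  coefficient 1, is the graph of a linear minorant.\<close>

lemma regular_derivative_subgradient:
  fixes f :: "'a::euclidean_space \<Rightarrow> real"
  assumes f: "regular_derivative f d"
  obtains \<xi> where "\<And>v. \<xi> \<bullet> v \<le> d x v"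
proof -
  define S where "S = {p :: 'a \<times> real. d x (fst p) < snd p}"
  have cS: "convex S"
  proof (rule convexI)
    fix p q :: "'a \<times> real" and u v :: real
    assume *: "p \<in> S" "q \<in> S" "0 \<le> u" "0 \<le> v" "u + v = 1"
    have "d x (u *\<^sub>R fst p + v *\<^sub>R fst q) \<le> u * d x (fst p) + v * d x (fst q)"
      using regular_derivative_subadditive[OF f, of x "u *\<^sub>R fst p" "v *\<^sub>R fst q"] * regular_derivative_pos_homogeneous[OF f]
      by simp
    also have "\<dots> < u * snd p + v * snd q"
    proof (cases "u = 0")
      case True
      then show ?thesis using * by (simp add: S_def)
    next
      case False
      then have "u * d x (fst p) < u * snd p" using * by (simp add: S_def)
      moreover have "v * d x (fst q) \<le> v * snd q" using * by (intro mult_left_mono) (auto simp: S_def)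
      ultimately show ?thesis by linarith
    qed
    finally show "u *\<^sub>R p + v *\<^sub>R q \<in> S" by (simp add: S_def)
  qed
  have "0 \<notin> S" using regular_derivative_0[OF f] by (simp add: S_def)
  from separating_hyperplane_set_0[OF cS this]
  obtain a where a: "a \<noteq> 0" "\<forall>p\<in>S. 0 \<le> a \<bullet> p" by blast
  have ineq: "0 \<le> fst a \<bullet> v + snd a * r" if "d x v < r" for v r
    using bspec[OF a(2), of "(v, r)"] that by (simp add: S_def inner_prod_def)
  have nn: "snd a \<ge> 0" using ineq[of 0 1] regular_derivative_0[OF f] by simp
  \<comment> \<open>A vertical hyperplane is impossible: the direction \<open>- fst a\<close> would
    force the normal vector to vanish.\<close>
  have pos: "snd a > 0"
  proof (rule ccontr)
    assume "\<not> snd a > 0"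
    then have z: "snd a = 0" using nn by simp
    then have "0 \<le> fst a \<bullet> (- fst a)" using ineq[of "- fst a" "d x (- fst a) + 1"] by simp
    then have "fst a \<bullet> fst a \<le> 0" by simp
    then have "fst a = 0" using inner_ge_zero[of "fst a"] by (metis order_antisym inner_eq_zero_iff)
    then show False using z a(1) by (simp add: prod_eq_iff)
  qed
  show thesis
  proof (rule that[of "- (1 / snd a) *\<^sub>R fst a"])
    fix v
    have "- (fst a \<bullet> v) / snd a \<le> d x v"
    proof (rule field_le_epsilon)
      fix e :: real assume "e > 0"
      then have "0 \<le> fst a \<bullet> v + snd a * (d x v + e)" by (intro ineq) simp
      then show "- (fst a \<bullet> v) / snd a \<le> d x v + e" using pos by (simp add: field_simps)
    qed
    then show "(- (1 / snd a) *\<^sub>R fst a) \<bullet> v \<le> d x v" by simp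
  qed
qed

lemma locally_lipschitz_continuous:
  assumes "locally_lipschitz f" shows "continuous_on S f"
proof (rule continuous_at_imp_continuous_on, rule ballI)
  fix x
  obtain r L where r: "r > 0" "L-lipschitz_on (ball x r) f" using assms unfolding locally_lipschitz_def by blast
  from lipschitz_on_continuous_on[OF r(2)] r(1) show "isCont f x"
    by (simp add: continuous_on_eq_continuous_at)
qed

text \<open>Maximising \<open>s \<mapsto> f (x + s v) - M' s\<close> over \<open>[0, 1]\<close> yields a point at which the left
  derivative is at least \<open>M'\<close>; upper semicontinuity of \<open>d\<close> in direction \<open>- v\<close> carries this
  estimate to nearby points of the dense set.\<close>

lemma regular_derivative_lipschitz:
  fixes f :: "'a::euclidean_space \<Rightarrow> real"
  assumes f: "regular_derivative f d" and cont: "continuous_on UNIV f"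
    and D: "closure D = UNIV" and O': "open O'" "convex O'"
    and M: "\<And>y \<xi>. y \<in> D \<Longrightarrow> y \<in> O' \<Longrightarrow> (\<And>v. \<xi> \<bullet> v \<le> d y v) \<Longrightarrow> norm \<xi> \<le> M"
    and xy: "x \<in> O'" "y \<in> O'"
  shows "\<bar>f x - f y\<bar> \<le> M * norm (x - y)"
proof -
  have *: "f y - f x \<le> M * norm (y - x)" if xy: "x \<in> O'" "y \<in> O'" for x y
  proof (rule ccontr)
    assume neg: "\<not> f y - f x \<le> M * norm (y - x)"
    define v where "v = y - x"
    \<comment> \<open>A slope strictly between the claimed bound and the actual increment.\<close>
    define M' where "M' = (f y - f x + M * norm v) / 2"
    have M': "M * norm v < M'" "M' < f y - f x" using neg by (auto simp: M'_def v_def)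
    define G where "G s = f (x + s *\<^sub>R v) - M' * s" for s
    have "continuous_on {0..1} G" unfolding G_def
      by (intro continuous_intros continuous_on_compose2[OF cont]) auto
    then obtain s where s: "s \<in> {0..1}" "\<And>r. r \<in> {0..1} \<Longrightarrow> G r \<le> G s"
      using continuous_attains_sup[of "{0..1}" G] by auto
    have "G 0 < G 1" using M' by (simp add: G_def v_def)
    \<comment> \<open>The maximiser may be the right end but not the left one, so there are points
      to its left to compare with.\<close>
    then have s0: "s > 0" using s(1) s(2)[of 1] by (cases "s = 0") auto
    define z where "z = x + s *\<^sub>R v"
    have "x + s *\<^sub>R (y - x) \<in> O'" using convexD_alt[OF O'(2) xy, of s] s(1) by (simp add: algebra_simps)
    then have z: "z \<in> O'" by (simp add: z_def v_def)
    have "\<forall>\<^sub>F h in at_right 0. (f (z + h *\<^sub>R (- v)) - f z) / h \<le> - M'"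
      unfolding eventually_at_right_field
    proof (intro exI[of _ s] conjI s0 allI impI)
      fix h assume h: "0 < h" "h < s"
      have "G (s - h) \<le> G s" using s(1) h by (intro s(2)) auto
      moreover have "z + h *\<^sub>R (- v) = x + (s - h) *\<^sub>R v" by (simp add: z_def algebra_simps)
      ultimately show "(f (z + h *\<^sub>R (- v)) - f z) / h \<le> - M'"
        using h by (simp add: G_def z_def pos_divide_le_eq algebra_simps)
    qed
    with regular_derivativeD(1)[OF f] have dz: "d z (- v) \<le> - M'" by (rule tendsto_upperbound) simp
    define e where "e = (M' - M * norm v) / 2"
    have e: "e > 0" using M' by (simp add: e_def)
    obtain \<delta> where \<delta>: "\<delta> > 0" "\<And>w. dist w z < \<delta> \<Longrightarrow> d w (- v) \<le> d z (- v) + e"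
      using regular_derivative_usc[OF f e] by blast
    obtain \<rho> where \<rho>: "\<rho> > 0" "ball z \<rho> \<subseteq> O'" using O'(1) z open_contains_ball by blast
    obtain w where w: "w \<in> D" "dist w z < min \<delta> \<rho>"
    proof -
      have "z \<in> closure D" "min \<delta> \<rho> > 0" using D \<delta>(1) \<rho>(1) by auto
      then show thesis using that unfolding closure_approachable by blast
    qed
    obtain \<xi> where \<xi>: "\<And>v. \<xi> \<bullet> v \<le> d w v" using regular_derivative_subgradient[OF f] by blast
    have "w \<in> O'" using w \<rho> by (auto simp: dist_commute)
    then have "norm \<xi> \<le> M" using M[of w \<xi>] w \<xi> by blast
    then have "norm \<xi> * norm v \<le> M * norm v" by (rule mult_right_mono) simp
    then have "\<xi> \<bullet> v \<le> M * norm v" using norm_cauchy_schwarz[of \<xi> v] by linarith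
    moreover have "- (\<xi> \<bullet> v) \<le> d z (- v) + e" using \<xi>[of "- v"] \<delta>(2)[of w] w by simp
    ultimately show False using dz M' by (simp add: e_def field_simps)
  qed
  show ?thesis using *[of x y] *[of y x] xy by (auto simp: norm_minus_commute abs_le_iff)
qed

lemma regular_derivative_bound:
  assumes f: "regular_derivative f d" and O': "open O'" "x \<in> O'"
    and L: "\<And>x y. x \<in> O' \<Longrightarrow> y \<in> O' \<Longrightarrow> \<bar>f x - f y\<bar> \<le> M * norm (x - y)"
  shows "\<bar>d x v\<bar> \<le> M * norm v"
proof -
  have "((\<lambda>h. x + h *\<^sub>R v) \<longlongrightarrow> x) (at_right 0)" by (auto intro!: tendsto_eq_intros)
  then have "\<forall>\<^sub>F h in at_right 0. x + h *\<^sub>R v \<in> O'" using O' by (rule topological_tendstoD)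
  moreover have "\<forall>\<^sub>F h in at_right (0::real). 0 < h" by (simp add: eventually_at_right_less)
  ultimately have "\<forall>\<^sub>F h in at_right 0. \<bar>(f (x + h *\<^sub>R v) - f x) / h\<bar> \<le> M * norm v"
  proof eventually_elim
    case (elim h)
    then have "\<bar>f (x + h *\<^sub>R v) - f x\<bar> \<le> M * norm (h *\<^sub>R v)" using L[OF elim(1) O'(2)] by simp
    then show ?case using elim by (simp add: abs_divide pos_divide_le_eq mult_ac)
  qed
  with tendsto_rabs[OF regular_derivativeD(1)[OF f]] show ?thesis by (rule tendsto_upperbound) simp
qed

section \<open>Derivatives of finite energy\<close>

lemma integrable_lebesgue_on_iff:
  fixes f :: "real \<Rightarrow> 'a::euclidean_space"
  shows "integrable (lebesgue_on {a..b}) f \<longleftrightarrow> f absolutely_integrable_on {a..b}"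
  by (simp add: integrable_restrict_space set_integrable_def)

lemma integral_lebesgue_on:
  fixes f :: "real \<Rightarrow> 'a::euclidean_space"
  assumes "integrable (lebesgue_on {a..b}) f"
  shows "(LINT t|lebesgue_on {a..b}. f t) = integral {a..b} f" "f integrable_on {a..b}"
  using has_integral_integral_lebesgue_on[OF assms] by (auto simp: integral_unique has_integral_integrable)

lemma finite_measure_lebesgue_on_Icc: "finite_measure (lebesgue_on {a..b::real})"
  by (rule finite_measure_lebesgue_on) simp

lemma measure_lebesgue_on_Icc: "a \<le> b \<Longrightarrow> measure (lebesgue_on {a..b::real}) {a..b} = b - a"
  by (simp add: measure_restrict_space)

lemma norm_integral_diff_le:
  fixes f g :: "real \<Rightarrow> 'a::euclidean_space"
  assumes f: "integrable (lebesgue_on {a..b}) f" and g: "integrable (lebesgue_on {a..b}) g" and t: "t \<in> {a..b}"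
  shows "norm (integral {a..t} f - integral {a..t} g) \<le> (LINT s|lebesgue_on {a..b}. norm (f s - g s))"
proof -
  have sub: "{a..t} \<subseteq> {a..b}" using t by auto
  have d: "integrable (lebesgue_on {a..b}) (\<lambda>s. f s - g s)" using f g by simp
  note fi = integrable_subinterval_real[OF integral_lebesgue_on(2)[OF f] sub]
    and gi = integrable_subinterval_real[OF integral_lebesgue_on(2)[OF g] sub]
    and ni = integral_lebesgue_on(2)[OF integrable_norm[OF d]]
  have "norm (integral {a..t} f - integral {a..t} g) = norm (integral {a..t} (\<lambda>s. f s - g s))"
    using fi gi by (simp add: Henstock_Kurzweil_Integration.integral_diff)
  also have "\<dots> \<le> integral {a..t} (\<lambda>s. norm (f s - g s))"
    by (rule integral_norm_bound_integral) (use fi gi integrable_subinterval_real[OF ni sub] in \<open>auto intro: integrable_diff\<close>)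
  also have "\<dots> \<le> integral {a..b} (\<lambda>s. norm (f s - g s))"
    by (rule integral_subset_le[OF sub integrable_subinterval_real[OF ni sub] ni]) auto
  also have "\<dots> = (LINT s|lebesgue_on {a..b}. norm (f s - g s))"
    using integral_lebesgue_on(1)[OF integrable_norm[OF d]] by simp
  finally show ?thesis .
qed

text \<open>Along a subsequence consecutive terms differ by more than \<open>(1/2)^i\<close> only on
  a set of measure at most \<open>(1/2)^i\<close>. By Borel-Cantelli almost every point lies in
  finitely many of these sets, and there the telescoping series converges.\<close>

lemma Cauchy_in_measure_subseq:
  fixes f :: "nat \<Rightarrow> 'a \<Rightarrow> 'b::euclidean_space"
  assumes fin: "finite_measure M" and meas [measurable]: "\<And>i. f i \<in> borel_measurable M"
    and Cauchy: "\<And>\<epsilon>. \<epsilon> > 0 \<Longrightarrow> \<exists>N. \<forall>j\<ge>N. \<forall>k\<ge>N. measure M {x \<in> space M. \<epsilon> \<le> dist (f j x) (f k x)} \<le> \<epsilon>"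
  obtains r where "strict_mono (r :: nat \<Rightarrow> nat)" "AE x in M. convergent (\<lambda>i. f (r i) x)"
proof -
  interpret finite_measure M by (rule fin)
  have "\<forall>i. \<exists>N. \<forall>j\<ge>N. \<forall>k\<ge>N. measure M {x \<in> space M. (1/2)^i \<le> dist (f j x) (f k x)} \<le> (1/2)^i"
    using Cauchy by simp
  then obtain N where N: "\<And>i j k. j \<ge> N i \<Longrightarrow> k \<ge> N i \<Longrightarrow>
      measure M {x \<in> space M. (1/2)^i \<le> dist (f j x) (f k x)} \<le> (1/2)^i" by metis
  \<comment> \<open>Summing the thresholds makes the indices exceed each \<open>N i\<close>; the
    extra \<open>i\<close> makes them strictly increasing.\<close>
  define r where "r i = i + (\<Sum>l\<le>i. N l)" for i
  have sm: "strict_mono r" by (rule strict_monoI_Suc) (simp add: r_def)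
  have rN: "r i \<ge> N i" "r (Suc i) \<ge> N i" for i
  proof -
    have "N i \<le> (\<Sum>l\<le>i. N l)" by (rule member_le_sum) auto
    then show "r i \<ge> N i" "r (Suc i) \<ge> N i" by (auto simp: r_def)
  qed
  define A where "A i = {x \<in> space M. (1/2)^i \<le> dist (f (r i) x) (f (r (Suc i)) x)}" for i
  have A [measurable]: "A i \<in> sets M" for i unfolding A_def by measurable
  have "AE x in M. eventually (\<lambda>i. x \<in> space M - A i) sequentially"
  proof (rule borel_cantelli_AE1)
    show "emeasure M (A i) < \<infinity>" for i by (simp add: less_top[symmetric])
    have "summable (\<lambda>i. (1/2::real)^i)" by (rule summable_geometric) simp
    then show "summable (\<lambda>i. measure M (A i))"
      by (rule summable_comparison_test'[where N=0]) (use N[OF rN] in \<open>auto simp: A_def\<close>)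
  qed simp
  then have "AE x in M. convergent (\<lambda>i. f (r i) x)"
  proof eventually_elim
    case (elim x)
    then obtain n where n: "\<And>i. i \<ge> n \<Longrightarrow> x \<in> space M - A i" by (auto simp: eventually_sequentially)
    have "summable (\<lambda>i. f (r (Suc i)) x - f (r i) x)"
    proof (rule summable_comparison_test'[where N=n])
      show "summable (\<lambda>i. (1/2::real)^i)" by (rule summable_geometric) simp
      show "norm (f (r (Suc i)) x - f (r i) x) \<le> (1/2)^i" if "i \<ge> n" for i
        using n[OF that] by (auto simp: A_def dist_norm norm_minus_commute)
    qed
    then have "convergent (\<lambda>m. \<Sum>i<m. f (r (Suc i)) x - f (r i) x)" by (simp add: summable_iff_convergent)
    then have "convergent (\<lambda>m. f (r m) x - f (r 0) x)" by (simp only: sum_lessThan_telescope[where f="\<lambda>i. f (r i) x"])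
    then have "convergent (\<lambda>m. (f (r m) x - f (r 0) x) + f (r 0) x)" by (intro convergent_add convergent_const)
    then show ?case by simp
  qed
  with sm show thesis by (rule that)
qed

context smooth_G_function
begin

text \<open>Under Delta2 this is the same as membership in \<open>L_phi\<close>, and no scaling
  factor has to be carried along.\<close>

definition finite_energy :: "real \<Rightarrow> (real \<Rightarrow> 'a) \<Rightarrow> bool" where
  "finite_energy T w \<longleftrightarrow> w \<in> borel_measurable (lebesgue_on {0..T}) \<and> integrable (lebesgue_on {0..T}) (\<lambda>t. \<phi> (w t))"

lemma finite_energy_measurable: "finite_energy T w \<Longrightarrow> w \<in> borel_measurable (lebesgue_on {0..T})"
  and finite_energy_integrable_phi: "finite_energy T w \<Longrightarrow> integrable (lebesgue_on {0..T}) (\<lambda>t. \<phi> (w t))"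
  by (simp_all add: finite_energy_def)

lemma finite_energy_integrable:
  assumes "finite_energy T w" shows "integrable (lebesgue_on {0..T}) w"
proof -
  interpret finite_measure "lebesgue_on {0..T}" by (rule finite_measure_lebesgue_on_Icc)
  obtain K where K: "\<And>x. norm x \<le> 1 * \<phi> x + K" using superlinear[of 1] by auto
  show ?thesis
  proof (rule Bochner_Integration.integrable_bound)
    show "integrable (lebesgue_on {0..T}) (\<lambda>t. \<phi> (w t) + K)"
      using finite_energy_integrable_phi[OF assms] by simp
    show "AE t in lebesgue_on {0..T}. norm (w t) \<le> norm (\<phi> (w t) + K)"
      using K by (intro AE_I2) (smt (verit) real_norm_def norm_ge_zero)
  qed (use assms in \<open>simp add: finite_energy_def\<close>)
qed

lemma finite_energy_bound:
  assumes "w \<in> borel_measurable (lebesgue_on {0..T})" "integrable (lebesgue_on {0..T}) g"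
    "AE t in lebesgue_on {0..T}. \<phi> (w t) \<le> g t"
  shows "finite_energy T w"
  unfolding finite_energy_def
proof
  have [measurable]: "w \<in> borel_measurable (lebesgue_on {0..T})" by fact
  show "integrable (lebesgue_on {0..T}) (\<lambda>t. \<phi> (w t))"
  proof (rule Bochner_Integration.integrable_bound[OF assms(2)])
    show "AE t in lebesgue_on {0..T}. norm (\<phi> (w t)) \<le> norm (g t)"
      using assms(3) by eventually_elim (use nonneg in \<open>smt (verit) real_norm_def\<close>)
  qed measurable
qed fact

text \<open>Makes the variations admissible: their derivatives are bounded functions.\<close>

lemma finite_energy_add_bounded:
  assumes v: "finite_energy T v" and [measurable]: "h \<in> borel_measurable (lebesgue_on {0..T})"
    and R: "\<And>t. norm (h t) \<le> R"
  shows "finite_energy T (\<lambda>t. v t + h t)"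
proof -
  interpret finite_measure "lebesgue_on {0..T}" by (rule finite_measure_lebesgue_on_Icc)
  have [measurable]: "v \<in> borel_measurable (lebesgue_on {0..T})" using finite_energy_measurable[OF v] .
  obtain C where C: "C \<ge> 0" "\<And>x y. \<phi> (x + y) \<le> C * \<phi> x + \<phi> (2 *\<^sub>R y) + 1" using sum_bound by blast
  obtain K where K: "\<And>x. norm x \<le> 2 * R \<Longrightarrow> \<phi> x \<le> K" using bounded_on_cball by blast
  show ?thesis
  proof (rule finite_energy_bound)
    show "integrable (lebesgue_on {0..T}) (\<lambda>t. C * \<phi> (v t) + K + 1)"
      using finite_energy_integrable_phi[OF v] by simp
    show "AE t in lebesgue_on {0..T}. \<phi> (v t + h t) \<le> C * \<phi> (v t) + K + 1"
    proof (rule AE_I2)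
      fix t
      have "\<phi> (2 *\<^sub>R h t) \<le> K" using R[of t] by (intro K) simp
      then show "\<phi> (v t + h t) \<le> C * \<phi> (v t) + K + 1" using C(2)[of "v t" "h t"] by linarith
    qed
  qed measurable
qed

lemma finite_energy_midpoint:
  assumes "finite_energy T v" "finite_energy T w"
  shows "finite_energy T (\<lambda>t. (1/2) *\<^sub>R v t + (1/2) *\<^sub>R w t)"
proof (rule finite_energy_bound)
  have [measurable]: "v \<in> borel_measurable (lebesgue_on {0..T})" "w \<in> borel_measurable (lebesgue_on {0..T})"
    using assms by (auto simp: finite_energy_def)
  show "(\<lambda>t. (1/2) *\<^sub>R v t + (1/2) *\<^sub>R w t) \<in> borel_measurable (lebesgue_on {0..T})" by measurable
  show "integrable (lebesgue_on {0..T}) (\<lambda>t. \<phi> (v t) / 2 + \<phi> (w t) / 2)"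
    using assms by (simp add: finite_energy_def)
  show "AE t in lebesgue_on {0..T}. \<phi> ((1/2) *\<^sub>R v t + (1/2) *\<^sub>R w t) \<le> \<phi> (v t) / 2 + \<phi> (w t) / 2"
    using conv[of "1/2"] by (intro AE_I2) simp
qed

text \<open>If two values differ by \<open>\<epsilon>\<close>, then either the convexity gap is at
  least \<open>\<delta>\<close> or one of them has norm above \<open>R\<close>. Markov's inequality
  gives each of these three events measure at most \<open>\<epsilon> / 3\<close>.\<close>

lemma small_energy_gap_imp_close:
  assumes T: "0 \<le> T" and \<epsilon>: "\<epsilon> > 0"
  obtains \<eta> where "\<eta> > 0"
    "\<And>v w. finite_energy T v \<Longrightarrow> finite_energy T w \<Longrightarrow>
      (LINT t|lebesgue_on {0..T}. \<phi> (v t)) \<le> B \<Longrightarrow> (LINT t|lebesgue_on {0..T}. \<phi> (w t)) \<le> B \<Longrightarrow>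
      (LINT t|lebesgue_on {0..T}. \<phi> (v t)) / 2 + (LINT t|lebesgue_on {0..T}. \<phi> (w t)) / 2
        - (LINT t|lebesgue_on {0..T}. \<phi> ((1/2) *\<^sub>R v t + (1/2) *\<^sub>R w t)) \<le> \<eta> \<Longrightarrow>
      measure (lebesgue_on {0..T}) {t \<in> space (lebesgue_on {0..T}). \<epsilon> \<le> dist (v t) (w t)} \<le> \<epsilon>"
proof -
  let ?M = "lebesgue_on {0..T}"
  interpret finite_measure ?M by (rule finite_measure_lebesgue_on_Icc)
  obtain K where K: "\<And>x. norm x \<le> 1 * \<phi> x + K" using superlinear[of 1] by auto
  \<comment> \<open>The numerator bounds three times the L1 norm of a function with energy at most
    \<open>B\<close>, so values above \<open>R\<close> occupy measure at most
    \<open>\<epsilon> / 3\<close>.\<close>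
  define R where "R = 3 * (\<bar>B\<bar> + \<bar>K\<bar> * T + 1) / \<epsilon>"
  have R: "R > 0" using \<epsilon> T by (simp add: R_def add_nonneg_pos)
  obtain \<delta> where \<delta>: "\<delta> > 0" "\<And>x y. norm x \<le> R \<Longrightarrow> norm y \<le> R \<Longrightarrow> dist x y \<ge> \<epsilon> \<Longrightarrow>
      \<delta> \<le> \<phi> x / 2 + \<phi> y / 2 - \<phi> ((1/2) *\<^sub>R x + (1/2) *\<^sub>R y)"
    using midpoint_gap[OF \<epsilon>, of R] by blast
  have large: "measure ?M {t \<in> space ?M. R \<le> norm (v t)} \<le> \<epsilon> / 3"
    if v: "finite_energy T v" and le: "(LINT t|?M. \<phi> (v t)) \<le> B" for v
  proof -
    have i: "integrable ?M (\<lambda>t. norm (v t))" using finite_energy_integrable[OF v] by simp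
    have "measure ?M {t \<in> space ?M. R \<le> norm (v t)} \<le> (LINT t|?M. norm (v t)) / R"
      by (rule integral_Markov_inequality_measure[OF i _ _ R, where A=\<open>{}\<close>]) auto
    also have "(LINT t|?M. norm (v t)) \<le> (LINT t|?M. \<phi> (v t) + \<bar>K\<bar>)"
      by (rule integral_mono[OF i]) (use finite_energy_integrable_phi[OF v] K in \<open>auto intro: order_trans\<close>, smt (verit) K)
    also have "\<dots> = (LINT t|?M. \<phi> (v t)) + \<bar>K\<bar> * T"
      using finite_energy_integrable_phi[OF v] measure_lebesgue_on_Icc[of 0 T] T by simp
    also have "\<dots> \<le> \<bar>B\<bar> + \<bar>K\<bar> * T + 1" using le by simp
    also have "(\<bar>B\<bar> + \<bar>K\<bar> * T + 1) / R = \<epsilon> / 3"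
    proof -
      have "\<bar>B\<bar> + \<bar>K\<bar> * T + 1 > 0" using T by (simp add: add_nonneg_pos)
      then show ?thesis using \<epsilon> by (simp add: R_def field_simps)
    qed
    finally show ?thesis using R by (simp add: divide_right_mono)
  qed
  show thesis
  \<comment> \<open>Markov at level \<open>\<delta>\<close> turns this energy gap into measure
    \<open>\<epsilon> / 3\<close>.\<close>
  proof (rule that[of "\<delta> * \<epsilon> / 3"])
    show "\<delta> * \<epsilon> / 3 > 0" using \<delta> \<epsilon> by simp
    fix v w
    assume v: "finite_energy T v" and w: "finite_energy T w"
      and le: "(LINT t|?M. \<phi> (v t)) \<le> B" "(LINT t|?M. \<phi> (w t)) \<le> B"
      and gap: "(LINT t|?M. \<phi> (v t)) / 2 + (LINT t|?M. \<phi> (w t)) / 2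
        - (LINT t|?M. \<phi> ((1/2) *\<^sub>R v t + (1/2) *\<^sub>R w t)) \<le> \<delta> * \<epsilon> / 3"
    have [measurable]: "v \<in> borel_measurable ?M" "w \<in> borel_measurable ?M"
      using v w by (auto simp: finite_energy_def)
    define D where "D t = \<phi> (v t) / 2 + \<phi> (w t) / 2 - \<phi> ((1/2) *\<^sub>R v t + (1/2) *\<^sub>R w t)" for t
    note ip = finite_energy_integrable_phi[OF v] finite_energy_integrable_phi[OF w]
      finite_energy_integrable_phi[OF finite_energy_midpoint[OF v w]]
    have Di: "integrable ?M D" unfolding D_def using ip by simp
    have D0: "0 \<le> D t" for t using conv[of "1/2" "v t" "w t"] by (simp add: D_def)
    have "(LINT t|?M. D t) \<le> \<delta> * \<epsilon> / 3" unfolding D_def using ip gap by simp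
    moreover have "measure ?M {t \<in> space ?M. \<delta> \<le> D t} \<le> (LINT t|?M. D t) / \<delta>"
      by (rule integral_Markov_inequality_measure[OF Di _ _ \<delta>(1), where A=\<open>{}\<close>]) (auto simp: D0)
    ultimately have small: "measure ?M {t \<in> space ?M. \<delta> \<le> D t} \<le> \<epsilon> / 3"
      using \<delta> by (smt (verit) pos_divide_le_eq times_divide_eq_right mult.commute divide_right_mono nonzero_mult_div_cancel_left)
    let ?A = "{t \<in> space ?M. \<delta> \<le> D t}" and ?B = "{t \<in> space ?M. R \<le> norm (v t)}" and ?C = "{t \<in> space ?M. R \<le> norm (w t)}"
    have ABC: "?A \<in> sets ?M" "?B \<in> sets ?M" "?C \<in> sets ?M" unfolding D_def by measurable
    have "measure ?M {t \<in> space ?M. \<epsilon> \<le> dist (v t) (w t)} \<le> measure ?M (?A \<union> ?B \<union> ?C)"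
    proof (rule finite_measure_mono)
      show "{t \<in> space ?M. \<epsilon> \<le> dist (v t) (w t)} \<subseteq> ?A \<union> ?B \<union> ?C"
        using \<delta>(2)[of "v _" "w _"] by (auto simp: D_def)
    qed (use ABC in auto)
    also have "\<dots> \<le> measure ?M (?A \<union> ?B) + measure ?M ?C" using ABC by (intro measure_Un_le) auto
    also have "measure ?M (?A \<union> ?B) \<le> measure ?M ?A + measure ?M ?B" using ABC by (intro measure_Un_le) auto
    also have "measure ?M ?A + measure ?M ?B + measure ?M ?C \<le> \<epsilon> / 3 + \<epsilon> / 3 + \<epsilon> / 3"
      by (intro add_mono small large v w le)
    finally show "measure ?M {t \<in> space ?M. \<epsilon> \<le> dist (v t) (w t)} \<le> \<epsilon>" by simp
  qed
qed

text \<open>Superlinearity of \<open>\<phi>\<close> makes bounded energy imply uniform integrability, through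
  \<open>|x - y| \<le> e (\<phi> x + \<phi> y) + min |x - y| (2 K)\<close>.\<close>

lemma finite_energy_L1_limit:
  assumes T: "0 \<le> T" and f: "\<And>i. finite_energy T (f i)" and v: "finite_energy T v"
    and fB: "\<And>i. (LINT t|lebesgue_on {0..T}. \<phi> (f i t)) \<le> B" and vB: "(LINT t|lebesgue_on {0..T}. \<phi> (v t)) \<le> B"
    and lim: "AE t in lebesgue_on {0..T}. (\<lambda>i. f i t) \<longlonglongrightarrow> v t"
  shows "(\<lambda>i. LINT t|lebesgue_on {0..T}. norm (f i t - v t)) \<longlonglongrightarrow> 0"
proof (rule LIMSEQ_I)
  fix \<epsilon> :: real assume \<epsilon>: "\<epsilon> > 0"
  let ?M = "lebesgue_on {0..T}"
  interpret finite_measure ?M by (rule finite_measure_lebesgue_on_Icc)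
  have [measurable]: "f i \<in> borel_measurable ?M" "v \<in> borel_measurable ?M" for i
    using f v by (auto simp: finite_energy_def)
  have B: "B \<ge> 0" using vB by (rule order_trans[rotated]) (auto intro: integral_nonneg_AE)
  \<comment> \<open>Two energies of at most \<open>B\<close> each then cost no more than
    \<open>\<epsilon> / 2\<close>.\<close>
  define e where "e = \<epsilon> / (4 * (B + 1))"
  have e: "e > 0" using \<epsilon> B by (simp add: e_def)
  obtain K where K: "\<And>x. norm x \<le> e * \<phi> x + K" using superlinear[OF e] by blast
  have K0: "K \<ge> 0" using K[of 0] by simp
  define g where "g i t = min (norm (f i t - v t)) (2 * K)" for i t
  have gm [measurable]: "g i \<in> borel_measurable ?M" for i unfolding g_def by measurable
  have gi: "integrable ?M (g i)" for i
    by (rule integrable_const_bound[of _ "2 * K"]) (auto simp: g_def K0)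
  have "(\<lambda>i. LINT t|?M. g i t) \<longlonglongrightarrow> (LINT t|?M. 0)"
  proof (rule integral_dominated_convergence[where w="\<lambda>_. 2 * K"])
    show "AE t in ?M. (\<lambda>i. g i t) \<longlonglongrightarrow> 0"
      using lim
    proof eventually_elim
      case (elim t)
      then have "(\<lambda>i. min (norm (f i t - v t)) (2 * K)) \<longlonglongrightarrow> min (norm (v t - v t)) (2 * K)"
        by (intro tendsto_intros)
      then show ?case using K0 by (simp add: g_def)
    qed
  qed (auto simp: g_def K0)
  then have "(\<lambda>i. LINT t|?M. g i t) \<longlonglongrightarrow> 0" by simp
  then obtain N where N: "\<And>i. i \<ge> N \<Longrightarrow> (LINT t|?M. g i t) < \<epsilon> / 2"
    using order_tendstoD(2)[of _ 0 sequentially "\<epsilon>/2"] \<epsilon> by (auto simp: eventually_sequentially)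
  have "norm ((LINT t|?M. norm (f i t - v t)) - 0) < \<epsilon>" if "i \<ge> N" for i
  proof -
    have "norm (f i t - v t) \<le> e * (\<phi> (f i t) + \<phi> (v t)) + g i t" for t
    proof -
      have "norm (f i t - v t) \<le> e * (\<phi> (f i t) + \<phi> (v t)) + 2 * K"
        using norm_triangle_ineq4[of "f i t" "v t"] K[of "f i t"] K[of "v t"] by (simp add: algebra_simps)
      moreover have "0 \<le> e * (\<phi> (f i t) + \<phi> (v t))" using e by simp
      ultimately show ?thesis unfolding g_def by (auto simp: min_def)
    qed
    then have "(LINT t|?M. norm (f i t - v t)) \<le> (LINT t|?M. e * (\<phi> (f i t) + \<phi> (v t)) + g i t)"
      using finite_energy_integrable[OF f] finite_energy_integrable[OF v] finite_energy_integrable_phi[OF f]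
        finite_energy_integrable_phi[OF v] gi
      by (intro integral_mono) auto
    also have "\<dots> = e * ((LINT t|?M. \<phi> (f i t)) + (LINT t|?M. \<phi> (v t))) + (LINT t|?M. g i t)"
      using finite_energy_integrable_phi[OF f] finite_energy_integrable_phi[OF v] gi by simp
    also have "e * ((LINT t|?M. \<phi> (f i t)) + (LINT t|?M. \<phi> (v t))) \<le> e * (2 * B)"
      using e fB[of i] vB by (intro mult_left_mono) auto
    also have "\<dots> \<le> \<epsilon> / 2"
      unfolding e_def using B \<epsilon> by (simp add: field_simps)
    finally show ?thesis using N[OF that] by (simp add: abs_of_nonneg integral_nonneg_AE)
  qed
  then show "\<exists>N. \<forall>i\<ge>N. norm ((LINT t|?M. norm (f i t - v t)) - 0) < \<epsilon>" by blast
qed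

end

context smooth_G_function
begin

text \<open>Weak compactness without weak topologies: for shrinking uniform neighbourhoods of \<open>u\<close>, almost
  minimisers of the energy among the derivatives of functions in the neighbourhood form a sequence
  that strict convexity makes Cauchy in measure.\<close>

lemma finite_energy_uniform_limit:
  assumes T: "0 \<le> T" and w: "\<And>j. finite_energy T (w j)"
    and L: "(\<lambda>j. LINT t|lebesgue_on {0..T}. \<phi> (w j t)) \<longlonglongrightarrow> L"
    and unif: "\<And>e. e > 0 \<Longrightarrow> \<exists>N. \<forall>j\<ge>N. \<forall>t\<in>{0..T}. norm (c j + integral {0..t} (w j) - u t) < e"
  obtains v where "finite_energy T v" "\<And>t. t \<in> {0..T} \<Longrightarrow> u t = u 0 + integral {0..t} v"
    "(LINT t|lebesgue_on {0..T}. \<phi> (v t)) \<le> L"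
proof -
  let ?M = "lebesgue_on {0..T}"
  define E where "E w = (LINT t|?M. \<phi> (w t))" for w
  \<comment> \<open>These sets are convex, shrink with \<open>e\<close>, and contain the given
    derivatives from some index on, up to which their energies can be discarded.\<close>
  define C where "C e = {w. finite_energy T w \<and> (\<forall>t\<in>{0..T}. norm (integral {0..t} w - (u t - u 0)) \<le> e)}" for e
  define e where "e k = 1 / real (Suc k)" for k
  have e: "e k > 0" "e \<longlonglongrightarrow> 0" "j \<le> k \<Longrightarrow> e k \<le> e j" "e k \<le> 1" for j k
    using LIMSEQ_inverse_real_of_nat by (auto simp: e_def[abs_def] inverse_eq_divide frac_le)
  have E0: "0 \<le> E w" for w unfolding E_def by (rule integral_nonneg_AE) simp
  have near: "\<exists>N. \<forall>j\<ge>N. w j \<in> C r" if r: "r > 0" for r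
  proof -
    obtain N where N: "\<And>j t. j \<ge> N \<Longrightarrow> t\<in>{0..T} \<Longrightarrow> norm (c j + integral {0..t} (w j) - u t) < r / 2"
      using unif[OF half_gt_zero[OF r]] by blast
    have "w j \<in> C r" if "j \<ge> N" for j
    proof -
      have "norm (integral {0..t} (w j) - (u t - u 0)) \<le> r" if t: "t \<in> {0..T}" for t
      proof -
        have "norm (c j - u 0) < r / 2" using N[OF \<open>j \<ge> N\<close>, of 0] T by simp
        moreover have "norm (c j + integral {0..t} (w j) - u t) < r / 2" by (rule N[OF \<open>j \<ge> N\<close> t])
        moreover have "integral {0..t} (w j) - (u t - u 0) = (c j + integral {0..t} (w j) - u t) - (c j - u 0)" by simp
        ultimately show ?thesis using norm_triangle_ineq4[of "c j + integral {0..t} (w j) - u t" "c j - u 0"] by (simp only:)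
      qed
      then show ?thesis using w by (simp add: C_def)
    qed
    then show ?thesis by blast
  qed
  \<comment> \<open>The infima increase as the sets shrink and stay below \<open>L\<close>, so they
    form a Cauchy sequence.\<close>
  define m where "m k = Inf (E ` C (e k))" for k
  have bdd: "bdd_below (E ` C r)" for r using E0 by (intro bdd_belowI[of _ 0]) auto
  have ne: "C (e k) \<noteq> {}" for k using near[OF e(1)] by blast
  have mE: "m k \<le> E x" if "x \<in> C (e k)" for x k
    unfolding m_def by (rule cInf_lower[OF _ bdd]) (use that in auto)
  have mL: "m k \<le> L" for k
  proof (rule LIMSEQ_le_const[OF L])
    show "\<exists>N. \<forall>n\<ge>N. m k \<le> (LINT t|?M. \<phi> (w n t))"
      using near[OF e(1), of k] mE[of _ k] unfolding E_def by blast
  qed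
  have mmono: "m j \<le> m k" if "j \<le> k" for j k
    unfolding m_def
  proof (rule cInf_superset_mono[OF _ bdd])
    show "E ` C (e k) \<subseteq> E ` C (e j)" using e(3)[OF that] unfolding C_def by (intro image_mono) (auto intro: order_trans)
  qed (use ne in auto)
  have "incseq m" using mmono by (auto simp: incseq_def)
  then obtain m' where "m \<longlonglongrightarrow> m'" using incseq_convergent[of m L] mL by blast
  then have mC: "Cauchy m" by (rule LIMSEQ_imp_Cauchy)
  have "\<exists>x. x \<in> C (e k) \<and> E x < m k + e k" for k
  proof -
    have "Inf (E ` C (e k)) < m k + e k" using e(1) by (simp add: m_def)
    then show ?thesis using cInf_lessD[of "E ` C (e k)"] ne by blast
  qed
  then obtain x where x: "\<And>k. x k \<in> C (e k)" "\<And>k. E (x k) < m k + e k" by metis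
  have fx: "finite_energy T (x k)" for k using x(1)[of k] by (simp add: C_def)
  have EB: "E (x k) \<le> L + 1" for k using x(2)[of k] mL[of k] e(4)[of k] by linarith
  \<comment> \<open>By convexity a midpoint competes in the larger of the two sets.\<close>
  have mid: "(\<lambda>t. (1/2) *\<^sub>R x j t + (1/2) *\<^sub>R x k t) \<in> C (e j)" if "j \<le> k" for j k
  proof -
    have "norm (integral {0..t} (\<lambda>t. (1/2) *\<^sub>R x j t + (1/2) *\<^sub>R x k t) - (u t - u 0)) \<le> e j" if t: "t \<in> {0..T}" for t
    proof -
      have i: "x k integrable_on {0..t}" for k
        by (rule integrable_subinterval_real[OF integral_lebesgue_on(2)[OF finite_energy_integrable[OF fx]]]) (use t in auto)
      have "integral {0..t} (\<lambda>t. (1/2) *\<^sub>R x j t + (1/2) *\<^sub>R x k t) = (1/2) *\<^sub>R integral {0..t} (x j) + (1/2) *\<^sub>R integral {0..t} (x k)"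
        using i by (simp add: Henstock_Kurzweil_Integration.integral_add integrable_cmul)
      also have "\<dots> - (u t - u 0) = (1/2) *\<^sub>R (integral {0..t} (x j) - (u t - u 0)) + (1/2) *\<^sub>R (integral {0..t} (x k) - (u t - u 0))"
        by (simp add: algebra_simps flip: scaleR_add_left)
      also have "norm \<dots> \<le> (1/2) * norm (integral {0..t} (x j) - (u t - u 0)) + (1/2) * norm (integral {0..t} (x k) - (u t - u 0))"
        by (rule order_trans[OF norm_triangle_ineq]) simp
      also have "\<dots> \<le> (1/2) * e j + (1/2) * e j"
        using x(1)[of j] x(1)[of k] t e(3)[OF \<open>j \<le> k\<close>] unfolding C_def by (intro add_mono mult_left_mono) (auto intro: order_trans)
      finally show ?thesis by simp
    qed
    then show ?thesis unfolding C_def using finite_energy_midpoint[OF fx fx] by blast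
  qed
  interpret finite_measure ?M by (rule finite_measure_lebesgue_on_Icc)
  have xm [measurable]: "x k \<in> borel_measurable ?M" for k using finite_energy_measurable[OF fx] .
  obtain r where r: "strict_mono (r :: nat \<Rightarrow> nat)" "AE t in ?M. convergent (\<lambda>i. x (r i) t)"
  proof (rule Cauchy_in_measure_subseq[of ?M x])
    fix \<epsilon> :: real assume "\<epsilon> > 0"
    then obtain \<eta> where \<eta>: "\<eta> > 0"
      "\<And>v w. finite_energy T v \<Longrightarrow> finite_energy T w \<Longrightarrow> E v \<le> L + 1 \<Longrightarrow> E w \<le> L + 1 \<Longrightarrow>
        E v / 2 + E w / 2 - E (\<lambda>t. (1/2) *\<^sub>R v t + (1/2) *\<^sub>R w t) \<le> \<eta> \<Longrightarrow>
        measure ?M {t \<in> space ?M. \<epsilon> \<le> dist (v t) (w t)} \<le> \<epsilon>"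
      using small_energy_gap_imp_close[OF T, of \<epsilon> "L + 1"] unfolding E_def by blast
    obtain N1 where N1: "\<And>j k. j \<ge> N1 \<Longrightarrow> k \<ge> N1 \<Longrightarrow> dist (m j) (m k) < \<eta>"
      using mC \<eta>(1) unfolding Cauchy_def by meson
    obtain N2 where N2: "\<And>j. j \<ge> N2 \<Longrightarrow> e j < \<eta> / 2"
      using order_tendstoD(2)[OF e(2), of "\<eta>/2"] \<eta>(1) by (auto simp: eventually_sequentially)
    \<comment> \<open>The midpoint costs at least \<open>m j\<close>, so the energy gap is below
      \<open>(m k - m j + e j + e k) / 2\<close>, which is less than \<open>\<eta>\<close>.\<close>
    have *: "measure ?M {t \<in> space ?M. \<epsilon> \<le> dist (x j t) (x k t)} \<le> \<epsilon>"
      if jk: "j \<le> k" "max N1 N2 \<le> j" for j k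
    proof (rule \<eta>(2)[OF fx fx EB EB])
      have "m j \<le> E (\<lambda>t. (1/2) *\<^sub>R x j t + (1/2) *\<^sub>R x k t)" by (rule mE[OF mid[OF jk(1)]])
      moreover have "E (x j) < m j + e j" "E (x k) < m k + e k" by (rule x(2))+
      moreover have "m k - m j < \<eta>" using N1[of k j] jk by (auto simp: dist_real_def)
      moreover have "e j < \<eta> / 2" "e k < \<eta> / 2" using N2 jk by auto
      ultimately show "E (x j) / 2 + E (x k) / 2 - E (\<lambda>t. (1/2) *\<^sub>R x j t + (1/2) *\<^sub>R x k t) \<le> \<eta>"
        by linarith
    qed
    show "\<exists>N. \<forall>j\<ge>N. \<forall>k\<ge>N. measure ?M {t \<in> space ?M. \<epsilon> \<le> dist (x j t) (x k t)} \<le> \<epsilon>"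
    proof (intro exI allI impI)
      fix j k assume "max N1 N2 \<le> j" "max N1 N2 \<le> k"
      then show "measure ?M {t \<in> space ?M. \<epsilon> \<le> dist (x j t) (x k t)} \<le> \<epsilon>"
        using *[of j k] *[of k j] by (cases "j \<le> k") (auto simp: dist_commute)
    qed
  qed (auto intro: finite_measure_lebesgue_on_Icc)
  define v where "v t = lim (\<lambda>i. x (r i) t)" for t
  have vm [measurable]: "v \<in> borel_measurable ?M" unfolding v_def[abs_def] by measurable
  have lim: "AE t in ?M. (\<lambda>i. x (r i) t) \<longlonglongrightarrow> v t"
    using r(2) by eventually_elim (simp add: v_def convergent_LIMSEQ_iff)
  have er: "(\<lambda>i. e (r i)) \<longlonglongrightarrow> 0" using LIMSEQ_subseq_LIMSEQ[OF e(2) r(1)] by (simp add: o_def)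
  have L0: "L \<ge> 0" by (rule LIMSEQ_le_const[OF L]) (use E0 in \<open>auto simp: E_def\<close>)
  have nnE: "(\<integral>\<^sup>+t. ennreal (\<phi> (x k t)) \<partial>?M) = ennreal (E (x k))" for k
    unfolding E_def by (rule nn_integral_eq_integral) (use finite_energy_integrable_phi[OF fx] in auto)
  \<comment> \<open>Only almost everywhere convergence is at hand here. Fatou's lemma yields finite
    energy of \<open>v\<close> first, and that is what permits the passage to L1 convergence and to
    primitives.\<close>
  have fatou: "(\<integral>\<^sup>+t. ennreal (\<phi> (v t)) \<partial>?M) \<le> ennreal L"
  proof -
    have "(\<integral>\<^sup>+t. ennreal (\<phi> (v t)) \<partial>?M) = (\<integral>\<^sup>+t. liminf (\<lambda>i. ennreal (\<phi> (x (r i) t))) \<partial>?M)"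
    proof (rule nn_integral_cong_AE)
      show "AE t in ?M. ennreal (\<phi> (v t)) = liminf (\<lambda>i. ennreal (\<phi> (x (r i) t)))"
        using lim
      proof eventually_elim
        case (elim t)
        have "(\<lambda>i. \<phi> (x (r i) t)) \<longlonglongrightarrow> \<phi> (v t)"
          by (rule continuous_on_tendsto_compose[OF continuous[of UNIV] elim]) auto
        then have "(\<lambda>i. ennreal (\<phi> (x (r i) t))) \<longlonglongrightarrow> ennreal (\<phi> (v t))" by (rule tendsto_ennrealI)
        from lim_imp_Liminf[OF _ this] show ?case by simp
      qed
    qed
    also have "\<dots> \<le> liminf (\<lambda>i. \<integral>\<^sup>+t. ennreal (\<phi> (x (r i) t)) \<partial>?M)"
      by (rule nn_integral_liminf) measurable
    also have "\<dots> \<le> liminf (\<lambda>i. ennreal (L + e (r i)))"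
    proof (intro Liminf_mono always_eventually allI)
      fix i
      show "(\<integral>\<^sup>+t. ennreal (\<phi> (x (r i) t)) \<partial>?M) \<le> ennreal (L + e (r i))"
        unfolding nnE using x(2)[of "r i"] mL[of "r i"] by (intro ennreal_leI) linarith
    qed
    also have "\<dots> = ennreal L"
    proof (rule lim_imp_Liminf)
      have "(\<lambda>i. L + e (r i)) \<longlonglongrightarrow> L + 0" by (intro tendsto_intros er)
      then show "(\<lambda>i. ennreal (L + e (r i))) \<longlonglongrightarrow> ennreal L" using tendsto_ennrealI by fastforce
    qed simp
    finally show ?thesis .
  qed
  have vi: "integrable ?M (\<lambda>t. \<phi> (v t))"
    by (rule integrableI_bounded) (use fatou in \<open>auto simp: le_less_trans\<close>)
  then have fv: "finite_energy T v" by (simp add: finite_energy_def)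
  have "ennreal (E v) \<le> ennreal L"
    using fatou nn_integral_eq_integral[OF vi] by (simp add: E_def)
  then have EvL: "E v \<le> L" using L0 by (simp add: ennreal_le_iff)
  have L1: "(\<lambda>i. LINT t|?M. norm (x (r i) t - v t)) \<longlonglongrightarrow> 0"
    by (rule finite_energy_L1_limit[OF T fx fv _ _ lim, of "L + 1"]) (use EB EvL in \<open>auto simp: E_def\<close>)
  have "u t = u 0 + integral {0..t} v" if t: "t \<in> {0..T}" for t
  proof -
    have "(\<lambda>i. integral {0..t} (x (r i)) - integral {0..t} v) \<longlonglongrightarrow> 0"
      by (rule Lim_null_comparison[OF _ L1])
        (use norm_integral_diff_le[OF finite_energy_integrable[OF fx] finite_energy_integrable[OF fv] t] in auto)
    moreover have "(\<lambda>i. integral {0..t} (x (r i)) - (u t - u 0)) \<longlonglongrightarrow> 0"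
      by (rule Lim_null_comparison[OF _ er]) (use x(1) t in \<open>auto simp: C_def\<close>)
    ultimately have "(\<lambda>i. integral {0..t} (x (r i)) - (u t - u 0) - (integral {0..t} (x (r i)) - integral {0..t} v)) \<longlonglongrightarrow> 0 - 0"
      by (intro tendsto_diff)
    then have "(\<lambda>i::nat. u 0 - u t + integral {0..t} v) \<longlonglongrightarrow> 0" by simp
    then show ?thesis by (simp add: LIMSEQ_const_iff algebra_simps)
  qed
  then show thesis by (rule that[OF fv _ EvL[unfolded E_def]])
qed

end

section \<open>Existence of minimizers\<close>

lemma continuous_on_Icc_bounded:
  fixes u :: "real \<Rightarrow> 'a::real_normed_vector"
  assumes u: "continuous_on {a..b} u"
  obtains R where "R > 0" "\<And>t. t \<in> {a..b} \<Longrightarrow> norm (u t) < R"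
proof -
  have "bounded (u ` {a..b})" by (intro compact_imp_bounded compact_continuous_image u compact_Icc)
  then obtain R where "R > 0" "\<forall>y\<in>u ` {a..b}. norm y < R" unfolding bounded_pos_less by blast
  then show thesis by (intro that[of R]) auto
qed

context smooth_G_function
begin

text \<open>Superlinearity integrated over an interval. Choosing \<open>e\<close> small first and
  then the length small gives equicontinuity from an energy bound.\<close>

lemma norm_integral_le_energy:
  assumes w: "finite_energy T w" and st: "0 \<le> s" "s \<le> t" "t \<le> T" and e: "e > 0"
    and K: "\<And>x. norm x \<le> e * \<phi> x + K"
  shows "norm (integral {s..t} w) \<le> e * (LINT t|lebesgue_on {0..T}. \<phi> (w t)) + K * (t - s)"
proof -
  note wi = finite_energy_integrable[OF w] and pi = finite_energy_integrable_phi[OF w]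
  have sub: "{s..t} \<subseteq> {0..T}" using st by auto
  note i1 = integrable_subinterval_real[OF integral_lebesgue_on(2)[OF wi] sub]
    and i2 = integrable_subinterval_real[OF integral_lebesgue_on(2)[OF pi] sub]
  have i3: "(\<lambda>t. e * \<phi> (w t) + K) integrable_on {s..t}"
    by (intro integrable_add integrable_on_mult_right i2 integrable_const_ivl)
  have "norm (integral {s..t} w) \<le> integral {s..t} (\<lambda>t. e * \<phi> (w t) + K)"
    by (rule integral_norm_bound_integral[OF i1 i3 K])
  also have "\<dots> = e * integral {s..t} (\<lambda>t. \<phi> (w t)) + K * (t - s)"
    using st integrable_on_mult_right[OF i2, of e] by (subst Henstock_Kurzweil_Integration.integral_add) auto
  also have "integral {s..t} (\<lambda>t. \<phi> (w t)) \<le> integral {0..T} (\<lambda>t. \<phi> (w t))"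
    by (rule integral_subset_le[OF sub i2 integral_lebesgue_on(2)[OF pi]]) auto
  finally show ?thesis using e integral_lebesgue_on(1)[OF pi] by simp
qed

text \<open>Jensen's inequality for the normalised Lebesgue measure on \<open>[0, T]\<close>, applied to
  \<open>k T w\<close> cut off at \<open>t\<close>.\<close>

lemma energy_jensen:
  assumes T: "T > 0" and w: "finite_energy T w" and t: "t \<in> {0..T}" and k: "0 \<le> k" "k * T \<le> 1"
  shows "\<phi> (k *\<^sub>R integral {0..t} w) \<le> k * (LINT t|lebesgue_on {0..T}. \<phi> (w t))"
proof -
  note wi = finite_energy_integrable[OF w] and pi = finite_energy_integrable_phi[OF w]
  define z where "z = integral {0..t} w"
  define x0 where "x0 = k *\<^sub>R z"
  let ?g = "gradient \<phi> x0"
  \<comment> \<open>The mean of \<open>y\<close> over \<open>{0..T}\<close> is \<open>x0\<close>, so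
    the linear part of the supporting inequality at \<open>x0\<close> integrates to zero. Since
    \<open>k * T\<close> is at most 1, convexity bounds \<open>\<phi>\<close> of the scaled
    function.\<close>
  define y where "y s = (if s \<in> {0..t} then (k * T) *\<^sub>R w s else 0)" for s
  have sub: "{0..t} \<subseteq> {0..T}" using t by auto
  have wt: "w integrable_on {0..t}" by (rule integrable_subinterval_real[OF integral_lebesgue_on(2)[OF wi] sub])
  have "((\<lambda>s. (k * T) *\<^sub>R w s) has_integral (k * T) *\<^sub>R z) {0..t}"
    unfolding z_def by (intro has_integral_cmul integrable_integral wt)
  then have yi: "(y has_integral (k * T) *\<^sub>R z) {0..T}"
    unfolding y_def by (subst has_integral_restrict[OF sub])
  have "((\<lambda>s. \<phi> x0 + ?g \<bullet> (y s - x0)) has_integral T * \<phi> x0 + (?g \<bullet> ((k * T) *\<^sub>R z) - T * (?g \<bullet> x0))) {0..T}"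
  proof -
    have 1: "((\<lambda>s. ?g \<bullet> y s) has_integral ?g \<bullet> ((k * T) *\<^sub>R z)) {0..T}"
      using has_integral_linear[OF yi bounded_linear_inner_right[of ?g]] by (simp add: o_def)
    have 2: "((\<lambda>s. ?g \<bullet> x0) has_integral T * (?g \<bullet> x0)) {0..T}" "((\<lambda>s. \<phi> x0) has_integral T * \<phi> x0) {0..T}"
      using has_integral_const_real[of "?g \<bullet> x0" 0 T] has_integral_const_real[of "\<phi> x0" 0 T] T by simp_all
    from has_integral_add[OF 2(2) has_integral_diff[OF 1 2(1)]] show ?thesis by (simp add: inner_diff_right)
  qed
  moreover have "?g \<bullet> ((k * T) *\<^sub>R z) - T * (?g \<bullet> x0) = 0" by (simp add: x0_def)
  ultimately have I1: "((\<lambda>s. \<phi> x0 + ?g \<bullet> (y s - x0)) has_integral T * \<phi> x0) {0..T}"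
    by (simp only: add_0_right)
  have "((\<lambda>s. \<phi> (w s)) has_integral (LINT t|lebesgue_on {0..T}. \<phi> (w t))) {0..T}"
    by (rule has_integral_integral_lebesgue_on[OF pi]) simp
  from has_integral_mult_right[OF this, of "k * T"]
  have I2: "((\<lambda>s. (k * T) * \<phi> (w s)) has_integral (k * T) * (LINT t|lebesgue_on {0..T}. \<phi> (w t))) {0..T}" .
  have "T * \<phi> x0 \<le> (k * T) * (LINT t|lebesgue_on {0..T}. \<phi> (w t))"
  proof (rule has_integral_le[OF I1 I2])
    fix s assume "s \<in> {0..T}"
    have "\<phi> (y s) \<le> (k * T) * \<phi> (w s)"
      using scale_le[of "k * T" "w s"] k T by (auto simp: y_def)
    then show "\<phi> x0 + ?g \<bullet> (y s - x0) \<le> (k * T) * \<phi> (w s)" using gradient_le[of x0 "y s"] by linarith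
  qed
  then have "T * \<phi> x0 \<le> T * (k * (LINT t|lebesgue_on {0..T}. \<phi> (w t)))" by (simp add: mult_ac)
  then show ?thesis using T by (simp add: x0_def z_def)
qed

end

text \<open>The hypotheses in working form: the null sets are gone, the growth of subgradients has
  become the Lipschitz estimate \<open>F_local\<close> on balls, and \<open>F_upper\<close> combines
  the bound by \<open>\<phi>\<^sub>0\<close> with its being much less than
  \<open>\<phi>\<close>.\<close>

locale variational_problem = smooth_G_function +
  fixes T :: real and F :: "real \<Rightarrow> 'a \<Rightarrow> real" and d :: "real \<Rightarrow> 'a \<Rightarrow> 'a \<Rightarrow> real" and b b\<^sub>1 :: "real \<Rightarrow> real"
    and l m :: real
  assumes T: "T > 0"
    and F_meas: "(\<lambda>t. F t x) \<in> borel_measurable (lebesgue_on {0..T})"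
    and reg: "t \<in> {0..T} \<Longrightarrow> regular_derivative (F t) (d t)"
    and b: "integrable (lebesgue_on {0..T}) b" "t \<in> {0..T} \<Longrightarrow> 0 \<le> b t"
    and F_local: "\<exists>C\<ge>0. \<forall>t\<in>{0..T}. \<forall>x\<in>ball 0 R. \<forall>y\<in>ball 0 R.
      \<bar>F t x\<bar> \<le> C * b t \<and> \<bar>F t x - F t y\<bar> \<le> C * b t * norm (x - y)"
    and lm: "l > 0" "m > 0"
    and subadd: "t \<in> {0..T} \<Longrightarrow> F t (l *\<^sub>R (x + y)) \<le> m * (F t x + F t y)"
    and b\<^sub>1: "integrable (lebesgue_on {0..T}) b\<^sub>1" "t \<in> {0..T} \<Longrightarrow> 0 \<le> b\<^sub>1 t"
    and F_upper: "k > 0 \<Longrightarrow> \<exists>C. \<forall>t\<in>{0..T}. \<forall>x. F t x \<le> b\<^sub>1 t * (C + \<phi> (k *\<^sub>R x))"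
    and coercive: "filterlim (\<lambda>x. LINT t|lebesgue_on {0..T}. F t x) at_top at_infinity"
begin

abbreviation "M \<equiv> lebesgue_on {0..T}"

text \<open>Curves are handled as pairs of initial value and derivative. Periodicity becomes the
  linear condition of vanishing integral, and the initial value can be varied independently of the
  derivative.\<close>

definition traj :: "'a \<Rightarrow> (real \<Rightarrow> 'a) \<Rightarrow> real \<Rightarrow> 'a" where
  "traj c w t = c + integral {0..t} w"

definition admissible :: "(real \<Rightarrow> 'a) \<Rightarrow> bool" where
  "admissible w \<longleftrightarrow> finite_energy T w \<and> integral {0..T} w = 0"

definition J :: "'a \<Rightarrow> (real \<Rightarrow> 'a) \<Rightarrow> real" where
  "J c w = (LINT t|M. \<phi> (w t)) + (LINT t|M. F t (traj c w t))"

lemma F_continuous: assumes "t \<in> {0..T}" shows "continuous_on S (F t)"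
proof (rule continuous_at_imp_continuous_on, rule ballI)
  fix x :: 'a
  obtain C where C: "C \<ge> 0" "\<And>x' y. x' \<in> ball 0 (norm x + 1) \<Longrightarrow> y \<in> ball 0 (norm x + 1) \<Longrightarrow> \<bar>F t x' - F t y\<bar> \<le> C * b t * norm (x' - y)"
    using F_local[of "norm x + 1"] assms by blast
  have "(C * b t)-lipschitz_on (ball 0 (norm x + 1)) (F t)"
    by (rule lipschitz_onI) (use C b(2)[OF assms] in \<open>auto simp: dist_norm\<close>)
  from lipschitz_on_continuous_on[OF this] show "isCont (F t) x"
    by (simp add: continuous_on_eq_continuous_at)
qed

text \<open>Replace \<open>u t\<close> by its value at \<open>t\<close> rounded down to a multiple
  of \<open>1 / Suc n\<close>. The rounded time takes countably many values, and continuity of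
  \<open>u\<close> and of \<open>F t\<close> gives the limit. Rounding down keeps the time in
  \<open>{0..T}\<close>.\<close>

lemma F_comp_measurable:
  assumes u: "continuous_on {0..T} u"
  shows "(\<lambda>t. F t (u t)) \<in> borel_measurable M"
proof (rule borel_measurable_LIMSEQ_real)
  define q where "q n t = real_of_int \<lfloor>real (Suc n) * t\<rfloor> / real (Suc n)" for n t
  show "(\<lambda>t. F t (u (q n t))) \<in> borel_measurable M" for n
  proof -
    have "(\<lambda>t. F t (u (real_of_int i / real (Suc n)))) \<in> borel_measurable M" for i :: int by (rule F_meas)
    moreover have "(\<lambda>t. \<lfloor>real (Suc n) * t\<rfloor>) \<in> measurable M (count_space UNIV)"
    proof -
      have "(\<lambda>t::real. \<lfloor>real (Suc n) * t\<rfloor>) \<in> measurable borel (count_space UNIV)" by measurable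
      then have "(\<lambda>t::real. \<lfloor>real (Suc n) * t\<rfloor>) \<in> measurable lborel (count_space UNIV)" by simp
      then show ?thesis by (intro measurable_restrict_space1 measurable_completion)
    qed
    ultimately show ?thesis
      unfolding q_def by (rule measurable_compose_countable)
  qed
  fix t assume "t \<in> space M"
  then have t: "t \<in> {0..T}" by simp
  have q1: "q n t \<le> t" "t - 1 / real (Suc n) \<le> q n t" "0 \<le> q n t" for n
  proof -
    have f: "real_of_int \<lfloor>real (Suc n) * t\<rfloor> \<le> real (Suc n) * t" "real (Suc n) * t - 1 \<le> real_of_int \<lfloor>real (Suc n) * t\<rfloor>"
      by linarith+
    show "q n t \<le> t" unfolding q_def using f(1) by (simp add: pos_divide_le_eq mult.commute)
    show "t - 1 / real (Suc n) \<le> q n t"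
    proof -
      have "t - 1 / real (Suc n) = (real (Suc n) * t - 1) / real (Suc n)" by (simp add: diff_divide_distrib)
      also have "\<dots> \<le> q n t" unfolding q_def using f(2) by (intro divide_right_mono) auto
      finally show ?thesis .
    qed
    show "0 \<le> q n t" using t by (simp add: q_def)
  qed
  have "(\<lambda>n. t - 1 / real (Suc n)) \<longlonglongrightarrow> t - 0"
    using LIMSEQ_inverse_real_of_nat by (intro tendsto_diff) (auto simp: inverse_eq_divide)
  then have "(\<lambda>n. q n t) \<longlonglongrightarrow> t"
    by (intro tendsto_sandwich[where f="\<lambda>n. t - 1 / real (Suc n)" and h="\<lambda>_. t" and g="\<lambda>n. q n t"]) (use q1 in \<open>auto intro!: always_eventually simp del: of_nat_Suc\<close>)
  then have "(\<lambda>n. u (q n t)) \<longlonglongrightarrow> u t"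
    by (rule continuous_on_tendsto_compose[OF u]) (use q1 t in \<open>auto intro!: always_eventually intro: order_trans\<close>)
  then show "(\<lambda>n. F t (u (q n t))) \<longlonglongrightarrow> F t (u t)"
    by (rule continuous_on_tendsto_compose[OF F_continuous[OF t, of UNIV]]) auto
qed

lemma F_comp_integrable:
  assumes u: "continuous_on {0..T} u"
  shows "integrable M (\<lambda>t. F t (u t))"
proof -
  obtain R where R: "\<And>t. t \<in> {0..T} \<Longrightarrow> norm (u t) < R" using continuous_on_Icc_bounded[OF u] by blast
  obtain C where C: "C \<ge> 0" "\<And>t x. t \<in> {0..T} \<Longrightarrow> x \<in> ball 0 R \<Longrightarrow> \<bar>F t x\<bar> \<le> C * b t"
    using F_local[of R] by blast
  show ?thesis
  proof (rule Bochner_Integration.integrable_bound)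
    show "integrable M (\<lambda>t. C * b t)" using b by simp
    show "AE t in M. norm (F t (u t)) \<le> norm (C * b t)"
    proof (rule AE_I2)
      fix t assume "t \<in> space M"
      then have t: "t \<in> {0..T}" by simp
      show "norm (F t (u t)) \<le> norm (C * b t)"
        using C(2)[OF t, of "u t"] R[OF t] by simp
    qed
  qed (rule F_comp_measurable[OF u])
qed

lemma traj_continuous:
  assumes "finite_energy T w" shows "continuous_on {0..T} (traj c w)"
  unfolding traj_def
  by (intro continuous_intros indefinite_integral_continuous_1 integral_lebesgue_on(2) finite_energy_integrable assms)

lemma admissible_zero: "admissible (\<lambda>_. 0)"
  by (simp add: admissible_def finite_energy_def)

lemma J_lower_bound:
  obtains B where "\<And>c w. admissible w \<Longrightarrow>
    (LINT t|M. \<phi> (w t)) / 2 + (LINT t|M. F t (l *\<^sub>R c)) / m - B \<le> J c w"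
proof -
  define \<beta> where "\<beta> = (LINT t|M. b\<^sub>1 t)"
  have \<beta>: "\<beta> \<ge> 0" unfolding \<beta>_def by (rule integral_nonneg_AE) (use b\<^sub>1(2) in \<open>auto intro!: AE_I2\<close>)
  \<comment> \<open>The first entry is for Jensen's inequality, the second lets the contribution of
    the deviation be absorbed into half of the energy.\<close>
  define k where "k = min (1 / T) (1 / (2 * (\<beta> + 1)))"
  have k: "k > 0" "k * T \<le> 1" "\<beta> * k \<le> 1 / 2"
  proof -
    show "k > 0" using T \<beta> by (simp add: k_def add_nonneg_pos)
    have "k * T \<le> (1 / T) * T" using T by (intro mult_right_mono) (auto simp: k_def)
    then show "k * T \<le> 1" using T by simp
    have "\<beta> * k \<le> \<beta> * (1 / (2 * (\<beta> + 1)))" using \<beta> by (intro mult_left_mono) (auto simp: k_def)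
    also have "\<dots> \<le> 1 / 2" using \<beta> by (simp add: field_simps)
    finally show "\<beta> * k \<le> 1 / 2" .
  qed
  obtain C where C: "\<And>t x. t \<in> {0..T} \<Longrightarrow> F t x \<le> b\<^sub>1 t * (C + \<phi> (k *\<^sub>R x))" using F_upper[OF k(1)] by blast
  show thesis
  proof (rule that[of "\<beta> * C"])
    fix c w assume adm: "admissible w"
    then have w: "finite_energy T w" by (simp add: admissible_def)
    define E where "E = (LINT t|M. \<phi> (w t))"
    have E: "E \<ge> 0" unfolding E_def by (rule integral_nonneg_AE) simp
    let ?u = "traj c w"
    have iF: "integrable M (\<lambda>t. F t (?u t))" by (rule F_comp_integrable[OF traj_continuous[OF w]])
    have iC: "integrable M (\<lambda>t. F t (l *\<^sub>R c))" by (rule F_comp_integrable) simp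
    have "(LINT t|M. F t (l *\<^sub>R c)) \<le> (LINT t|M. m * F t (?u t) + (m * (C + k * E)) * b\<^sub>1 t)"
    proof (rule integral_mono[OF iC])
      show "integrable M (\<lambda>t. m * F t (?u t) + (m * (C + k * E)) * b\<^sub>1 t)" using iF b\<^sub>1 by simp
      fix t assume "t \<in> space M"
      then have t: "t \<in> {0..T}" by simp
      \<comment> \<open>The two arguments add up to \<open>c\<close>; evenness of
        \<open>\<phi>\<close> then removes the sign of the deviation.\<close>
      have "F t (l *\<^sub>R (?u t + - integral {0..t} w)) \<le> m * (F t (?u t) + F t (- integral {0..t} w))" by (rule subadd[OF t])
      then have 1: "F t (l *\<^sub>R c) \<le> m * (F t (?u t) + F t (- integral {0..t} w))" by (simp add: traj_def)
      have "F t (- integral {0..t} w) \<le> b\<^sub>1 t * (C + \<phi> (k *\<^sub>R (- integral {0..t} w)))" by (rule C[OF t])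
      also have "\<phi> (k *\<^sub>R (- integral {0..t} w)) = \<phi> (k *\<^sub>R integral {0..t} w)" by simp
      also have "b\<^sub>1 t * (C + \<phi> (k *\<^sub>R integral {0..t} w)) \<le> b\<^sub>1 t * (C + k * E)"
        using energy_jensen[OF T w t _ k(2)] k(1) b\<^sub>1(2)[OF t] unfolding E_def by (intro mult_left_mono) auto
      finally have "m * (F t (?u t) + F t (- integral {0..t} w)) \<le> m * (F t (?u t) + b\<^sub>1 t * (C + k * E))"
        using lm by simp
      with 1 show "F t (l *\<^sub>R c) \<le> m * F t (?u t) + (m * (C + k * E)) * b\<^sub>1 t" by (simp add: algebra_simps)
    qed
    also have "\<dots> = m * (LINT t|M. F t (?u t)) + (m * (C + k * E)) * \<beta>" using iF b\<^sub>1 by (simp add: \<beta>_def)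
    also have "\<dots> = m * ((LINT t|M. F t (?u t)) + \<beta> * C + (\<beta> * k) * E)" by (simp add: algebra_simps)
    finally have "(LINT t|M. F t (l *\<^sub>R c)) / m \<le> (LINT t|M. F t (?u t)) + \<beta> * C + (\<beta> * k) * E"
      using lm by (simp add: pos_divide_le_eq mult.commute)
    moreover have "(\<beta> * k) * E \<le> (1/2) * E" using k(3) E by (rule mult_right_mono)
    ultimately show "(LINT t|M. \<phi> (w t)) / 2 + (LINT t|M. F t (l *\<^sub>R c)) / m - \<beta> * C \<le> J c w"
      unfolding J_def E_def[symmetric] by linarith
  qed
qed

text \<open>Coercivity settles large \<open>x\<close> and the integrable local bound all others.
  Without a lower bound the potential at \<open>l *\<^sub>R c\<close> could offset the energy in
  \<open>J_lower_bound\<close>.\<close>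

lemma potential_bounded_below: obtains B where "\<And>x. B \<le> (LINT t|M. F t x)"
proof -
  have "\<forall>\<^sub>F x in at_infinity. (LINT t|M. F t x) \<ge> 0" using coercive by (simp add: filterlim_at_top)
  then obtain R where R: "\<And>x. norm x \<ge> R \<Longrightarrow> (LINT t|M. F t x) \<ge> 0" unfolding eventually_at_infinity by blast
  obtain C where C: "C \<ge> 0" "\<And>t x. t \<in> {0..T} \<Longrightarrow> x \<in> ball 0 R \<Longrightarrow> \<bar>F t x\<bar> \<le> C * b t"
    using F_local[of R] by blast
  have "- \<bar>LINT t|M. C * b t\<bar> \<le> (LINT t|M. F t x)" for x
  proof (cases "norm x \<ge> R")
    case False
    have "(LINT t|M. - (C * b t)) \<le> (LINT t|M. F t x)"
    proof (rule integral_mono)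
      show "integrable M (\<lambda>t. F t x)" by (rule F_comp_integrable) simp
      show "- (C * b t) \<le> F t x" if "t \<in> space M" for t using C(2)[of t x] that False by auto
    qed (use b in simp)
    then show ?thesis by simp
  qed (use R[of x] in linarith)
  then show thesis by (rule that)
qed

theorem minimizer_exists:
  obtains c v where "admissible v" "\<And>c' w. admissible w \<Longrightarrow> J c v \<le> J c' w"
proof -
  obtain B where B: "\<And>c w. admissible w \<Longrightarrow>
    (LINT t|M. \<phi> (w t)) / 2 + (LINT t|M. F t (l *\<^sub>R c)) / m - B \<le> J c w" using J_lower_bound by blast
  obtain B0 where B0: "\<And>x. B0 \<le> (LINT t|M. F t x)" using potential_bounded_below by blast
  have E0: "0 \<le> (LINT t|M. \<phi> (w t))" for w by (rule integral_nonneg_AE) simp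
  define S where "S = {J c w | c w. admissible w}"
  have Sne: "S \<noteq> {}" using admissible_zero by (auto simp: S_def)
  have Sbd: "bdd_below S"
  proof (rule bdd_belowI)
    fix y assume "y \<in> S"
    then obtain c w where "y = J c w" "admissible w" by (auto simp: S_def)
    then have "(LINT t|M. \<phi> (w t)) / 2 + (LINT t|M. F t (l *\<^sub>R c)) / m - B \<le> y" using B by simp
    moreover have "B0 / m \<le> (LINT t|M. F t (l *\<^sub>R c)) / m" using B0 lm by (simp add: divide_right_mono)
    ultimately show "B0 / m - B \<le> y" using E0[of w] by linarith
  qed
  define I where "I = Inf S"
  have IJ: "I \<le> J c w" if "admissible w" for c w
    unfolding I_def by (rule cInf_lower[OF _ Sbd]) (use that in \<open>auto simp: S_def\<close>)
  have "\<exists>p. admissible (snd p) \<and> J (fst p) (snd p) < I + 1 / real (Suc j)" for j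
  proof -
    have "Inf S < I + 1 / real (Suc j)" by (simp add: I_def)
    then obtain y where "y \<in> S" "y < I + 1 / real (Suc j)" using cInf_lessD[OF Sne] by blast
    then show ?thesis by (auto simp: S_def)
  qed
  then obtain p where p: "\<And>j. admissible (snd (p j))" "\<And>j. J (fst (p j)) (snd (p j)) < I + 1 / real (Suc j)" by metis
  define c where "c j = fst (p j)" for j
  define w where "w j = snd (p j)" for j
  have adm: "admissible (w j)" and Jj: "J (c j) (w j) < I + 1 / real (Suc j)" for j using p by (simp_all add: c_def w_def)
  have fw: "finite_energy T (w j)" and w0: "integral {0..T} (w j) = 0" for j using adm[of j] by (auto simp: admissible_def)
  have J1: "J (c j) (w j) \<le> I + 1" for j
  proof -
    have "1 / real (Suc j) \<le> 1" by simp
    then show ?thesis using Jj[of j] by linarith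
  qed
  \<comment> \<open>Solves the lower bound on \<open>J\<close> for the energy, with the potential
    replaced by its infimum bound \<open>B0\<close>.\<close>
  define E' where "E' = 2 * \<bar>I + 1 + B - B0 / m\<bar>"
  have E': "(LINT t|M. \<phi> (w j t)) \<le> E'" for j
  proof -
    have "B0 / m \<le> (LINT t|M. F t (l *\<^sub>R c j)) / m" using B0 lm by (simp add: divide_right_mono)
    moreover have "X \<le> 2 * \<bar>I + 1 + B - r\<bar>" if "r \<le> Y" "X / 2 + Y - B \<le> J'" "J' \<le> I + 1" for X Y J' r :: real
    proof -
      have "X \<le> 2 * (I + 1 + B - r)" using that by argo
      then show ?thesis using abs_ge_self[of "I + 1 + B - r"] by argo
    qed
    ultimately show ?thesis using B[OF adm, of j "c j"] J1[of j] unfolding E'_def by blast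
  qed
  \<comment> \<open>Coercivity is applied at \<open>l *\<^sub>R c j\<close>, so the radius is
    divided by \<open>l\<close> afterwards.\<close>
  obtain R where R: "\<And>j. norm (c j) \<le> R"
  proof -
    have "\<forall>\<^sub>F x in at_infinity. (LINT t|M. F t x) > m * (I + 1 + B)"
      using coercive by (simp add: filterlim_at_top_dense)
    then obtain R where R: "\<And>x. norm x \<ge> R \<Longrightarrow> (LINT t|M. F t x) > m * (I + 1 + B)"
      unfolding eventually_at_infinity by blast
    have "norm (c j) \<le> R / l" for j
    proof (rule ccontr)
      assume "\<not> norm (c j) \<le> R / l"
      then have "norm (l *\<^sub>R c j) \<ge> R" using lm by (simp add: field_simps)
      from R[OF this] have "(I + 1 + B) < (LINT t|M. F t (l *\<^sub>R c j)) / m"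
        using lm by (simp add: pos_less_divide_eq mult.commute)
      then show False using B[OF adm, of j "c j"] J1[of j] E0[of "w j"] by linarith
    qed
    then show thesis by (rule that)
  qed
  have diff: "traj (c j) (w j) t - traj (c j) (w j) s = integral {s..t} (w j)" if "0 \<le> s" "s \<le> t" "t \<le> T" for j s t
    using integral_Icc_diff[OF integral_lebesgue_on(2)[OF finite_energy_integrable[OF fw[of j]]], of s t] that by (simp add: traj_def)
  obtain K1 where K1: "\<And>x. norm x \<le> 1 * \<phi> x + K1" using superlinear[of 1] by auto
  define R' where "R' = R + E' + \<bar>K1\<bar> * T"
  have bound: "norm (traj (c j) (w j) t) \<le> R'" if t: "t \<in> {0..T}" for j t
  proof -
    have "norm (integral {0..t} (w j)) \<le> 1 * (LINT t|M. \<phi> (w j t)) + K1 * (t - 0)"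
      by (rule norm_integral_le_energy[OF fw _ _ _ _ K1]) (use t in auto)
    also have "\<dots> \<le> E' + \<bar>K1\<bar> * T" using E'[of j] t by (intro add_mono) (auto intro: mult_mono)
    finally show ?thesis unfolding traj_def R'_def
      using R[of j] norm_triangle_ineq[of "c j" "integral {0..t} (w j)"] by linarith
  qed
  have equi: "\<exists>\<delta>>0. \<forall>n s. s \<in> {0..T} \<and> norm (t - s) < \<delta> \<longrightarrow> norm (traj (c n) (w n) t - traj (c n) (w n) s) < \<epsilon>"
    if t: "t \<in> {0..T}" and \<epsilon>: "\<epsilon> > 0" for t \<epsilon>
  proof -
    \<comment> \<open>The energy term takes less than half of \<open>\<epsilon>\<close>; the length
      of the interval is then chosen for the other half.\<close>
    define e where "e = \<epsilon> / (2 * (E' + 1))"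
    have E'0: "E' \<ge> 0" by (simp add: E'_def)
    then have e: "e > 0" using \<epsilon> by (simp add: e_def)
    obtain K where K: "\<And>x. norm x \<le> e * \<phi> x + K" using superlinear[OF e] by blast
    have K0: "K \<ge> 0" using K[of 0] by simp
    have eE: "e * E' < \<epsilon> / 2" using \<epsilon> E'0 by (simp add: e_def field_simps)
    have small: "norm (integral {r..s} (w n)) < \<epsilon>" if rs: "0 \<le> r" "r \<le> s" "s \<le> T" "s - r < \<epsilon> / (2 * (K + 1))" for r s n
    proof -
      have "norm (integral {r..s} (w n)) \<le> e * (LINT t|M. \<phi> (w n t)) + K * (s - r)"
        by (rule norm_integral_le_energy[OF fw rs(1-3) e K])
      also have "e * (LINT t|M. \<phi> (w n t)) \<le> e * E'" using E' e by simp
      also have "K * (s - r) \<le> (K + 1) * (\<epsilon> / (2 * (K + 1)))" using rs K0 by (intro mult_mono) auto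
      also have "\<dots> = \<epsilon> / 2"
      proof -
        have "K + 1 \<noteq> 0" using K0 by simp
        then show ?thesis by (simp add: divide_simps)
      qed
      finally show ?thesis using eE by linarith
    qed
    show ?thesis
    proof (intro exI[of _ "\<epsilon> / (2 * (K + 1))"] conjI allI impI)
      show "0 < \<epsilon> / (2 * (K + 1))" using \<epsilon> K0 by simp
      fix n s assume s: "s \<in> {0..T} \<and> norm (t - s) < \<epsilon> / (2 * (K + 1))"
      show "norm (traj (c n) (w n) t - traj (c n) (w n) s) < \<epsilon>"
      proof (cases "s \<le> t")
        case True
        then show ?thesis using diff[of s t n] small[of s t n] s t by auto
      next
        case False
        then show ?thesis using diff[of t s n] small[of t s n] s t by (auto simp: norm_minus_commute)
      qed
    qed
  qed
  obtain g k where g: "continuous_on {0..T} g" "strict_mono (k :: nat \<Rightarrow> nat)"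
      "\<And>e. 0 < e \<Longrightarrow> \<exists>N. \<forall>n t. n \<ge> N \<and> t \<in> {0..T} \<longrightarrow> norm (traj (c (k n)) (w (k n)) t - g t) < e"
    by (rule Arzela_Ascoli[of "{0..T}" "\<lambda>n. traj (c n) (w n)" R', OF compact_Icc bound equi]) blast+
  have ptw: "(\<lambda>n. traj (c (k n)) (w (k n)) t) \<longlonglongrightarrow> g t" if "t \<in> {0..T}" for t
    using g(3) that unfolding LIMSEQ_iff by blast
  have Flim: "(\<lambda>n. LINT t|M. F t (traj (c (k n)) (w (k n)) t)) \<longlonglongrightarrow> (LINT t|M. F t (g t))"
  proof -
    obtain C where C: "C \<ge> 0" "\<And>t x. t \<in> {0..T} \<Longrightarrow> x \<in> ball 0 (R' + 1) \<Longrightarrow> \<bar>F t x\<bar> \<le> C * b t"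
      using F_local[of "R' + 1"] by blast
    show ?thesis
    proof (rule integral_dominated_convergence[where w="\<lambda>t. C * b t"])
      show "(\<lambda>t. F t (g t)) \<in> borel_measurable M" by (rule F_comp_measurable[OF g(1)])
      show "(\<lambda>t. F t (traj (c (k n)) (w (k n)) t)) \<in> borel_measurable M" for n
        by (rule F_comp_measurable[OF traj_continuous[OF fw]])
      show "integrable M (\<lambda>t. C * b t)" using b by simp
      show "AE t in M. (\<lambda>n. F t (traj (c (k n)) (w (k n)) t)) \<longlonglongrightarrow> F t (g t)"
      proof (rule AE_I2)
        fix t assume "t \<in> space M"
        then have t: "t \<in> {0..T}" by simp
        show "(\<lambda>n. F t (traj (c (k n)) (w (k n)) t)) \<longlonglongrightarrow> F t (g t)"
          by (rule continuous_on_tendsto_compose[OF F_continuous[OF t, of UNIV] ptw[OF t]]) auto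
      qed
      show "AE t in M. norm (F t (traj (c (k n)) (w (k n)) t)) \<le> C * b t" for n
      proof (rule AE_I2)
        fix t assume "t \<in> space M"
        then have t: "t \<in> {0..T}" by simp
        show "norm (F t (traj (c (k n)) (w (k n)) t)) \<le> C * b t"
          using C(2)[OF t, of "traj (c (k n)) (w (k n)) t"] bound[OF t, of "k n"] by simp
      qed
    qed
  qed
  have Jlim: "(\<lambda>n. J (c (k n)) (w (k n))) \<longlonglongrightarrow> I"
  proof -
    have "(\<lambda>n. I + 1 / real (Suc n)) \<longlonglongrightarrow> I + 0"
      using LIMSEQ_inverse_real_of_nat by (intro tendsto_add) (auto simp: inverse_eq_divide)
    then have "(\<lambda>j. J (c j) (w j)) \<longlonglongrightarrow> I"
      by (intro tendsto_sandwich[where f="\<lambda>_. I" and h="\<lambda>n. I + 1 / real (Suc n)" and g="\<lambda>j. J (c j) (w j)"])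
        (use IJ[OF adm] less_imp_le[OF Jj] in \<open>auto intro!: always_eventually simp del: of_nat_Suc\<close>)
    from LIMSEQ_subseq_LIMSEQ[OF this g(2)] show ?thesis by (simp add: o_def)
  qed
  \<comment> \<open>The potential is continuous under uniform convergence, so the energies converge
    as well. Lower semicontinuity against exactly this limit is what makes the limit a
    minimiser.\<close>
  have Elim: "(\<lambda>n. LINT t|M. \<phi> (w (k n) t)) \<longlonglongrightarrow> I - (LINT t|M. F t (g t))"
    using tendsto_diff[OF Jlim Flim] by (simp add: J_def)
  obtain v where v: "finite_energy T v" "\<And>t. t \<in> {0..T} \<Longrightarrow> g t = g 0 + integral {0..t} v"
     "(LINT t|M. \<phi> (v t)) \<le> I - (LINT t|M. F t (g t))"
  proof (rule finite_energy_uniform_limit[OF less_imp_le[OF T] fw Elim, where c="\<lambda>n. c (k n)" and u=g])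
    show "\<exists>N. \<forall>j\<ge>N. \<forall>t\<in>{0..T}. norm (c (k j) + integral {0..t} (w (k j)) - g t) < e" if "e > 0" for e
      using g(3)[OF that] unfolding traj_def by blast
  qed blast
  have "g T = g 0"
  proof (rule LIMSEQ_unique[OF ptw])
    have "traj (c (k n)) (w (k n)) T = traj (c (k n)) (w (k n)) 0" for n by (simp add: traj_def w0)
    then show "(\<lambda>n. traj (c (k n)) (w (k n)) T) \<longlonglongrightarrow> g 0" using ptw[of 0] T by simp
  qed (use T in auto)
  then have "integral {0..T} v = 0" using v(2)[of T] T by simp
  then have av: "admissible v" using v(1) by (simp add: admissible_def)
  have "(LINT t|M. F t (traj (g 0) v t)) = (LINT t|M. F t (g t))"
    by (rule Bochner_Integration.integral_cong) (auto simp: traj_def v(2)[symmetric])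
  then have "J (g 0) v \<le> I" using v(3) by (simp add: J_def)
  from that[OF av order_trans[OF this IJ]] show thesis by blast
qed

end

section \<open>The Euler--Lagrange inclusion\<close>

lemma filterlim_inverse_Suc_at_right: "filterlim (\<lambda>n. 1 / real (Suc n)) (at_right 0) sequentially"
  by (rule tendsto_imp_filterlim_at_right)
    (use LIMSEQ_inverse_real_of_nat in \<open>auto simp: inverse_eq_divide intro: always_eventually\<close>)

context variational_problem
begin

section \<open>First variations\<close>

lemma d_bound:
  assumes u: "continuous_on {0..T} u"
  obtains C where "C \<ge> 0" "\<And>t e. t \<in> {0..T} \<Longrightarrow> \<bar>d t (u t) e\<bar> \<le> C * b t * norm e"
proof -
  obtain R where R0: "\<And>t. t \<in> {0..T} \<Longrightarrow> norm (u t) < R" using continuous_on_Icc_bounded[OF u] by blast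
  obtain C where C: "C \<ge> 0" "\<And>t x y. t \<in> {0..T} \<Longrightarrow> x \<in> ball 0 R \<Longrightarrow> y \<in> ball 0 R \<Longrightarrow> \<bar>F t x - F t y\<bar> \<le> C * b t * norm (x - y)"
    using F_local[of R] by blast
  show thesis
  proof (rule that[OF C(1)])
    fix t e assume t: "t \<in> {0..T}"
    show "\<bar>d t (u t) e\<bar> \<le> C * b t * norm e"
      by (rule regular_derivative_bound[OF reg[OF t], of "ball 0 R"]) (use R0 t C(2)[OF t] in auto)
  qed
qed

text \<open>Regularity makes the Clarke derivative a limit of quotients along the steps
  \<open>1 / Suc n\<close>, each measurable in time by \<open>F_comp_measurable\<close>.\<close>

lemma d_integrable:
  assumes u: "continuous_on {0..T} u"
  shows "integrable M (\<lambda>t. d t (u t) e)"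
proof -
  obtain C where C: "C \<ge> 0" "\<And>t e. t \<in> {0..T} \<Longrightarrow> \<bar>d t (u t) e\<bar> \<le> C * b t * norm e" using d_bound[OF u] by blast
  show ?thesis
  proof (rule Bochner_Integration.integrable_bound)
    show "integrable M (\<lambda>t. C * b t * norm e)" using b by simp
    show "AE t in M. norm (d t (u t) e) \<le> norm (C * b t * norm e)"
    proof (rule AE_I2)
      fix t assume "t \<in> space M"
      then have t: "t \<in> {0..T}" by simp
      show "norm (d t (u t) e) \<le> norm (C * b t * norm e)" using C(2)[OF t, of e] by simp
    qed
    show "(\<lambda>t. d t (u t) e) \<in> borel_measurable M"
    proof (rule borel_measurable_LIMSEQ_real)
      fix t assume "t \<in> space M"
      then have t: "t \<in> {0..T}" by simp
      show "(\<lambda>n. (F t (u t + (1 / real (Suc n)) *\<^sub>R e) - F t (u t)) / (1 / real (Suc n))) \<longlonglongrightarrow> d t (u t) e"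
        by (rule filterlim_compose[OF regular_derivativeD(1)[OF reg[OF t]] filterlim_inverse_Suc_at_right])
    next
      fix n :: nat
      have "(\<lambda>t. F t (u t + (1 / real (Suc n)) *\<^sub>R e)) \<in> borel_measurable M" "(\<lambda>t. F t (u t)) \<in> borel_measurable M"
        by (rule F_comp_measurable, intro continuous_intros u)+
      then show "(\<lambda>t. (F t (u t + (1 / real (Suc n)) *\<^sub>R e) - F t (u t)) / (1 / real (Suc n))) \<in> borel_measurable M"
        by measurable
    qed
  qed
qed

lemma gradient_integrable:
  assumes v: "finite_energy T v" shows "integrable M (\<lambda>t. gradient \<phi> (v t))"
proof -
  interpret finite_measure M by (rule finite_measure_lebesgue_on_Icc)
  have [measurable]: "v \<in> borel_measurable M" using finite_energy_measurable[OF v] .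
  obtain C where C: "C \<ge> 0" "\<And>x. norm (gradient \<phi> x) \<le> C * \<phi> x + C" using norm_gradient_le by blast
  show ?thesis
  proof (rule Bochner_Integration.integrable_bound)
    show "integrable M (\<lambda>t. C * \<phi> (v t) + C)" using finite_energy_integrable_phi[OF v] by simp
    show "AE t in M. norm (gradient \<phi> (v t)) \<le> norm (C * \<phi> (v t) + C)"
    proof (rule AE_I2)
      fix t
      show "norm (gradient \<phi> (v t)) \<le> norm (C * \<phi> (v t) + C)"
        using C(2)[of "v t"] by (rule order_trans) simp
    qed
  qed measurable
qed

text \<open>Convexity brackets the quotients between those with steps 1 and -1, and both ends are
  integrable because adding a bounded function preserves finite energy.\<close>

lemma first_variation_energy:
  assumes v: "finite_energy T v" and h [measurable]: "h \<in> borel_measurable M" and R: "\<And>t. norm (h t) \<le> R"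
  shows "(\<lambda>n. LINT t|M. (\<phi> (v t + (1 / real (Suc n)) *\<^sub>R h t) - \<phi> (v t)) / (1 / real (Suc n)))
    \<longlonglongrightarrow> (LINT t|M. gradient \<phi> (v t) \<bullet> h t)"
proof (rule integral_dominated_convergence[where w="\<lambda>t. \<phi> (v t + h t) + \<phi> (v t + - h t) + \<phi> (v t)"])
  have [measurable]: "v \<in> borel_measurable M" using finite_energy_measurable[OF v] .
  show "(\<lambda>t. gradient \<phi> (v t) \<bullet> h t) \<in> borel_measurable M" by measurable
  show "(\<lambda>t. (\<phi> (v t + (1 / real (Suc n)) *\<^sub>R h t) - \<phi> (v t)) / (1 / real (Suc n))) \<in> borel_measurable M" for n
    by measurable
  have "finite_energy T (\<lambda>t. v t + h t)" by (rule finite_energy_add_bounded[OF v h R])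
  moreover have "finite_energy T (\<lambda>t. v t + - h t)"
    by (rule finite_energy_add_bounded[OF v, of "\<lambda>t. - h t" R]) (use R in auto)
  ultimately show "integrable M (\<lambda>t. \<phi> (v t + h t) + \<phi> (v t + - h t) + \<phi> (v t))"
    using v by (intro Bochner_Integration.integrable_add finite_energy_integrable_phi)
  show "AE t in M. (\<lambda>n. (\<phi> (v t + (1 / real (Suc n)) *\<^sub>R h t) - \<phi> (v t)) / (1 / real (Suc n))) \<longlonglongrightarrow> gradient \<phi> (v t) \<bullet> h t"
  proof (rule AE_I2)
    fix t
    have "((\<lambda>s. (\<phi> (v t + s *\<^sub>R h t) - \<phi> (v t)) / s) \<longlongrightarrow> gradient \<phi> (v t) \<bullet> h t) (at_right 0)"
      by (rule tendsto_mono[OF _ directional_derivative]) (simp add: at_within_le_at)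
    from filterlim_compose[OF this filterlim_inverse_Suc_at_right]
    show "(\<lambda>n. (\<phi> (v t + (1 / real (Suc n)) *\<^sub>R h t) - \<phi> (v t)) / (1 / real (Suc n))) \<longlonglongrightarrow> gradient \<phi> (v t) \<bullet> h t" .
  qed
  show "AE t in M. norm ((\<phi> (v t + (1 / real (Suc n)) *\<^sub>R h t) - \<phi> (v t)) / (1 / real (Suc n)))
      \<le> \<phi> (v t + h t) + \<phi> (v t + - h t) + \<phi> (v t)" for n
  proof (rule AE_I2)
    fix t
    have s: "0 < 1 / real (Suc n)" "1 / real (Suc n) \<le> 1" by auto
    from difference_bounds[OF s, of "v t" "h t"] nonneg[of "v t + h t"] nonneg[of "v t - h t"] nonneg[of "v t"]
    show "norm ((\<phi> (v t + (1 / real (Suc n)) *\<^sub>R h t) - \<phi> (v t)) / (1 / real (Suc n)))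
      \<le> \<phi> (v t + h t) + \<phi> (v t + - h t) + \<phi> (v t)"
      unfolding real_norm_def diff_conv_add_uminus[symmetric] by linarith
  qed
qed

text \<open>The multiplier \<open>\<theta>\<close> can be taken out of the directional derivative
  only where it is nonnegative. The local Lipschitz bound dominates the quotients.\<close>

lemma first_variation_potential:
  assumes u: "continuous_on {0..T} u" and \<theta>: "continuous_on {0..T} \<theta>" and nn: "\<And>t. t \<in> {0..T} \<Longrightarrow> 0 \<le> \<theta> t"
  shows "(\<lambda>n. LINT t|M. (F t (u t + (1 / real (Suc n)) *\<^sub>R (\<theta> t *\<^sub>R e)) - F t (u t)) / (1 / real (Suc n)))
    \<longlonglongrightarrow> (LINT t|M. \<theta> t * d t (u t) e)"
proof -
  obtain R where R: "\<And>t. t \<in> {0..T} \<Longrightarrow> norm (u t) < R" using continuous_on_Icc_bounded[OF u] by blast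
  obtain K where K: "K > 0" "\<And>t. t \<in> {0..T} \<Longrightarrow> norm (\<theta> t) < K" using continuous_on_Icc_bounded[OF \<theta>] by blast
  \<comment> \<open>A ball around the curve and all its variations with step at most 1.\<close>
  define R' where "R' = R + K * norm e"
  obtain C where C: "C \<ge> 0" "\<And>t x y. t \<in> {0..T} \<Longrightarrow> x \<in> ball 0 R' \<Longrightarrow> y \<in> ball 0 R' \<Longrightarrow> \<bar>F t x - F t y\<bar> \<le> C * b t * norm (x - y)"
    using F_local[of R'] by blast
  show ?thesis
  proof (rule integral_dominated_convergence[where w="\<lambda>t. C * b t * (K * norm e)"])
    have "\<theta> \<in> borel_measurable M" using \<theta> by (simp add: continuous_imp_measurable_on_sets_lebesgue)
    then show "(\<lambda>t. \<theta> t * d t (u t) e) \<in> borel_measurable M"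
      using borel_measurable_integrable[OF d_integrable[OF u, of e]] by measurable
    have "(\<lambda>t. F t (u t + (1 / real (Suc n)) *\<^sub>R (\<theta> t *\<^sub>R e))) \<in> borel_measurable M" "(\<lambda>t. F t (u t)) \<in> borel_measurable M" for n
      by (rule F_comp_measurable, intro continuous_intros u \<theta>)+
    then show "(\<lambda>t. (F t (u t + (1 / real (Suc n)) *\<^sub>R (\<theta> t *\<^sub>R e)) - F t (u t)) / (1 / real (Suc n))) \<in> borel_measurable M" for n
      by measurable
    show "integrable M (\<lambda>t. C * b t * (K * norm e))" using b by simp
    show "AE t in M. (\<lambda>n. (F t (u t + (1 / real (Suc n)) *\<^sub>R (\<theta> t *\<^sub>R e)) - F t (u t)) / (1 / real (Suc n))) \<longlonglongrightarrow> \<theta> t * d t (u t) e"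
    proof (rule AE_I2)
      fix t assume "t \<in> space M"
      then have t: "t \<in> {0..T}" by simp
      from filterlim_compose[OF regular_derivative_scale[OF reg[OF t] nn[OF t]] filterlim_inverse_Suc_at_right]
      show "(\<lambda>n. (F t (u t + (1 / real (Suc n)) *\<^sub>R (\<theta> t *\<^sub>R e)) - F t (u t)) / (1 / real (Suc n))) \<longlonglongrightarrow> \<theta> t * d t (u t) e" .
    qed
    show "AE t in M. norm ((F t (u t + (1 / real (Suc n)) *\<^sub>R (\<theta> t *\<^sub>R e)) - F t (u t)) / (1 / real (Suc n))) \<le> C * b t * (K * norm e)" for n
    proof (rule AE_I2)
      fix t assume "t \<in> space M"
      then have t: "t \<in> {0..T}" by simp
      define s where "s = 1 / real (Suc n)"
      have s: "0 < s" "s \<le> 1" by (auto simp: s_def)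
      have "norm (\<theta> t) < K" by (rule K(2)[OF t])
      then have "\<bar>\<theta> t\<bar> \<le> K" by simp
      then have th: "\<bar>\<theta> t\<bar> * norm e \<le> K * norm e" by (rule mult_right_mono) simp
      have se: "norm (s *\<^sub>R (\<theta> t *\<^sub>R e)) \<le> s * (K * norm e)"
        using mult_left_mono[OF th, of s] s by (simp add: abs_mult mult.assoc)
      also have "\<dots> \<le> 1 * (K * norm e)" using s K by (intro mult_right_mono) auto
      finally have le: "norm (s *\<^sub>R (\<theta> t *\<^sub>R e)) \<le> K * norm e" by simp
      have "norm (u t) < R" by (rule R[OF t])
      then have in_ball: "u t \<in> ball 0 R'" "u t + s *\<^sub>R (\<theta> t *\<^sub>R e) \<in> ball 0 R'"
        using le norm_triangle_ineq[of "u t" "s *\<^sub>R (\<theta> t *\<^sub>R e)"] norm_ge_zero[of "s *\<^sub>R (\<theta> t *\<^sub>R e)"]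
        unfolding R'_def mem_ball_0 by linarith+
      have "\<bar>F t (u t + s *\<^sub>R (\<theta> t *\<^sub>R e)) - F t (u t)\<bar> \<le> C * b t * norm (s *\<^sub>R (\<theta> t *\<^sub>R e))"
        using C(2)[OF t in_ball(2,1)] by simp
      also have "\<dots> \<le> C * b t * (s * (K * norm e))" using C(1) b(2)[OF t] se by (intro mult_left_mono) auto
      finally have "\<bar>F t (u t + s *\<^sub>R (\<theta> t *\<^sub>R e)) - F t (u t)\<bar> / s \<le> C * b t * (K * norm e)"
        using s by (simp add: pos_divide_le_eq mult_ac)
      then show "norm ((F t (u t + (1 / real (Suc n)) *\<^sub>R (\<theta> t *\<^sub>R e)) - F t (u t)) / (1 / real (Suc n))) \<le> C * b t * (K * norm e)"
        unfolding s_def[symmetric] using s by (simp add: abs_divide)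
    qed
  qed
qed

text \<open>The initial value moves along \<open>\<theta>\<^sub>0\<close> times \<open>e\<close> and
  the derivative along \<open>\<psi>\<close> times \<open>e\<close>; together they move the curve by
  the multiplier \<open>\<theta>\<^sub>0\<close> plus the primitive of \<open>\<psi>\<close>. The
  condition on the integral of \<open>\<psi>\<close> keeps the competitor periodic.\<close>

lemma first_variation:
  assumes v: "admissible v" and min: "\<And>c' w. admissible w \<Longrightarrow> J c v \<le> J c' w"
    and \<psi> [measurable]: "\<psi> \<in> borel_measurable M" and K: "\<And>t. \<bar>\<psi> t\<bar> \<le> K"
    and zero: "integral {0..T} \<psi> = 0"
    and nn: "\<And>t. t \<in> {0..T} \<Longrightarrow> 0 \<le> \<theta>\<^sub>0 + integral {0..t} \<psi>"
  shows "0 \<le> (LINT t|M. \<psi> t * (gradient \<phi> (v t) \<bullet> e)) + (LINT t|M. (\<theta>\<^sub>0 + integral {0..t} \<psi>) * d t (traj c v t) e)"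
proof -
  interpret finite_measure M by (rule finite_measure_lebesgue_on_Icc)
  have fv: "finite_energy T v" and v0: "integral {0..T} v = 0" using v by (auto simp: admissible_def)
  let ?u = "traj c v"
  define \<theta> where "\<theta> t = \<theta>\<^sub>0 + integral {0..t} \<psi>" for t
  have \<psi>i: "integrable M \<psi>" by (rule integrable_const_bound[of _ K]) (use K in auto)
  note \<psi>I = integral_lebesgue_on(2)[OF \<psi>i] and vI = integral_lebesgue_on(2)[OF finite_energy_integrable[OF fv]]
  have cu: "continuous_on {0..T} ?u" by (rule traj_continuous[OF fv])
  have c\<theta>: "continuous_on {0..T} \<theta>" unfolding \<theta>_def
    by (intro continuous_intros indefinite_integral_continuous_1 \<psi>I)
  define h where "h t = \<psi> t *\<^sub>R e" for t
  have hm [measurable]: "h \<in> borel_measurable M" unfolding h_def[abs_def] by measurable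
  have hR: "norm (h t) \<le> K * norm e" for t using K[of t] by (simp add: h_def mult_right_mono)
  define A where "A n = (LINT t|M. (\<phi> (v t + (1 / real (Suc n)) *\<^sub>R h t) - \<phi> (v t)) / (1 / real (Suc n)))" for n
  define B where "B n = (LINT t|M. (F t (?u t + (1 / real (Suc n)) *\<^sub>R (\<theta> t *\<^sub>R e)) - F t (?u t)) / (1 / real (Suc n)))" for n
  have "0 \<le> A n + B n" for n
  proof -
    define s where "s = 1 / real (Suc n)"
    have s: "s > 0" by (simp add: s_def)
    define w where "w t = v t + s *\<^sub>R h t" for t
    have fw: "finite_energy T w" unfolding w_def
      by (rule finite_energy_add_bounded[OF fv, of "\<lambda>t. s *\<^sub>R h t" "s * (K * norm e)"])
        (use hR s in \<open>auto intro: mult_left_mono\<close>)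
    have int_w: "integral {0..t} w = integral {0..t} v + (s * integral {0..t} \<psi>) *\<^sub>R e" if "t \<in> {0..T}" for t
    proof -
      have "v integrable_on {0..t}" "\<psi> integrable_on {0..t}"
        by (rule integrable_subinterval_real[OF vI] integrable_subinterval_real[OF \<psi>I], use that in auto)+
      then have "((\<lambda>t. v t + s *\<^sub>R (\<psi> t *\<^sub>R e)) has_integral integral {0..t} v + s *\<^sub>R (integral {0..t} \<psi> *\<^sub>R e)) {0..t}"
        by (intro has_integral_add has_integral_cmul has_integral_scaleR_left integrable_integral)
      then show ?thesis by (simp add: w_def[abs_def] h_def integral_unique)
    qed
    have "admissible w" unfolding admissible_def using fw int_w[of T] v0 zero T by simp
    then have le: "J c v \<le> J (c + (s * \<theta>\<^sub>0) *\<^sub>R e) w" by (rule min)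
    have tr: "traj (c + (s * \<theta>\<^sub>0) *\<^sub>R e) w t = ?u t + s *\<^sub>R (\<theta> t *\<^sub>R e)" if "t \<in> {0..T}" for t
      using int_w[OF that] by (simp add: traj_def \<theta>_def algebra_simps)
    have i1: "integrable M (\<lambda>t. \<phi> (v t + s *\<^sub>R h t))" "integrable M (\<lambda>t. \<phi> (v t))"
      using finite_energy_integrable_phi[OF fw] finite_energy_integrable_phi[OF fv] by (simp_all add: w_def)
    have i2: "integrable M (\<lambda>t. F t (?u t + s *\<^sub>R (\<theta> t *\<^sub>R e)))" "integrable M (\<lambda>t. F t (?u t))"
      by (rule F_comp_integrable, intro continuous_intros cu c\<theta>)+
    have "J (c + (s * \<theta>\<^sub>0) *\<^sub>R e) w = (LINT t|M. \<phi> (v t + s *\<^sub>R h t)) + (LINT t|M. F t (?u t + s *\<^sub>R (\<theta> t *\<^sub>R e)))"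
      unfolding J_def w_def using tr[unfolded w_def] by (auto intro!: Bochner_Integration.integral_cong arg_cong2[where f="(+)"])
    moreover have "A n = ((LINT t|M. \<phi> (v t + s *\<^sub>R h t)) - (LINT t|M. \<phi> (v t))) / s"
      unfolding A_def s_def[symmetric] using i1 by simp
    moreover have "B n = ((LINT t|M. F t (?u t + s *\<^sub>R (\<theta> t *\<^sub>R e))) - (LINT t|M. F t (?u t))) / s"
      unfolding B_def s_def[symmetric] using i2 by simp
    ultimately have "A n + B n = (J (c + (s * \<theta>\<^sub>0) *\<^sub>R e) w - J c v) / s"
      unfolding J_def[of c v] by (simp add: diff_divide_distrib add_divide_distrib)
    then show ?thesis using le s by simp
  qed
  moreover have "A \<longlonglongrightarrow> (LINT t|M. gradient \<phi> (v t) \<bullet> h t)"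
    unfolding A_def by (rule first_variation_energy[OF fv hm hR])
  moreover have "B \<longlonglongrightarrow> (LINT t|M. \<theta> t * d t (?u t) e)"
    unfolding B_def by (rule first_variation_potential[OF cu c\<theta>]) (use nn in \<open>simp add: \<theta>_def\<close>)
  ultimately have "0 \<le> (LINT t|M. gradient \<phi> (v t) \<bullet> h t) + (LINT t|M. \<theta> t * d t (?u t) e)"
    by (intro LIMSEQ_le_const[OF tendsto_add]) auto
  then show ?thesis by (simp add: h_def \<theta>_def)
qed

end

section \<open>Trapezoidal test functions and increments of the gradient\<close>

lemma AE_lebesgue_on_not_in_negligible:
  fixes N :: "real set"
  assumes "negligible N" "S \<in> sets lebesgue" shows "AE t in lebesgue_on S. t \<notin> N"
proof -
  have "AE t in lebesgue. t \<notin> N" using assms by (intro AE_not_in) (simp add: negligible_iff_null_sets)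
  then show ?thesis using assms(2) by (subst AE_restrict_space_iff) auto
qed

lemma borel_measurable_lebesgue_on:
  assumes "f \<in> borel_measurable borel" shows "f \<in> borel_measurable (lebesgue_on S)"
proof -
  have "f \<in> borel_measurable lborel" using assms by simp
  then show ?thesis by (intro measurable_restrict_space1 measurable_completion)
qed

text \<open>The primitive of the normalised indicator of an interval of length
  \<open>\<delta>\<close> starting at \<open>s\<close>: it rises from 0 at \<open>s\<close> to 1 at
  \<open>s + \<delta>\<close>. The difference of two ramps is a trapezoid.\<close>

definition ramp :: "real \<Rightarrow> real \<Rightarrow> real \<Rightarrow> real" where
  "ramp \<delta> s \<tau> = max 0 (min (\<tau> - s) \<delta>) / \<delta>"

lemma has_integral_indicator_ramp:
  assumes "0 \<le> s" "\<delta> > 0" "0 \<le> \<tau>"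
  shows "((\<lambda>x. indicator {s..s + \<delta>} x / \<delta>) has_integral ramp \<delta> s \<tau>) {0..\<tau>}"
proof -
  have eq: "{s..s + \<delta>} \<inter> {0..\<tau>} = {s..min \<tau> (s + \<delta>)}" using assms by auto
  have "(indicat_real {s..s + \<delta>} has_integral measure lebesgue {s..min \<tau> (s + \<delta>)}) {0..\<tau>}"
    using integral_indicator[of "{s..s + \<delta>}" "{0..\<tau>}"] integrable_on_indicator[of "{s..s + \<delta>}" "{0..\<tau>}"]
    unfolding eq by (simp add: has_integral_iff)
  moreover have "measure lebesgue {s..min \<tau> (s + \<delta>)} = max 0 (min (\<tau> - s) \<delta>)"
    by (auto simp: max_def min_def)
  ultimately have "(indicat_real {s..s + \<delta>} has_integral max 0 (min (\<tau> - s) \<delta>)) {0..\<tau>}" by simp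
  from has_integral_divide[OF this, of \<delta>] show ?thesis by (simp add: ramp_def)
qed

lemma ramp_bounds: "\<delta> > 0 \<Longrightarrow> 0 \<le> ramp \<delta> s \<tau>" "\<delta> > 0 \<Longrightarrow> ramp \<delta> s \<tau> \<le> 1"
  "\<delta> > 0 \<Longrightarrow> s \<le> t \<Longrightarrow> ramp \<delta> t \<tau> \<le> ramp \<delta> s \<tau>"
  unfolding ramp_def by (auto intro!: divide_right_mono)

lemma ramp_tendsto: "(\<lambda>n. ramp (1 / real (Suc n)) s \<tau>) \<longlonglongrightarrow> indicator {s<..} \<tau>"
proof (cases "\<tau> > s")
  case True
  have "\<forall>\<^sub>F n in sequentially. 1 / real (Suc n) < \<tau> - s"
    using order_tendstoD(2)[OF LIMSEQ_inverse_real_of_nat, of "\<tau> - s"] True by (simp add: inverse_eq_divide)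
  then have "\<forall>\<^sub>F n in sequentially. ramp (1 / real (Suc n)) s \<tau> = indicator {s<..} \<tau>"
    by eventually_elim (use True in \<open>simp add: ramp_def min_def max_def\<close>)
  then show ?thesis by (rule tendsto_eventually)
next
  case False
  then have "ramp \<delta> s \<tau> = 0" for \<delta>
    unfolding ramp_def by (subst max_absorb1) (auto simp: min_le_iff_disj)
  then show ?thesis using False by simp
qed

lemma has_vector_derivative_inner_seq:
  fixes Q :: "real \<Rightarrow> 'a::euclidean_space"
  assumes Q: "(Q has_vector_derivative q) (at s within {0..T})" and s: "0 < s" "s < T"
  shows "(\<lambda>n. ((Q (s + 1 / real (Suc n)) - Q s) \<bullet> e) / (1 / real (Suc n))) \<longlonglongrightarrow> q \<bullet> e"
proof -
  have "((\<lambda>\<tau>. Q \<tau> \<bullet> e) has_vector_derivative q \<bullet> e) (at s within {0..T})"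
    by (rule bounded_linear.has_vector_derivative[OF bounded_linear_inner_left Q])
  then have "((\<lambda>\<tau>. Q \<tau> \<bullet> e) has_real_derivative q \<bullet> e) (at s within {0..T})"
    by (simp add: has_real_derivative_iff_has_vector_derivative)
  moreover have "at s within {0..T} = at s" using s by (intro at_within_interior) auto
  ultimately have "((\<lambda>h. ((Q (s + h) \<bullet> e) - (Q s \<bullet> e)) / h) \<longlongrightarrow> q \<bullet> e) (at 0)"
    by (simp add: DERIV_def)
  moreover have "filterlim (\<lambda>n. 1 / real (Suc n)) (at 0) sequentially"
    using filterlim_inverse_Suc_at_right by (rule filterlim_mono) (auto simp: at_within_le_at)
  ultimately have "(\<lambda>n. ((Q (s + 1 / real (Suc n)) \<bullet> e) - (Q s \<bullet> e)) / (1 / real (Suc n))) \<longlonglongrightarrow> q \<bullet> e"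
    by (rule filterlim_compose)
  then show ?thesis by (simp add: inner_diff_left)
qed

context variational_problem
begin

text \<open>Variations in the direction of \<open>e\<close> times a trapezoid that tends to the indicator of \<open>(s, t]\<close>,
  and times its complement to \<open>1\<close>.\<close>

lemma euler_lagrange_increments:
  assumes v: "admissible v" and min: "\<And>c' w. admissible w \<Longrightarrow> J c v \<le> J c' w"
    and st: "0 < s" "s < t" "t < T"
    and Qs: "((\<lambda>\<tau>. integral {0..\<tau>} (\<lambda>t. gradient \<phi> (v t))) has_vector_derivative gradient \<phi> (v s)) (at s within {0..T})"
    and Qt: "((\<lambda>\<tau>. integral {0..\<tau>} (\<lambda>t. gradient \<phi> (v t))) has_vector_derivative gradient \<phi> (v t)) (at t within {0..T})"
  shows "(gradient \<phi> (v t) - gradient \<phi> (v s)) \<bullet> e \<le> integral {s..t} (\<lambda>\<tau>. d \<tau> (traj c v \<tau>) e)"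
    and "(gradient \<phi> (v s) - gradient \<phi> (v t)) \<bullet> e \<le>
      integral {0..T} (\<lambda>\<tau>. d \<tau> (traj c v \<tau>) e) - integral {s..t} (\<lambda>\<tau>. d \<tau> (traj c v \<tau>) e)"
proof -
  interpret finite_measure M by (rule finite_measure_lebesgue_on_Icc)
  define q where "q \<tau> = gradient \<phi> (v \<tau>)" for \<tau>
  define Q where "Q \<tau> = integral {0..\<tau>} q" for \<tau>
  define g where "g \<tau> = d \<tau> (traj c v \<tau>) e" for \<tau>
  have fv: "finite_energy T v" using v by (simp add: admissible_def)
  have qi: "integrable M q" unfolding q_def[abs_def] by (rule gradient_integrable[OF fv])
  have gi: "integrable M g" unfolding g_def[abs_def] by (rule d_integrable[OF traj_continuous[OF fv]])
  note qI = integral_lebesgue_on(2)[OF qi] and gI = integral_lebesgue_on(2)[OF gi]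
  have Qd: "(Q has_vector_derivative q s) (at s within {0..T})" "(Q has_vector_derivative q t) (at t within {0..T})"
    using Qs Qt unfolding Q_def[abs_def] q_def[abs_def] by auto
  \<comment> \<open>The descending flank starts at \<open>t\<close> and has to end before
    \<open>T\<close>, otherwise the variation would not be periodic.\<close>
  obtain N0 where N0: "\<And>n. n \<ge> N0 \<Longrightarrow> 1 / real (Suc n) < T - t"
    using order_tendstoD(2)[OF LIMSEQ_inverse_real_of_nat, of "T - t"] st by (auto simp: eventually_sequentially inverse_eq_divide)
  define \<psi> where "\<psi> n \<tau> = indicat_real {s..s + 1 / real (Suc n)} \<tau> / (1 / real (Suc n))
      - indicat_real {t..t + 1 / real (Suc n)} \<tau> / (1 / real (Suc n))" for n \<tau>
  define \<theta> where "\<theta> n \<tau> = ramp (1 / real (Suc n)) s \<tau> - ramp (1 / real (Suc n)) t \<tau>" for n \<tau>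
  have \<psi>m [measurable]: "\<psi> n \<in> borel_measurable M" for n
    by (rule borel_measurable_lebesgue_on) (unfold \<psi>_def[abs_def], measurable)
  have \<psi>b: "\<bar>\<psi> n \<tau>\<bar> \<le> real (Suc n)" for n \<tau> unfolding \<psi>_def by (auto simp: indicator_def)
  have \<psi>\<theta>: "(\<psi> n has_integral \<theta> n \<tau>) {0..\<tau>}" if "0 \<le> \<tau>" for n \<tau>
    unfolding \<psi>_def[abs_def] \<theta>_def by (intro has_integral_diff has_integral_indicator_ramp) (use st that in auto)
  have \<theta>b: "0 \<le> \<theta> n \<tau>" "\<theta> n \<tau> \<le> 1" for n \<tau>
    using ramp_bounds[of "1 / real (Suc n)" s \<tau>] ramp_bounds[of "1 / real (Suc n)" t \<tau>]
      ramp_bounds(3)[of "1 / real (Suc n)" s t \<tau>] st by (auto simp: \<theta>_def)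
  have \<theta>T: "\<theta> n T = 0" if "n \<ge> N0" for n
    using N0[OF that] st by (simp add: \<theta>_def ramp_def min_def max_def)
  define A where "A n = (LINT \<tau>|M. \<psi> n \<tau> * (q \<tau> \<bullet> e))" for n
  define B where "B n = (LINT \<tau>|M. \<theta> n \<tau> * g \<tau>)" for n
  have \<theta>m [measurable]: "\<theta> n \<in> borel_measurable M" for n
    by (rule borel_measurable_lebesgue_on) (unfold \<theta>_def[abs_def] ramp_def, measurable)
  have \<theta>gi: "integrable M (\<lambda>\<tau>. \<theta> n \<tau> * g \<tau>)" for n
  proof (rule Bochner_Integration.integrable_bound[OF gi])
    show "AE \<tau> in M. norm (\<theta> n \<tau> * g \<tau>) \<le> norm (g \<tau>)"
      using \<theta>b by (intro AE_I2) (auto simp: abs_mult intro!: mult_left_le_one_le)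
  qed (use borel_measurable_integrable[OF gi] in measurable)
  have AB1: "0 \<le> A n + B n" if n: "n \<ge> N0" for n
  proof -
    have "0 \<le> (LINT \<tau>|M. \<psi> n \<tau> * (gradient \<phi> (v \<tau>) \<bullet> e)) + (LINT \<tau>|M. (0 + integral {0..\<tau>} (\<psi> n)) * d \<tau> (traj c v \<tau>) e)"
    proof (rule first_variation[OF v min \<psi>m \<psi>b])
      show "integral {0..T} (\<psi> n) = 0" using \<psi>\<theta>[of T n] \<theta>T[OF n] T by (simp add: integral_unique)
      show "0 \<le> 0 + integral {0..\<tau>} (\<psi> n)" if "\<tau> \<in> {0..T}" for \<tau>
        using \<psi>\<theta>[of \<tau> n] \<theta>b that by (simp add: integral_unique)
    qed
    also have "(LINT \<tau>|M. (0 + integral {0..\<tau>} (\<psi> n)) * d \<tau> (traj c v \<tau>) e) = B n"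
      unfolding B_def g_def by (rule Bochner_Integration.integral_cong) (use \<psi>\<theta> in \<open>auto simp: integral_unique\<close>)
    finally show ?thesis by (simp add: A_def q_def)
  qed
  \<comment> \<open>Starting value 1 and derivative minus \<open>\<psi> n\<close> give the
    multiplier \<open>1 - \<theta> n\<close>, which is nonnegative since trapezoids stay below
    1.\<close>
  have AB2: "0 \<le> - A n + ((LINT \<tau>|M. g \<tau>) - B n)" if n: "n \<ge> N0" for n
  proof -
    have int: "integral {0..\<tau>} (\<lambda>x. - \<psi> n x) = - \<theta> n \<tau>" if "0 \<le> \<tau>" for \<tau>
      using has_integral_neg[OF \<psi>\<theta>[OF that, of n]] by (rule integral_unique)
    have "0 \<le> (LINT \<tau>|M. - \<psi> n \<tau> * (gradient \<phi> (v \<tau>) \<bullet> e)) + (LINT \<tau>|M. (1 + integral {0..\<tau>} (\<lambda>x. - \<psi> n x)) * d \<tau> (traj c v \<tau>) e)"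
    proof (rule first_variation[OF v min])
      show "(\<lambda>x. - \<psi> n x) \<in> borel_measurable M" by measurable
      show "\<bar>- \<psi> n x\<bar> \<le> real (Suc n)" for x using \<psi>b by simp
      show "integral {0..T} (\<lambda>x. - \<psi> n x) = 0" using int[of T] \<theta>T[OF n] T by simp
      show "0 \<le> 1 + integral {0..\<tau>} (\<lambda>x. - \<psi> n x)" if "\<tau> \<in> {0..T}" for \<tau>
        using int[of \<tau>] \<theta>b[of n \<tau>] that by simp
    qed
    also have "(LINT \<tau>|M. (1 + integral {0..\<tau>} (\<lambda>x. - \<psi> n x)) * d \<tau> (traj c v \<tau>) e) = (LINT \<tau>|M. g \<tau> - \<theta> n \<tau> * g \<tau>)"
      unfolding g_def by (rule Bochner_Integration.integral_cong) (use int in \<open>auto simp: algebra_simps\<close>)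
    also have "\<dots> = (LINT \<tau>|M. g \<tau>) - B n" unfolding B_def using gi \<theta>gi by simp
    finally show ?thesis by (simp add: A_def q_def)
  qed
  \<comment> \<open>The energy part of the variation is a difference of averages of \<open>q\<close>
    to the right of \<open>s\<close> and of \<open>t\<close>; the assumed derivatives of its
    primitive give their limits.\<close>
  have "(\<lambda>n. ((Q (s + 1 / real (Suc n)) - Q s) \<bullet> e) / (1 / real (Suc n)) - ((Q (t + 1 / real (Suc n)) - Q t) \<bullet> e) / (1 / real (Suc n)))
      \<longlonglongrightarrow> q s \<bullet> e - q t \<bullet> e"
    by (intro tendsto_diff has_vector_derivative_inner_seq[OF Qd(1)] has_vector_derivative_inner_seq[OF Qd(2)]) (use st in auto)
  moreover have "\<forall>\<^sub>F n in sequentially. ((Q (s + 1 / real (Suc n)) - Q s) \<bullet> e) / (1 / real (Suc n))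
      - ((Q (t + 1 / real (Suc n)) - Q t) \<bullet> e) / (1 / real (Suc n)) = A n"
    unfolding eventually_sequentially
  proof (intro exI allI impI)
    fix n assume n: "N0 \<le> n"
    define \<delta> where "\<delta> = 1 / real (Suc n)"
    have \<delta>: "\<delta> > 0" "t + \<delta> < T" using N0[OF n] by (auto simp: \<delta>_def)
    have *: "((\<lambda>\<tau>. indicat_real {x..x + \<delta>} \<tau> / \<delta> * (q \<tau> \<bullet> e)) has_integral ((Q (x + \<delta>) - Q x) \<bullet> e) / \<delta>) {0..T}"
      if x: "0 \<le> x" "x + \<delta> \<le> T" for x
    proof -
      have sub: "{x..x + \<delta>} \<subseteq> {0..T}" using x by auto
      have "Q (x + \<delta>) - Q x = integral {x..x + \<delta>} q"
        unfolding Q_def by (rule integral_Icc_diff[OF qI]) (use x \<delta> in auto)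
      then have "(q has_integral (Q (x + \<delta>) - Q x)) {x..x + \<delta>}"
        using integrable_integral[OF integrable_subinterval_real[OF qI sub]] by simp
      from has_integral_linear[OF this bounded_linear_inner_left[of e]]
      have "((\<lambda>\<tau>. q \<tau> \<bullet> e) has_integral (Q (x + \<delta>) - Q x) \<bullet> e) {x..x + \<delta>}" by (simp add: o_def)
      from has_integral_divide[OF this, of \<delta>]
      have "((\<lambda>\<tau>. if \<tau> \<in> {x..x + \<delta>} then (q \<tau> \<bullet> e) / \<delta> else 0) has_integral ((Q (x + \<delta>) - Q x) \<bullet> e) / \<delta>) {0..T}"
        by (subst has_integral_restrict[OF sub])
      moreover have "(\<lambda>\<tau>. if \<tau> \<in> {x..x + \<delta>} then (q \<tau> \<bullet> e) / \<delta> else 0) = (\<lambda>\<tau>. indicat_real {x..x + \<delta>} \<tau> / \<delta> * (q \<tau> \<bullet> e))"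
        by (auto simp: indicator_def fun_eq_iff)
      ultimately show ?thesis by simp
    qed
    have "integrable M (\<lambda>\<tau>. \<psi> n \<tau> * (q \<tau> \<bullet> e))"
    proof (rule Bochner_Integration.integrable_bound)
      show "integrable M (\<lambda>\<tau>. real (Suc n) * (q \<tau> \<bullet> e))" using qi by simp
      show "AE \<tau> in M. norm (\<psi> n \<tau> * (q \<tau> \<bullet> e)) \<le> norm (real (Suc n) * (q \<tau> \<bullet> e))"
        using \<psi>b[of n] by (intro AE_I2) (auto simp: abs_mult simp del: of_nat_Suc intro!: mult_right_mono)
    qed (use borel_measurable_integrable[OF qi] in measurable)
    then have "A n = integral {0..T} (\<lambda>\<tau>. \<psi> n \<tau> * (q \<tau> \<bullet> e))" unfolding A_def by (rule integral_lebesgue_on(1))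
    also have "\<dots> = ((Q (s + \<delta>) - Q s) \<bullet> e) / \<delta> - ((Q (t + \<delta>) - Q t) \<bullet> e) / \<delta>"
      unfolding \<psi>_def \<delta>_def[symmetric] left_diff_distrib
      by (intro integral_unique has_integral_diff *) (use st \<delta> in auto)
    finally show "((Q (s + 1 / real (Suc n)) - Q s) \<bullet> e) / (1 / real (Suc n))
      - ((Q (t + 1 / real (Suc n)) - Q t) \<bullet> e) / (1 / real (Suc n)) = A n" by (simp only: \<delta>_def)
  qed
  ultimately have A: "A \<longlonglongrightarrow> q s \<bullet> e - q t \<bullet> e" by (rule Lim_transform_eventually)
  have sub: "{s..t} \<subseteq> {0..T}" using st by auto
  have iI: "integrable M (\<lambda>\<tau>. indicat_real {s..t} \<tau> * g \<tau>)"
  proof (rule Bochner_Integration.integrable_bound[OF gi])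
    have "indicat_real {s..t} \<in> borel_measurable M" by (rule borel_measurable_lebesgue_on) measurable
    then show "(\<lambda>\<tau>. indicat_real {s..t} \<tau> * g \<tau>) \<in> borel_measurable M"
      by (rule borel_measurable_times[OF _ borel_measurable_integrable[OF gi]])
  qed (auto simp: indicator_def)
  have "B \<longlonglongrightarrow> (LINT \<tau>|M. indicat_real {s..t} \<tau> * g \<tau>)"
    unfolding B_def
  proof (rule integral_dominated_convergence[where w="\<lambda>\<tau>. norm (g \<tau>)"])
    \<comment> \<open>The trapezoids tend to the indicator of the interval open at \<open>s\<close>,
      which differs from that of \<open>{s..t}\<close> in this point alone.\<close>
    have "AE \<tau> in M. \<tau> \<notin> {s}" by (rule AE_lebesgue_on_not_in_negligible) simp_all
    then show "AE \<tau> in M. (\<lambda>n. \<theta> n \<tau> * g \<tau>) \<longlonglongrightarrow> indicat_real {s..t} \<tau> * g \<tau>"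
    proof eventually_elim
      case (elim \<tau>)
      have "(\<lambda>n. \<theta> n \<tau> * g \<tau>) \<longlonglongrightarrow> (indicator {s<..} \<tau> - indicator {t<..} \<tau>) * g \<tau>"
        unfolding \<theta>_def by (intro tendsto_intros ramp_tendsto)
      moreover have "indicator {s<..} \<tau> - indicator {t<..} \<tau> = indicat_real {s..t} \<tau>"
        using elim st by (auto simp: indicator_def)
      ultimately show ?case by simp
    qed
    show "AE \<tau> in M. norm (\<theta> n \<tau> * g \<tau>) \<le> norm (g \<tau>)" for n
      using \<theta>b by (intro AE_I2) (auto simp: abs_mult intro!: mult_left_le_one_le)
  qed (use gi iI \<theta>gi in \<open>auto intro: borel_measurable_integrable\<close>)
  also have "(LINT \<tau>|M. indicat_real {s..t} \<tau> * g \<tau>) = integral {s..t} g"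
  proof -
    have "(g has_integral integral {s..t} g) {s..t}" by (intro integrable_integral integrable_subinterval_real[OF gI sub])
    then have "((\<lambda>\<tau>. if \<tau> \<in> {s..t} then g \<tau> else 0) has_integral integral {s..t} g) {0..T}"
      by (subst has_integral_restrict[OF sub])
    moreover have "(\<lambda>\<tau>. if \<tau> \<in> {s..t} then g \<tau> else 0) = (\<lambda>\<tau>. indicat_real {s..t} \<tau> * g \<tau>)" by (auto simp: indicator_def)
    ultimately show ?thesis using integral_lebesgue_on(1)[OF iI] by (simp add: integral_unique)
  qed
  finally have B: "B \<longlonglongrightarrow> integral {s..t} g" .
  have "0 \<le> (q s \<bullet> e - q t \<bullet> e) + integral {s..t} g"
    by (rule LIMSEQ_le_const[OF tendsto_add[OF A B]]) (use AB1 in blast)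
  then show "(gradient \<phi> (v t) - gradient \<phi> (v s)) \<bullet> e \<le> integral {s..t} (\<lambda>\<tau>. d \<tau> (traj c v \<tau>) e)"
    by (simp add: q_def g_def[abs_def] inner_diff_left)
  have "0 \<le> - (q s \<bullet> e - q t \<bullet> e) + ((LINT \<tau>|M. g \<tau>) - integral {s..t} g)"
    by (rule LIMSEQ_le_const[OF tendsto_add[OF tendsto_minus[OF A] tendsto_diff[OF tendsto_const B]]]) (use AB2 in blast)
  then show "(gradient \<phi> (v s) - gradient \<phi> (v t)) \<bullet> e \<le>
      integral {0..T} (\<lambda>\<tau>. d \<tau> (traj c v \<tau>) e) - integral {s..t} (\<lambda>\<tau>. d \<tau> (traj c v \<tau>) e)"
    using integral_lebesgue_on(1)[OF gi] by (simp add: q_def g_def[abs_def] inner_diff_left)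
qed

end

section \<open>From increments to the differential inclusion\<close>

lemma subset_closure_Diff_negligible:
  fixes U :: "'a::euclidean_space set"
  assumes "open U" "negligible N" shows "U \<subseteq> closure (U - N)"
proof
  fix x assume x: "x \<in> U"
  show "x \<in> closure (U - N)"
    unfolding closure_approachable
  proof (intro allI impI)
    fix e :: real assume e: "e > 0"
    have "open (U \<inter> ball x e)" "U \<inter> ball x e \<noteq> {}" using assms x e by auto
    then have "\<not> negligible (U \<inter> ball x e)" by (rule open_not_negligible)
    then have "\<not> U \<inter> ball x e \<subseteq> N" using assms(2) negligible_subset by blast
    then show "\<exists>y\<in>U - N. dist y x < e" by (auto simp: dist_commute)
  qed
qed

text \<open>Approximate both end points from \<open>A\<close>. Their midpoint eventually separates
  the approximants, so these are in the order in which the hypothesis applies.\<close>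

lemma increments_closure:
  fixes f :: "real \<Rightarrow> real"
  assumes f: "continuous_on (closure A) f" and K: "closed K"
    and A: "\<And>s t. s \<in> A \<Longrightarrow> t \<in> A \<Longrightarrow> s < t \<Longrightarrow> f t - f s \<in> K"
    and st: "s \<in> closure A" "t \<in> closure A" "s < t"
  shows "f t - f s \<in> K"
proof -
  obtain a where a: "\<And>n. a n \<in> A" "a \<longlonglongrightarrow> s" using st(1) unfolding closure_sequential by blast
  obtain c where c: "\<And>n. c n \<in> A" "c \<longlonglongrightarrow> t" using st(2) unfolding closure_sequential by blast
  have "(\<lambda>n. f (a n)) \<longlonglongrightarrow> f s" "(\<lambda>n. f (c n)) \<longlonglongrightarrow> f t"
    using a c closure_subset by (auto intro!: continuous_on_tendsto_compose[OF f] st always_eventually)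
  then have lim: "(\<lambda>n. f (c n) - f (a n)) \<longlonglongrightarrow> f t - f s" by (intro tendsto_diff)
  define x where "x = (s + t) / 2"
  have "\<forall>\<^sub>F n in sequentially. a n < x" "\<forall>\<^sub>F n in sequentially. x < c n"
    using order_tendstoD(2)[OF a(2), of x] order_tendstoD(1)[OF c(2), of x] st(3) by (auto simp: x_def)
  then have "\<forall>\<^sub>F n in sequentially. f (c n) - f (a n) \<in> K"
    by eventually_elim (rule A[OF a(1) c(1)], linarith)
  then show ?thesis by (rule Lim_in_closed_set[OF K _ sequentially_bot lim])
qed

context variational_problem
begin

theorem euler_lagrange:
  assumes v: "admissible v" and min: "\<And>c' w. admissible w \<Longrightarrow> J c v \<le> J c' w"
  obtains p Z where "abs_continuous_on {0..T} p" "p 0 = p T" "negligible Z"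
    "\<And>t. t \<in> {0..T} - Z \<Longrightarrow> p t = gradient \<phi> (v t)"
    "\<And>t. t \<in> {0..T} - Z \<Longrightarrow> \<exists>w. (p has_vector_derivative w) (at t) \<and> (\<forall>e. w \<bullet> e \<le> d t (traj c v t) e)"
proof -
  define q where "q \<tau> = gradient \<phi> (v \<tau>)" for \<tau>
  define g where "g e \<tau> = d \<tau> (traj c v \<tau>) e" for e \<tau>
  have fv: "finite_energy T v" using v by (simp add: admissible_def)
  have cu: "continuous_on {0..T} (traj c v)" by (rule traj_continuous[OF fv])
  have gI: "g e integrable_on {0..T}" for e
    unfolding g_def[abs_def] by (rule integral_lebesgue_on(2)[OF d_integrable[OF cu]])
  have qI: "q integrable_on {0..T}"
    unfolding q_def[abs_def] by (rule integral_lebesgue_on(2)[OF gradient_integrable[OF fv]])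
  note bI = integral_lebesgue_on(2)[OF b(1)]
  have sI: "f integrable_on {s..t}" if "f integrable_on {0..T}" "0 \<le> s" "t \<le> T" for f :: "real \<Rightarrow> 'b::euclidean_space" and s t
    using that by (intro integrable_subinterval_real[OF that(1)]) auto
  obtain C where C: "C \<ge> 0" "\<And>t e. t \<in> {0..T} \<Longrightarrow> \<bar>g e t\<bar> \<le> C * b t * norm e"
    using d_bound[OF cu] unfolding g_def by blast
  have gb: "integral {s..t} (g e) \<le> norm e * (C * integral {s..t} b)" if st: "0 \<le> s" "t \<le> T" for s t e
  proof -
    have "integral {s..t} (g e) \<le> integral {s..t} (\<lambda>\<tau>. (C * norm e) * b \<tau>)"
    proof (rule integral_le[OF sI[OF gI st]])
      show "(\<lambda>\<tau>. (C * norm e) * b \<tau>) integrable_on {s..t}" by (rule integrable_on_mult_right[OF sI[OF bI st]])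
      show "g e \<tau> \<le> (C * norm e) * b \<tau>" if "\<tau> \<in> {s..t}" for \<tau>
        using C(2)[of \<tau> e] that st by (auto simp: mult_ac)
    qed
    then show ?thesis by (simp add: mult_ac)
  qed
  \<comment> \<open>The direction is taken to be the increment itself, which turns one-sided bounds
    in all directions into a bound of the norm.\<close>
  have self: "norm x \<le> C * integral {s..t} b" if st: "0 \<le> s" "t \<le> T" and x: "x \<bullet> x \<le> integral {s..t} (g x)" for x s t
  proof (cases "x = 0")
    case True
    have "0 \<le> integral {s..t} b"
      by (rule Henstock_Kurzweil_Integration.integral_nonneg[OF sI[OF bI st]]) (use b(2) st in auto)
    then show ?thesis using C True by simp
  next
    case False
    have "norm x * norm x \<le> norm x * (C * integral {s..t} b)"
      using x gb[OF st, of x] by (simp add: power2_norm_eq_inner[symmetric] power2_eq_square)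
    then show ?thesis using False by simp
  qed
  define A0 where "A0 = {t \<in> {0..T}. \<not> ((\<lambda>\<tau>. integral {0..\<tau>} q) has_vector_derivative q t) (at t within {0..T})}"
  have A0: "negligible A0" unfolding A0_def by (rule negligible_non_differentiable_integral[OF qI])
  \<comment> \<open>Interior times at which the increment inequalities are available. The set is
    dense, so \<open>q\<close> extends uniquely from it.\<close>
  define A where "A = {0<..<T} - A0"
  have clA: "closure A = {0..T}"
  proof
    show "closure A \<subseteq> {0..T}" by (rule closure_minimal) (auto simp: A_def)
    have "{0<..<T} \<subseteq> closure A" unfolding A_def by (rule subset_closure_Diff_negligible[OF _ A0]) simp
    then have "closure {0<..<T} \<subseteq> closure A" by (rule closure_minimal) simp
    then show "{0..T} \<subseteq> closure A" using T by simp
  qed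
  have incr: "(q t - q s) \<bullet> e \<le> integral {s..t} (g e)" "(q s - q t) \<bullet> e \<le> integral {0..T} (g e) - integral {s..t} (g e)"
    if st: "s \<in> A" "t \<in> A" "s < t" for s t e
  proof -
    have *: "0 < s" "t < T" "((\<lambda>\<tau>. integral {0..\<tau>} (\<lambda>t. gradient \<phi> (v t))) has_vector_derivative gradient \<phi> (v s)) (at s within {0..T})"
        "((\<lambda>\<tau>. integral {0..\<tau>} (\<lambda>t. gradient \<phi> (v t))) has_vector_derivative gradient \<phi> (v t)) (at t within {0..T})"
      using st by (auto simp: A_def A0_def q_def[abs_def])
    show "(q t - q s) \<bullet> e \<le> integral {s..t} (g e)" "(q s - q t) \<bullet> e \<le> integral {0..T} (g e) - integral {s..t} (g e)"
      unfolding q_def g_def[abs_def]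
      using euler_lagrange_increments[OF v min *(1) st(3) *(2-4), of e] by auto
  qed
  define B where "B \<tau> = integral {0..\<tau>} b" for \<tau>
  have B: "integral {s..t} b = B t - B s" if "0 \<le> s" "s \<le> t" "t \<le> T" for s t
    unfolding B_def by (rule integral_Icc_diff[OF bI that, symmetric])
  have qA: "dist (q t) (q s) \<le> C * dist (B t) (B s)" if st: "s \<in> A" "t \<in> A" for s t
  proof -
    have *: "dist (q t) (q s) \<le> C * dist (B t) (B s)" if st: "s \<in> A" "t \<in> A" "s < t" for s t
    proof -
      have st': "0 \<le> s" "s \<le> t" "t \<le> T" using st by (auto simp: A_def)
      have "norm (q t - q s) \<le> C * integral {s..t} b" by (rule self[OF st'(1,3) incr(1)[OF st]])
      also have "\<dots> \<le> C * dist (B t) (B s)" unfolding B[OF st'] using C by (intro mult_left_mono) (auto simp: dist_real_def)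
      finally show ?thesis by (simp add: dist_norm)
    qed
    show ?thesis using *[of s t] *[of t s] st by (cases s t rule: linorder_cases) (auto simp: dist_commute)
  qed
  have UB: "uniformly_continuous_on {0..T} B"
    unfolding B_def by (intro compact_uniformly_continuous indefinite_integral_continuous_1[OF bI] compact_Icc)
  have AT: "A \<subseteq> {0..T}" by (auto simp: A_def)
  have "uniformly_continuous_on A q"
    unfolding uniformly_continuous_on_def
  proof (intro allI impI)
    fix \<epsilon> :: real assume \<epsilon>: "\<epsilon> > 0"
    have "\<epsilon> / (C + 1) > 0" using \<epsilon> C by simp
    then obtain \<delta> where \<delta>: "\<delta> > 0" "\<forall>x\<in>{0..T}. \<forall>x'\<in>{0..T}. dist x' x < \<delta> \<longrightarrow> dist (B x') (B x) < \<epsilon> / (C + 1)"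
      using UB[unfolded uniformly_continuous_on_def, rule_format, of "\<epsilon> / (C + 1)"] by blast
    have "dist (q x') (q x) < \<epsilon>" if x: "x \<in> A" "x' \<in> A" "dist x' x < \<delta>" for x x'
    proof -
      have "dist (q x') (q x) \<le> C * dist (B x') (B x)" by (rule qA[OF x(1,2)])
      also have "\<dots> \<le> C * (\<epsilon> / (C + 1))"
      proof (rule mult_left_mono[OF less_imp_le C(1)])
        show "dist (B x') (B x) < \<epsilon> / (C + 1)"
          by (rule \<delta>(2)[rule_format]) (use x AT in blast)+
      qed
      also have "\<dots> < \<epsilon>" using C \<epsilon> by (simp add: field_simps)
      finally show ?thesis .
    qed
    then show "\<exists>\<delta>>0. \<forall>x\<in>A. \<forall>x'\<in>A. dist x' x < \<delta> \<longrightarrow> dist (q x') (q x) < \<epsilon>" using \<delta>(1) by blast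
  qed
  then obtain p where p: "uniformly_continuous_on (closure A) p" "\<And>x. x \<in> A \<Longrightarrow> q x = p x"
    by (rule uniformly_continuous_on_extension_on_closure) blast
  have pc: "continuous_on {0..T} p" using uniformly_continuous_imp_continuous[OF p(1)] by (simp add: clA)
  define G where "G e \<tau> = integral {0..\<tau>} (g e)" for e \<tau>
  \<comment> \<open>The excess of the primitive of the directional derivative over the inner product
    of \<open>p\<close> and \<open>e\<close>; the trapezoid inequality says that it is
    nondecreasing.\<close>
  define N where "N e \<tau> = G e \<tau> - p \<tau> \<bullet> e" for e \<tau>
  have G: "integral {s..t} (g e) = G e t - G e s" if "0 \<le> s" "s \<le> t" "t \<le> T" for s t e
    unfolding G_def by (rule integral_Icc_diff[OF gI that, symmetric])
  have Nc: "continuous_on {0..T} (N e)" for e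
    unfolding N_def G_def by (intro continuous_intros pc indefinite_integral_continuous_1[OF gI])
  \<comment> \<open>The lower end comes from the trapezoids, the upper end from their complements;
    one closed range lets both pass from \<open>A\<close> to its closure.\<close>
  have NN: "N e t - N e s \<in> {0..G e T}" if st: "s \<in> {0..T}" "t \<in> {0..T}" "s < t" for s t e
  proof (rule increments_closure[of A "N e" "{0..G e T}" s t])
    show "continuous_on (closure A) (N e)" using Nc clA by simp
    show "N e t - N e s \<in> {0..G e T}" if st: "s \<in> A" "t \<in> A" "s < t" for s t
    proof -
      have "integral {s..t} (g e) = G e t - G e s" by (rule G) (use st in \<open>auto simp: A_def\<close>)
      then show ?thesis using incr[OF st, of e] p(2)[OF st(1)] p(2)[OF st(2)]
        by (simp add: N_def inner_diff_left G_def)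
    qed
  qed (use st clA in auto)
  have pe: "(p t - p s) \<bullet> e \<le> integral {s..t} (g e)" if st: "0 \<le> s" "s \<le> t" "t \<le> T" for s t e
    using NN[of s t e] st by (cases "s = t") (auto simp: N_def G inner_diff_left)
  have pd: "norm (p t - p s) \<le> C * integral {s..t} b" if st: "0 \<le> s" "s \<le> t" "t \<le> T" for s t
    by (rule self[OF st(1,3) pe[OF st]])
  have ac: "abs_continuous_on {0..T} p"
  proof (rule abs_continuous_on_dominated)
    show "(\<lambda>t. C * b t) integrable_on {0..T}" by (rule integrable_on_mult_right[OF bI])
    show "0 \<le> C * b t" if "t \<in> {0..T}" for t using C(1) b(2)[OF that] by simp
    show "dist (p s) (p t) \<le> integral {s..t} (\<lambda>t. C * b t)" if "0 \<le> s" "s \<le> t" "t \<le> T" for s t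
      using pd[OF that] by (simp add: dist_norm norm_minus_commute)
  qed
  \<comment> \<open>Over the whole interval the primitives cancel from the upper bound, leaving a
    linear functional that is nonnegative in every direction.\<close>
  have per: "p 0 = p T"
  proof -
    have "(p T - p 0) \<bullet> e \<ge> 0" for e
      using NN[of 0 T e] T by (simp add: N_def G_def inner_diff_left)
    from this[of "- (p T - p 0)"] have "(p T - p 0) \<bullet> (p T - p 0) \<le> 0" unfolding inner_minus_right by linarith
    then have "(p T - p 0) \<bullet> (p T - p 0) = 0" using inner_ge_zero[of "p T - p 0"] by linarith
    then show ?thesis by simp
  qed
  \<comment> \<open>Here \<open>N e\<close> is recovered from a density. Its increments are
    dominated by \<open>2 * C\<close> times those of a primitive of \<open>b\<close>: one
    \<open>C\<close> for the primitive \<open>G e\<close>, one for \<open>p\<close>.\<close>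
  have "\<exists>r. r integrable_on {0..T} \<and> (\<forall>t\<in>{0..T}. N e t - N e 0 = integral {0..t} r)" if e: "e \<in> Basis" for e
  proof -
    have I2: "(\<lambda>t. 2 * C * b t) integrable_on {0..T}" by (rule integrable_on_mult_right[OF bI])
    have incI: "0 \<le> N e t - N e s \<and> N e t - N e s \<le> integral {s..t} (\<lambda>t. 2 * C * b t)" if st: "0 \<le> s" "s \<le> t" "t \<le> T" for s t
    proof
      show "0 \<le> N e t - N e s" using NN[of s t e] st by (cases "s = t") auto
      have "N e t - N e s = integral {s..t} (g e) - (p t - p s) \<bullet> e" by (simp add: N_def G[OF st] inner_diff_left)
      moreover have "integral {s..t} (g e) \<le> C * integral {s..t} b" using gb[OF st(1,3), of e] e by simp
      moreover have "- ((p t - p s) \<bullet> e) \<le> C * integral {s..t} b"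
        using Basis_le_norm[OF e, of "p t - p s"] pd[OF st] by linarith
      ultimately show "N e t - N e s \<le> integral {s..t} (\<lambda>t. 2 * C * b t)" by simp
    qed
    have nnI: "0 \<le> 2 * C * b t" if "t \<in> {0..T}" for t using C(1) b(2)[OF that] by simp
    show ?thesis
      by (rule monotone_dominated_eq_integral[OF less_imp_le[OF T] I2 nnI incI]) blast+
  qed
  then obtain r where r: "\<And>e. e \<in> Basis \<Longrightarrow> r e integrable_on {0..T}"
      "\<And>e t. e \<in> Basis \<Longrightarrow> t \<in> {0..T} \<Longrightarrow> N e t - N e 0 = integral {0..t} (r e)" by metis
  \<comment> \<open>The coordinate densities recombine to a function whose primitive is
    \<open>p\<close> up to a constant, so Lebesgue differentiation yields the derivative of
    \<open>p\<close>.\<close>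
  define W where "W \<tau> = (\<Sum>e\<in>Basis. (g e \<tau> - r e \<tau>) *\<^sub>R e)" for \<tau>
  have Wi: "(W has_integral (p t - p 0)) {0..t}" if t: "t \<in> {0..T}" for t
  proof -
    have "(W has_integral (\<Sum>e\<in>Basis. (G e t - (N e t - N e 0)) *\<^sub>R e)) {0..t}"
      unfolding W_def[abs_def]
    proof (intro has_integral_sum has_integral_scaleR_left has_integral_diff finite_Basis)
      fix e :: 'a assume e: "e \<in> Basis"
      show "(g e has_integral G e t) {0..t}" unfolding G_def using t by (intro integrable_integral sI[OF gI]) auto
      show "(r e has_integral (N e t - N e 0)) {0..t}"
        unfolding r(2)[OF e t] using t by (intro integrable_integral sI[OF r(1)[OF e]]) auto
    qed
    also have "(\<Sum>e\<in>Basis. (G e t - (N e t - N e 0)) *\<^sub>R e) = (\<Sum>e\<in>Basis. ((p t - p 0) \<bullet> e) *\<^sub>R e)"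
      by (rule sum.cong) (auto simp: N_def G_def inner_diff_left)
    also have "\<dots> = p t - p 0" by (rule euclidean_representation)
    finally show ?thesis .
  qed
  have WI: "W integrable_on {0..T}" using Wi[of T] T by (auto intro: has_integral_integrable)
  \<comment> \<open>A single null set has to serve all directions, so only those in a countable
    dense set are differentiated.\<close>
  obtain D :: "'a set" where D: "countable D" "\<And>X. open X \<Longrightarrow> X \<noteq> {} \<Longrightarrow> \<exists>x\<in>D. x \<in> X"
    using countable_dense_exists by blast
  have clD: "closure D = UNIV"
  proof (intro set_eqI iffI UNIV_I)
    fix x
    show "x \<in> closure D"
      unfolding closure_approachable
    proof (intro allI impI)
      fix \<epsilon> :: real assume "\<epsilon> > 0"
      then show "\<exists>y\<in>D. dist y x < \<epsilon>" using D(2)[of "ball x \<epsilon>"] by (auto simp: dist_commute)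
    qed
  qed
  define Zw where "Zw = {t \<in> {0..T}. \<not> ((\<lambda>\<tau>. integral {0..\<tau>} W) has_vector_derivative W t) (at t within {0..T})}"
  define Zg where "Zg e = {t \<in> {0..T}. \<not> ((\<lambda>\<tau>. integral {0..\<tau>} (g e)) has_vector_derivative g e t) (at t within {0..T})}" for e
  \<comment> \<open>The end points are removed so that derivatives within \<open>{0..T}\<close>
    become two-sided.\<close>
  define Z where "Z = A0 \<union> Zw \<union> (\<Union>e\<in>D. Zg e) \<union> {0, T}"
  have Zneg: "negligible Z"
  proof -
    have "negligible (Zg e)" for e
      unfolding Zg_def by (rule negligible_non_differentiable_integral[OF gI])
    then have "negligible (\<Union>e\<in>D. Zg e)"
      by (intro negligible_countable_Union countable_image D(1)) auto
    moreover have "negligible Zw" unfolding Zw_def by (rule negligible_non_differentiable_integral[OF WI])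
    ultimately show ?thesis unfolding Z_def using A0 by simp
  qed
  show thesis
  proof (rule that[OF ac per Zneg])
    fix t assume t: "t \<in> {0..T} - Z"
    then have t0: "0 < t" "t < T" "t \<in> {0..T}" by (auto simp: Z_def less_le)
    have "t \<in> A" using t t0 by (auto simp: A_def Z_def)
    then show "p t = gradient \<phi> (v t)" using p(2)[of t] by (simp add: q_def)
    have at: "at t within {0..T} = at t" using t0 by (intro at_within_interior) auto
    have "((\<lambda>\<tau>. p 0 + integral {0..\<tau>} W) has_vector_derivative 0 + W t) (at t within {0..T})"
      using t by (intro has_vector_derivative_add has_vector_derivative_const) (auto simp: Z_def Zw_def)
    then have pd': "((\<lambda>\<tau>. p 0 + integral {0..\<tau>} W) has_vector_derivative W t) (at t within {0..T})" by simp
    have "(p has_vector_derivative W t) (at t within {0..T})"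
    proof (rule has_vector_derivative_transform[OF t0(3) _ pd'])
      show "p x = p 0 + integral {0..x} W" if "x \<in> {0..T}" for x
        using integral_unique[OF Wi[OF that]] by simp
    qed
    then have pW: "(p has_vector_derivative W t) (at t)" by (simp add: at)
    \<comment> \<open>The monotone function \<open>N e\<close> cannot have a negative
      derivative.\<close>
    have le: "W t \<bullet> e \<le> g e t" if e: "e \<in> D" for e
    proof -
      have "((\<lambda>\<tau>. G e \<tau>) has_vector_derivative g e t) (at t)"
        using t e at by (auto simp: Z_def Zg_def G_def[abs_def])
      moreover have "((\<lambda>\<tau>. p \<tau> \<bullet> e) has_vector_derivative W t \<bullet> e) (at t)"
        by (rule bounded_linear.has_vector_derivative[OF bounded_linear_inner_left pW])
      ultimately have "((\<lambda>\<tau>. G e \<tau> - p \<tau> \<bullet> e) has_vector_derivative g e t - W t \<bullet> e) (at t)"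
        by (rule has_vector_derivative_diff)
      then have der: "(N e has_real_derivative g e t - W t \<bullet> e) (at t)"
        by (simp add: N_def[abs_def] has_real_derivative_iff_has_vector_derivative)
      show ?thesis
      proof (rule ccontr)
        assume "\<not> ?thesis"
        then obtain h where h: "h > 0" "\<And>k. k > 0 \<Longrightarrow> k < h \<Longrightarrow> N e (t + k) < N e t"
          using DERIV_neg_dec_right[OF der] by auto
        define k where "k = min (h / 2) (T - t)"
        have k: "k > 0" "k < h" "t + k \<le> T" using h t0 by (auto simp: k_def)
        have "N e (t + k) - N e t \<in> {0..G e T}" by (rule NN) (use k t0 in auto)
        then show False using h(2)[OF k(1,2)] by simp
      qed
    qed
    have sub: "g (x + y) t \<le> g x t + g y t" for x y
      unfolding g_def by (rule regular_derivative_subadditive[OF reg[OF t0(3)]])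
    \<comment> \<open>A bounded sublinear function is Lipschitz, so the inequality extends from
      dense directions to all of them.\<close>
    have "continuous_on UNIV (\<lambda>e. W t \<bullet> e - g e t)"
    proof (rule lipschitz_on_continuous_on[of "norm (W t) + C * b t"], rule lipschitz_onI)
      fix x y :: 'a
      have 1: "\<bar>W t \<bullet> x - W t \<bullet> y\<bar> \<le> norm (W t) * norm (x - y)"
        using Cauchy_Schwarz_ineq2[of "W t" "x - y"] by (simp add: inner_diff_right)
      have 2: "\<bar>g x t - g y t\<bar> \<le> C * b t * norm (x - y)"
        using sub[of y "x - y"] sub[of x "y - x"] C(2)[OF t0(3), of "x - y"] C(2)[OF t0(3), of "y - x"]
        by (auto simp: norm_minus_commute abs_le_iff)
      show "dist (W t \<bullet> x - g x t) (W t \<bullet> y - g y t) \<le> (norm (W t) + C * b t) * dist x y"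
        using 1 2 unfolding dist_norm real_norm_def distrib_right by linarith
    qed (use C b(2)[OF t0(3)] in auto)
    then have cont: "continuous_on (closure D) (\<lambda>e. W t \<bullet> e - g e t)" by (simp add: clD)
    have "W t \<bullet> e - g e t \<le> 0" for e
      by (rule continuous_le_on_closure[OF cont]) (use le clD in auto)
    then have "\<forall>e. W t \<bullet> e \<le> d t (traj c v t) e" by (simp add: g_def)
    with pW show "\<exists>w. (p has_vector_derivative w) (at t) \<and> (\<forall>e. w \<bullet> e \<le> d t (traj c v t) e)" by blast
  qed
qed

end

section \<open>Orlicz--Sobolev functions and the main theorem\<close>

lemma AE_lebesgue_onE:
  fixes P :: "real \<Rightarrow> bool"
  assumes "AE t in lebesgue_on S. P t" "S \<in> sets lebesgue"
  obtains N where "negligible N" "\<And>t. t \<in> S - N \<Longrightarrow> P t"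
proof -
  have "AE t in lebesgue. t \<in> S \<longrightarrow> P t" using assms by (subst (asm) AE_restrict_space_iff) auto
  then obtain N where N: "{t \<in> space lebesgue. \<not> (t \<in> S \<longrightarrow> P t)} \<subseteq> N" "N \<in> null_sets lebesgue"
    unfolding eventually_ae_filter by blast
  show thesis by (rule that[of N]) (use N in \<open>auto simp: negligible_iff_null_sets\<close>)
qed

lemma AE_lebesgue_onI:
  fixes P :: "real \<Rightarrow> bool"
  assumes "negligible N" "S \<in> sets lebesgue" "\<And>t. t \<in> S - N \<Longrightarrow> P t"
  shows "AE t in lebesgue_on S. P t"
proof -
  have "AE t in lebesgue_on S. t \<in> S" by (rule AE_I2) simp
  with AE_lebesgue_on_not_in_negligible[OF assms(1,2)] show ?thesis
    by eventually_elim (use assms(3) in auto)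
qed

lemma borel_measurable_lebesgue_on_spike:
  fixes f g :: "real \<Rightarrow> 'a::topological_space"
  assumes g: "g \<in> borel_measurable (lebesgue_on S)" and S: "S \<in> sets lebesgue"
    and N: "negligible N" and eq: "\<And>t. t \<in> S - N \<Longrightarrow> f t = g t"
  shows "f \<in> borel_measurable (lebesgue_on S)"
proof (rule measurableI)
  fix A :: "'a set" assume A: "A \<in> sets borel"
  have "g -` A \<inter> S \<in> sets (lebesgue_on S)" using measurable_sets[OF g A] by simp
  then have "g -` A \<inter> S \<in> sets lebesgue" using S by (simp add: sets_restrict_space_iff)
  then have 1: "g -` A \<inter> S - N \<in> sets lebesgue" by (rule sets.Diff[OF _ negligible_imp_sets[OF N]])
  have "negligible (f -` A \<inter> S \<inter> N)" by (rule negligible_subset[OF N]) auto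
  then have 2: "f -` A \<inter> S \<inter> N \<in> sets lebesgue" by (rule negligible_imp_sets)
  have "f -` A \<inter> S = (g -` A \<inter> S - N) \<union> (f -` A \<inter> S \<inter> N)" using eq by auto
  then have "f -` A \<inter> S \<in> sets lebesgue" using sets.Un[OF 1 2] by simp
  then show "f -` A \<inter> space (lebesgue_on S) \<in> sets (lebesgue_on S)" using S by (simp add: sets_restrict_space_iff)
qed simp

lemma abs_continuous_on_subset:
  assumes "abs_continuous_on S f" "S' \<subseteq> S" shows "abs_continuous_on S' f"
  unfolding abs_continuous_on_def
proof (intro allI impI)
  fix e :: real assume e: "e > 0"
  obtain d where d: "d > 0" "\<forall>P. finite P \<and> (\<forall>(a, b)\<in>P. a \<le> b \<and> {a..b} \<subseteq> S) \<and>
        disjoint_family_on (\<lambda>(a, b). {a<..<b}) P \<and> (\<Sum>(a, b)\<in>P. b - a) < d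
        \<longrightarrow> (\<Sum>(a, b)\<in>P. dist (f a) (f b)) < e"
    using assms(1)[unfolded abs_continuous_on_def, rule_format, OF e] by (elim exE conjE) (rule that)
  show "\<exists>d>0. \<forall>P. finite P \<and> (\<forall>(a, b)\<in>P. a \<le> b \<and> {a..b} \<subseteq> S') \<and>
        disjoint_family_on (\<lambda>(a, b). {a<..<b}) P \<and> (\<Sum>(a, b)\<in>P. b - a) < d
        \<longrightarrow> (\<Sum>(a, b)\<in>P. dist (f a) (f b)) < e"
  proof (intro exI[of _ d] conjI allI impI d(1))
    fix P :: "(real \<times> real) set"
    assume P: "finite P \<and> (\<forall>(a, b)\<in>P. a \<le> b \<and> {a..b} \<subseteq> S') \<and>
        disjoint_family_on (\<lambda>(a, b). {a<..<b}) P \<and> (\<Sum>(a, b)\<in>P. b - a) < d"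
    have "\<forall>(a, b)\<in>P. a \<le> b \<and> {a..b} \<subseteq> S" using P assms(2) by fastforce
    with P spec[OF d(2), of P] show "(\<Sum>(a, b)\<in>P. dist (f a) (f b)) < e" by blast
  qed
qed

text \<open>A finite value of the conjugate at a point is an affine minorant of
  \<open>\<phi>\<close> with that slope. Taking the slopes \<open>R\<close> and \<open>- R\<close>
  along every basis vector and summing bounds the l1 norm, hence the Euclidean one; \<open>R\<close>
  is the dimension divided by \<open>e\<close>, which leaves the coefficient \<open>e\<close> for
  \<open>\<phi>\<close>.\<close>

lemma conjugate_finite_imp_superlinear:
  fixes \<phi> :: "'a::euclidean_space \<Rightarrow> real"
  assumes fin: "\<And>\<xi>. \<bar>conjugate (\<lambda>x. ereal (\<phi> x)) \<xi>\<bar> \<noteq> \<infinity>" and e: "e > 0"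
  shows "\<exists>K. \<forall>x. norm x \<le> e * \<phi> x + K"
proof -
  have "\<exists>K. \<forall>x. \<xi> \<bullet> x \<le> \<phi> x + K" for \<xi>
  proof -
    obtain K where K: "conjugate (\<lambda>x. ereal (\<phi> x)) \<xi> = ereal K" using fin[of \<xi>] by (cases "conjugate (\<lambda>x. ereal (\<phi> x)) \<xi>") auto
    have "\<xi> \<bullet> x \<le> \<phi> x + K" for x
    proof -
      have "ereal (\<xi> \<bullet> x) - ereal (\<phi> x) \<le> ereal K"
        unfolding K[symmetric] conjugate_def by (rule SUP_upper) simp
      then show ?thesis by simp
    qed
    then show ?thesis by blast
  qed
  then obtain k where k: "\<And>\<xi> x. \<xi> \<bullet> x \<le> \<phi> x + k \<xi>" by metis
  define R where "R = real DIM('a) / e"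
  have R: "R > 0" using e by (simp add: R_def)
  define K where "K b = \<bar>k (R *\<^sub>R b)\<bar> + \<bar>k (- (R *\<^sub>R b))\<bar>" for b
  have "R * \<bar>x \<bullet> b\<bar> \<le> \<phi> x + K b" for x b
    using k[of "R *\<^sub>R b" x] k[of "- (R *\<^sub>R b)" x] R by (auto simp: K_def abs_if inner_commute[of b x])
  then have "(\<Sum>b\<in>Basis. R * \<bar>x \<bullet> b\<bar>) \<le> (\<Sum>b\<in>Basis. \<phi> x + K b)" for x by (rule sum_mono)
  then have le: "R * (\<Sum>b\<in>Basis. \<bar>x \<bullet> b\<bar>) \<le> real DIM('a) * \<phi> x + sum K Basis" for x
    by (simp add: sum.distrib sum_distrib_left)
  have "norm x \<le> e * \<phi> x + sum K Basis / R" for x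
  proof -
    have "R * norm x \<le> R * (\<Sum>b\<in>Basis. \<bar>x \<bullet> b\<bar>)" using R norm_le_l1[of x] by (intro mult_left_mono) auto
    also note le[of x]
    finally have "norm x \<le> (real DIM('a) * \<phi> x + sum K Basis) / R" using R by (simp add: pos_le_divide_eq mult.commute)
    also have "\<dots> = e * \<phi> x + sum K Basis / R"
    proof -
      have "real DIM('a) * \<phi> x / R = e * \<phi> x" using e by (simp add: R_def)
      then show ?thesis by (simp add: add_divide_distrib)
    qed
    finally show ?thesis .
  qed
  then show ?thesis by blast
qed

lemma smooth_G_functionI:
  fixes \<phi> :: "'a::euclidean_space \<Rightarrow> real"
  assumes diff: "\<forall>x. \<phi> differentiable (at x)" and G: "G_function (\<lambda>x. ereal (\<phi> x))"
    and strict: "strictly_convex \<phi>"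
    and D2: "Delta2 (\<lambda>x. ereal (\<phi> x))" and cD2: "Delta2 (conjugate (\<lambda>x. ereal (\<phi> x)))"
  shows "smooth_G_function \<phi>"
proof
  show "\<phi> ((1 - t) *\<^sub>R x + t *\<^sub>R y) \<le> (1 - t) * \<phi> x + t * \<phi> y" if "0 \<le> t" "t \<le> 1" for t x y
  proof -
    have "ereal (\<phi> ((1 - t) *\<^sub>R x + t *\<^sub>R y)) \<le> ereal (1 - t) * ereal (\<phi> x) + ereal t * ereal (\<phi> y)"
      using G that unfolding G_function_def by auto
    then show ?thesis by simp
  qed
  show "\<phi> 0 = 0" "\<And>x. 0 \<le> \<phi> x" "\<And>x. \<phi> (- x) = \<phi> x"
    using G unfolding G_function_def by (auto simp: zero_ereal_def)
  show "\<exists>C. \<forall>x. \<phi> (2 *\<^sub>R x) \<le> C * \<phi> x + 1"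
  proof -
    obtain C :: real where C: "\<forall>x. ereal (\<phi> (2 *\<^sub>R x)) \<le> ereal C * ereal (\<phi> x) + 1" using D2 unfolding Delta2_def by blast
    then have "\<phi> (2 *\<^sub>R x) \<le> C * \<phi> x + 1" for x
      using C[rule_format, of x] by (simp add: one_ereal_def)
    then show ?thesis by blast
  qed
  show "\<exists>K. \<forall>x. norm x \<le> e * \<phi> x + K" if "e > 0" for e
    by (rule conjugate_finite_imp_superlinear[OF _ that]) (use cD2 in \<open>auto simp: Delta2_def\<close>)
qed (use diff strict in auto)

lemma (in smooth_G_function) L_phi_imp_finite_energy:
  assumes "w \<in> L_phi (\<lambda>x. ereal (\<phi> x)) T"
  shows "finite_energy T w"
proof -
  interpret finite_measure "lebesgue_on {0..T}" by (rule finite_measure_lebesgue_on_Icc)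
  obtain k where w [measurable]: "w \<in> borel_measurable (lebesgue_on {0..T})" and k: "k > 0"
      "(\<integral>\<^sup>+ t. ennreal (\<phi> (k *\<^sub>R w t)) \<partial>lebesgue_on {0..T}) < \<infinity>"
    using assms unfolding L_phi_def by auto
  have i: "integrable (lebesgue_on {0..T}) (\<lambda>t. \<phi> (k *\<^sub>R w t))"
    by (rule integrableI_bounded) (use k(2) in auto)
  obtain C where C: "C \<ge> 0" "\<And>x. \<phi> ((1 / k) *\<^sub>R x) \<le> C * (\<phi> x + 1)" using scale_bound by blast
  show ?thesis
  proof (rule finite_energy_bound[OF w])
    show "integrable (lebesgue_on {0..T}) (\<lambda>t. C * (\<phi> (k *\<^sub>R w t) + 1))" using i by simp
    show "AE t in lebesgue_on {0..T}. \<phi> (w t) \<le> C * (\<phi> (k *\<^sub>R w t) + 1)"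
      using C(2)[of "k *\<^sub>R w _"] k by (intro AE_I2) simp
  qed
qed

lemma (in smooth_G_function) finite_energy_imp_L_phi:
  assumes w: "finite_energy T w" shows "w \<in> L_phi (\<lambda>x. ereal (\<phi> x)) T"
proof -
  have "(\<integral>\<^sup>+ t. ennreal (\<phi> (1 *\<^sub>R w t)) \<partial>lebesgue_on {0..T}) < \<infinity>"
    using nn_integral_eq_integral[OF finite_energy_integrable_phi[OF w]] by simp
  then show ?thesis using finite_energy_measurable[OF w] unfolding L_phi_def by (auto intro!: exI[of _ 1])
qed

section \<open>Orlicz-Sobolev functions as pairs of initial value and derivative\<close>

context variational_problem
begin

lemma W1L_phi_per_imp_traj:
  assumes w: "w \<in> W1L_phi_per (\<lambda>x. ereal (\<phi> x)) T"
  defines "v \<equiv> \<lambda>t. vector_derivative w (at t within {0..T})"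
  shows "admissible v" "\<And>t. t \<in> {0..T} \<Longrightarrow> w t = traj (w 0) v t"
proof -
  have w': "abs_continuous_on {0..T} w" "AE t in lebesgue_on {0..T}. w differentiable (at t within {0..T})"
      "v \<in> L_phi (\<lambda>x. ereal (\<phi> x)) T" "w 0 = w T"
    using w by (auto simp: W1L_phi_per_def W1L_phi_def v_def)
  obtain N where N: "negligible N" "\<And>t. t \<in> {0..T} - N \<Longrightarrow> w differentiable (at t within {0..T})"
    using AE_lebesgue_onE[OF w'(2)] by auto
  have hi: "(v has_integral (w t - w 0)) {0..t}" if t: "t \<in> {0..T}" for t
  proof (rule abs_continuous_on_has_integral[OF _ abs_continuous_on_subset[OF w'(1)] N(1)])
    fix s assume s: "s \<in> {0..t} - N"
    then have "w differentiable (at s within {0..T})" using N(2) t by auto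
    then have "(w has_vector_derivative v s) (at s within {0..T})" unfolding v_def by (simp add: vector_derivative_works)
    then show "(w has_vector_derivative v s) (at s within {0..t})"
      by (rule has_vector_derivative_within_subset) (use t in auto)
  qed (use t in auto)
  show "w t = traj (w 0) v t" if "t \<in> {0..T}" for t
    using integral_unique[OF hi[OF that]] by (simp add: traj_def)
  show "admissible v"
    unfolding admissible_def using L_phi_imp_finite_energy[OF w'(3)] integral_unique[OF hi[of T]] T w'(4) by simp
qed

lemma traj_has_vector_derivative:
  assumes v: "finite_energy T v"
  obtains N where "negligible N" "\<And>t. t \<in> {0..T} - N \<Longrightarrow> (traj c v has_vector_derivative v t) (at t within {0..T})"
proof (rule that)
  show "negligible {t \<in> {0..T}. \<not> ((\<lambda>t. integral {0..t} v) has_vector_derivative v t) (at t within {0..T})}"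
    by (rule negligible_non_differentiable_integral[OF integral_lebesgue_on(2)[OF finite_energy_integrable[OF v]]])
  fix t assume t: "t \<in> {0..T} - {t \<in> {0..T}. \<not> ((\<lambda>t. integral {0..t} v) has_vector_derivative v t) (at t within {0..T})}"
  have "((\<lambda>t. c + integral {0..t} v) has_vector_derivative 0 + v t) (at t within {0..T})"
    using t by (intro has_vector_derivative_add has_vector_derivative_const) auto
  then show "(traj c v has_vector_derivative v t) (at t within {0..T})" by (simp add: traj_def[abs_def])
qed

lemma vector_derivative_traj:
  assumes v: "finite_energy T v"
  obtains N where "negligible N" "\<And>t. t \<in> {0..T} - N \<Longrightarrow> vector_derivative (traj c v) (at t within {0..T}) = v t"
proof -
  obtain N where N: "negligible N" "\<And>t. t \<in> {0..T} - N \<Longrightarrow> (traj c v has_vector_derivative v t) (at t within {0..T})"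
    using traj_has_vector_derivative[OF v] by blast
  show thesis
  proof (rule that[OF N(1)])
    fix t assume t: "t \<in> {0..T} - N"
    then show "vector_derivative (traj c v) (at t within {0..T}) = v t"
      using T by (intro vector_derivative_within_cbox[of 0 T, unfolded box_real] N(2)) auto
  qed
qed

lemma traj_in_W1L_phi_per:
  assumes v: "admissible v"
  shows "traj c v \<in> W1L_phi_per (\<lambda>x. ereal (\<phi> x)) T"
proof -
  have fv: "finite_energy T v" and v0: "integral {0..T} v = 0" using v by (auto simp: admissible_def)
  obtain N where N: "negligible N" "\<And>t. t \<in> {0..T} - N \<Longrightarrow> (traj c v has_vector_derivative v t) (at t within {0..T})"
    using traj_has_vector_derivative[OF fv] by blast
  obtain N' where N': "negligible N'" "\<And>t. t \<in> {0..T} - N' \<Longrightarrow> vector_derivative (traj c v) (at t within {0..T}) = v t"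
    using vector_derivative_traj[OF fv] by blast
  have "abs_continuous_on {0..T} (traj c v)"
    unfolding traj_def[abs_def]
    by (rule abs_continuous_on_integral) (use finite_energy_integrable[OF fv] in \<open>simp add: integrable_lebesgue_on_iff\<close>)
  moreover have "AE t in lebesgue_on {0..T}. traj c v differentiable (at t within {0..T})"
    by (rule AE_lebesgue_onI[OF N(1)]) (use N(2) in \<open>auto intro: differentiableI_vector\<close>)
  moreover have "(\<lambda>t. vector_derivative (traj c v) (at t within {0..T})) \<in> L_phi (\<lambda>x. ereal (\<phi> x)) T"
  proof (rule finite_energy_imp_L_phi, rule finite_energy_bound[OF _ finite_energy_integrable_phi[OF fv]])
    show "(\<lambda>t. vector_derivative (traj c v) (at t within {0..T})) \<in> borel_measurable (lebesgue_on {0..T})"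
      by (rule borel_measurable_lebesgue_on_spike[OF finite_energy_measurable[OF fv] _ N']) simp_all
    show "AE t in lebesgue_on {0..T}. \<phi> (vector_derivative (traj c v) (at t within {0..T})) \<le> \<phi> (v t)"
      by (rule AE_lebesgue_onI[OF N'(1)]) (use N'(2) in auto)
  qed
  moreover have "traj c v 0 = traj c v T" using v0 by (simp add: traj_def)
  ultimately show ?thesis by (simp add: W1L_phi_per_def W1L_phi_def)
qed

text \<open>\<open>F0\<close> stands for the original integrand and \<open>F\<close> for the one
  corrected on a null set; the action does not see the difference.\<close>

lemma action_eq_J:
  assumes v: "admissible v" and u: "\<And>t. t \<in> {0..T} \<Longrightarrow> u t = traj c v t"
    and N0: "negligible N0" "\<And>t x. t \<in> {0..T} - N0 \<Longrightarrow> F0 t x = F t x"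
  shows "action \<phi> F0 T u = J c v"
proof -
  have fv: "finite_energy T v" using v by (auto simp: admissible_def)
  have [measurable]: "v \<in> borel_measurable M" using finite_energy_measurable[OF fv] .
  obtain N where N: "negligible N" "\<And>t. t \<in> {0..T} - N \<Longrightarrow> vector_derivative (traj c v) (at t within {0..T}) = v t"
    using vector_derivative_traj[OF fv] by blast
  have vd: "vector_derivative u (at t within {0..T}) = vector_derivative (traj c v) (at t within {0..T})" if "t \<in> {0..T}" for t
  proof -
    have "(u has_vector_derivative D) (at t within {0..T}) \<longleftrightarrow> (traj c v has_vector_derivative D) (at t within {0..T})" for D
      using has_vector_derivative_transform[OF that, of u "traj c v"] has_vector_derivative_transform[OF that, of "traj c v" u] u
      by metis
    then show ?thesis unfolding vector_derivative_def by simp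
  qed
  have eq1: "\<phi> (vector_derivative u (at t within {0..T})) = \<phi> (v t)" if "t \<in> {0..T} - N" for t
    using vd[of t] N(2)[OF that] that by simp
  have eq2: "F0 t (u t) = F t (traj c v t)" if "t \<in> {0..T} - N0" for t
    using N0(2)[OF that] u[of t] that by simp
  have m1: "(\<lambda>t. \<phi> (v t)) \<in> borel_measurable M" by measurable
  have m2: "(\<lambda>t. F t (traj c v t)) \<in> borel_measurable M" by (rule F_comp_measurable[OF traj_continuous[OF fv]])
  have "(LINT t|M. \<phi> (vector_derivative u (at t within {0..T}))) = (LINT t|M. \<phi> (v t))"
    by (rule integral_cong_AE[OF borel_measurable_lebesgue_on_spike[OF m1 _ N(1) eq1] m1 AE_lebesgue_onI[OF N(1) _ eq1]]) auto
  moreover have "(LINT t|M. F0 t (u t)) = (LINT t|M. F t (traj c v t))"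
    by (rule integral_cong_AE[OF borel_measurable_lebesgue_on_spike[OF m2 _ N0(1) eq2] m2 AE_lebesgue_onI[OF N0(1) _ eq2]]) auto
  ultimately show ?thesis by (simp add: action_def J_def)
qed

theorem minimizer_solves:
  assumes N0: "negligible N0" "\<And>t x. t \<in> {0..T} - N0 \<Longrightarrow> F0 t x = F t x"
    and grad: "\<And>t x. t \<in> {0..T} - N0 \<Longrightarrow> clarke_gradient (F0 t) x = {\<xi>. \<forall>e. \<xi> \<bullet> e \<le> d t x e}"
  shows "\<exists>u \<in> W1L_phi_per (\<lambda>x. ereal (\<phi> x)) T.
           (\<forall>w \<in> W1L_phi_per (\<lambda>x. ereal (\<phi> x)) T. action \<phi> F0 T u \<le> action \<phi> F0 T w) \<and>
           solves_problem \<phi> F0 T u"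
proof -
  obtain c v where v: "admissible v" and min: "\<And>c' w. admissible w \<Longrightarrow> J c v \<le> J c' w"
    by (rule minimizer_exists) (rule that)
  have fv: "finite_energy T v" and v0: "integral {0..T} v = 0" using v by (auto simp: admissible_def)
  let ?u = "traj c v"
  have "action \<phi> F0 T ?u \<le> action \<phi> F0 T w" if w: "w \<in> W1L_phi_per (\<lambda>x. ereal (\<phi> x)) T" for w
    using action_eq_J[OF v refl N0, of c] action_eq_J[OF W1L_phi_per_imp_traj[OF w] N0] min[OF W1L_phi_per_imp_traj(1)[OF w]] by simp
  moreover have "solves_problem \<phi> F0 T ?u"
  proof -
    obtain p Z where p: "abs_continuous_on {0..T} p" "p 0 = p T" and Z: "negligible Z"
      "\<And>t. t \<in> {0..T} - Z \<Longrightarrow> p t = gradient \<phi> (v t)"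
      "\<And>t. t \<in> {0..T} - Z \<Longrightarrow> \<exists>w. (p has_vector_derivative w) (at t) \<and> (\<forall>e. w \<bullet> e \<le> d t (traj c v t) e)"
      by (rule euler_lagrange[OF v, of c]) (erule min, rule that)
    obtain N where N: "negligible N" "\<And>t. t \<in> {0..T} - N \<Longrightarrow> (?u has_vector_derivative v t) (at t within {0..T})"
      using traj_has_vector_derivative[OF fv] by blast
    \<comment> \<open>The required representative of the derivative: the gradient is inverted at
      every time. As the choice depends on \<open>p t\<close> alone, periodicity of \<open>p\<close>
      carries over to \<open>v'\<close>.\<close>
    define v' where "v' t = (SOME x. gradient \<phi> x = p t)" for t
    have v': "gradient \<phi> (v' t) = p t" for t unfolding v'_def by (rule someI_ex[OF gradient_surj])
    have eq: "v' t = v t" if "t \<in> {0..T} - Z" for t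
      by (rule gradient_inj) (simp add: v' Z(2)[OF that])
    show ?thesis
      unfolding solves_problem_def v'
    proof (intro exI[of _ v'] conjI)
      show "AE t in lebesgue_on {0..T}. (?u has_vector_derivative v' t) (at t within {0..T})"
        by (rule AE_lebesgue_onI[of "N \<union> Z"]) (use N Z(1) eq in auto)
      show "abs_continuous_on {0..T} (\<lambda>t. gradient \<phi> (v' t))" using p(1) by (simp add: v')
      show "AE t in lebesgue_on {0<..<T}. \<exists>w\<in>clarke_gradient (F0 t) (?u t). ((\<lambda>s. gradient \<phi> (v' s)) has_vector_derivative w) (at t)"
      proof (rule AE_lebesgue_onI[of "Z \<union> N0"])
        fix t assume t: "t \<in> {0<..<T} - (Z \<union> N0)"
        then obtain w where w: "(p has_vector_derivative w) (at t)" "\<forall>e. w \<bullet> e \<le> d t (?u t) e" using Z(3)[of t] by auto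
        then have "w \<in> clarke_gradient (F0 t) (?u t)" using grad[of t "?u t"] t by auto
        with w(1) show "\<exists>w\<in>clarke_gradient (F0 t) (?u t). ((\<lambda>s. gradient \<phi> (v' s)) has_vector_derivative w) (at t)"
          by (auto simp: v')
      qed (use Z(1) N0(1) in auto)
      show "?u 0 - ?u T = 0" using v0 by (simp add: traj_def)
      show "v' 0 - v' T = 0" using p(2) by (simp add: v'_def)
    qed
  qed
  ultimately show ?thesis using traj_in_W1L_phi_per[OF v] by blast
qed

end

theorem theorem2p3:
  fixes T :: real
    and \<phi> :: "real ^ 'n \<Rightarrow> real"
    and F :: "real \<Rightarrow> real ^ 'n \<Rightarrow> real"
  assumes T_pos: "T > 0"
    and phi_diff: "\<forall>x. \<phi> differentiable (at x)"
    and F_meas: "\<forall>x. (\<lambda>t. F t x) \<in> borel_measurable (lebesgue_on {0..T})"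
    and phi_G: "G_function (\<lambda>x. ereal (\<phi> x))"
    and phi_strict: "strictly_convex \<phi>"
    and phi_Delta2: "Delta2 (\<lambda>x. ereal (\<phi> x))"
    and conj_Delta2: "Delta2 (conjugate (\<lambda>x. ereal (\<phi> x)))"
    and F_regular: "AE t in lebesgue_on {0..T}. locally_lipschitz (F t) \<and> clarke_regular (F t)"
    and F_growth: "\<exists>(b :: real \<Rightarrow> real) (c :: real ^ 'n \<Rightarrow> real).
          integrable (lebesgue_on {0..T}) b \<and> (\<forall>t\<in>{0..T}. 0 \<le> b t) \<and>
          (\<forall>S. bounded S \<longrightarrow> bounded (c ` S)) \<and>
          (\<forall>x. AE t in lebesgue_on {0..T}. \<forall>\<xi> \<in> clarke_gradient (F t) x.
             \<bar>F t x\<bar> + norm \<xi> \<le> c x * b t)"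
    and F_quasi_subadd: "\<exists>l m :: real. l > 0 \<and> m > 0 \<and>
          (AE t in lebesgue_on {0..T}. \<forall>x y. F t (l *\<^sub>R (x + y)) \<le> m * (F t x + F t y))"
    and F_upper: "\<exists>(\<phi>\<^sub>0 :: real ^ 'n \<Rightarrow> ereal) (b\<^sub>1 :: real \<Rightarrow> real).
          G_function \<phi>\<^sub>0 \<and> \<phi>\<^sub>0 \<lless> (\<lambda>x. ereal (\<phi> x)) \<and>
          integrable (lebesgue_on {0..T}) b\<^sub>1 \<and>
          (AE t in lebesgue_on {0..T}. \<forall>x. ereal (F t x) \<le> ereal (b\<^sub>1 t) * (\<phi>\<^sub>0 x + 1))"
    and F_coercive: "filterlim (\<lambda>x. LINT t|lebesgue_on {0..T}. F t x) at_top at_infinity"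
  shows "\<exists>u \<in> W1L_phi_per (\<lambda>x. ereal (\<phi> x)) T.
           (\<forall>w \<in> W1L_phi_per (\<lambda>x. ereal (\<phi> x)) T. action \<phi> F T u \<le> action \<phi> F T w) \<and>
           solves_problem \<phi> F T u"
proof -
  let ?M = "lebesgue_on {0..T}"
  interpret smooth_G_function \<phi> by (rule smooth_G_functionI[OF phi_diff phi_G phi_strict phi_Delta2 conj_Delta2])
  obtain b :: "real \<Rightarrow> real" and c :: "real ^ 'n \<Rightarrow> real"
    where bc: "integrable ?M b" "\<forall>t\<in>{0..T}. 0 \<le> b t" "\<forall>S. bounded S \<longrightarrow> bounded (c ` S)"
      "\<forall>x. AE t in ?M. \<forall>\<xi> \<in> clarke_gradient (F t) x. \<bar>F t x\<bar> + norm \<xi> \<le> c x * b t"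
    using F_growth by (elim exE conjE) (rule that)
  note b = bc(1) bc(2)[rule_format] and c = bc(3)[rule_format] and growth = spec[OF bc(4)]
  obtain l m :: real where lm: "l > 0" "m > 0"
    and subadd: "AE t in ?M. \<forall>x y. F t (l *\<^sub>R (x + y)) \<le> m * (F t x + F t y)"
    using F_quasi_subadd by (elim exE conjE) (rule that)
  obtain \<phi>0 :: "real ^ 'n \<Rightarrow> ereal" and b1 :: "real \<Rightarrow> real" where \<phi>0: "G_function \<phi>0" "\<phi>0 \<lless> (\<lambda>x. ereal (\<phi> x))"
    and b1: "integrable ?M b1" and upper: "AE t in ?M. \<forall>x. ereal (F t x) \<le> ereal (b1 t) * (\<phi>0 x + 1)"
    using F_upper by (elim exE conjE) (rule that)
  \<comment> \<open>The null set in the growth hypothesis depends on \<open>x\<close>; restricted to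
    a countable set of points it can be chosen once.\<close>
  obtain D :: "(real ^ 'n) set" where D: "countable D" "\<And>X. open X \<Longrightarrow> X \<noteq> {} \<Longrightarrow> \<exists>x\<in>D. x \<in> X"
    using countable_dense_exists by blast
  have near: "\<exists>y\<in>D. dist y x < \<epsilon>" if "\<epsilon> > 0" for x \<epsilon>
    using D(2)[of "ball x \<epsilon>"] that by (auto simp: dist_commute)
  then have clD: "closure D = UNIV" by (auto simp: closure_approachable)
  have "AE t in ?M. \<forall>x\<in>D. \<forall>\<xi> \<in> clarke_gradient (F t) x. \<bar>F t x\<bar> + norm \<xi> \<le> c x * b t"
    using growth D(1) by (simp add: AE_ball_countable)
  note AE_conjI[OF F_regular AE_conjI[OF subadd AE_conjI[OF upper this]]]
  then obtain N where N: "negligible N" and good: "\<And>t. t \<in> {0..T} - N \<Longrightarrow>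
      (locally_lipschitz (F t) \<and> clarke_regular (F t)) \<and> (\<forall>x y. F t (l *\<^sub>R (x + y)) \<le> m * (F t x + F t y)) \<and>
      (\<forall>x. ereal (F t x) \<le> ereal (b1 t) * (\<phi>0 x + 1)) \<and>
      (\<forall>x\<in>D. \<forall>\<xi> \<in> clarke_gradient (F t) x. \<bar>F t x\<bar> + norm \<xi> \<le> c x * b t)"
    by (rule AE_lebesgue_onE) (simp, rule that)
  have P: "locally_lipschitz (F t)" "clarke_regular (F t)" "F t (l *\<^sub>R (x + y)) \<le> m * (F t x + F t y)"
      "ereal (F t x) \<le> ereal (b1 t) * (\<phi>0 x + 1)"
      "z \<in> D \<Longrightarrow> \<xi> \<in> clarke_gradient (F t) z \<Longrightarrow> \<bar>F t z\<bar> + norm \<xi> \<le> c z * b t"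
    if "t \<in> {0..T} - N" for t x y z \<xi>
    using good[OF that] by simp_all
  define A where "A t d \<longleftrightarrow> regular_derivative (F t) d \<and> (\<forall>x. clarke_gradient (F t) x = {\<xi>. \<forall>v. \<xi> \<bullet> v \<le> d x v})" for t d
  define d where "d t = (if t \<in> {0..T} - N then (SOME d. A t d) else (\<lambda>_ _. 0))" for t
  have d: "regular_derivative (F t) (d t)" "clarke_gradient (F t) x = {\<xi>. \<forall>v. \<xi> \<bullet> v \<le> d t x v}"
    if t: "t \<in> {0..T} - N" for t x
  proof -
    have "\<exists>d. A t d" using clarke_regular_imp_regular_derivative[OF P(2)[OF t]] unfolding A_def by metis
    then have "A t (SOME d. A t d)" by (rule someI_ex)
    then have "A t (d t)" using t by (simp add: d_def)
    then show "regular_derivative (F t) (d t)" "clarke_gradient (F t) x = {\<xi>. \<forall>v. \<xi> \<bullet> v \<le> d t x v}"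
      by (auto simp: A_def)
  qed
  \<comment> \<open>Zero satisfies each of the pointwise conditions, so after this change they hold
    at every time.\<close>
  define F' where "F' t x = (if t \<in> {0..T} - N then F t x else 0)" for t x
  have F'm: "(\<lambda>t. F' t x) \<in> borel_measurable ?M" for x
    by (rule borel_measurable_lebesgue_on_spike[OF F_meas[rule_format, of x] _ N]) (auto simp: F'_def)
  \<comment> \<open>The absolute value of \<open>b1\<close> is used because replacing
    \<open>\<phi>0\<close> by something larger requires a nonnegative weight.\<close>
  interpret variational_problem \<phi> T F' d b "\<lambda>t. \<bar>b1 t\<bar>" l m
  proof
    show "T > 0" by (rule T_pos)
    show "(\<lambda>t. F' t x) \<in> borel_measurable ?M" for x by (rule F'm)
    show "regular_derivative (F' t) (d t)" if "t \<in> {0..T}" for t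
    proof (cases "t \<in> N")
      case True
      then show ?thesis using regular_derivative_zero by (simp add: F'_def[abs_def] d_def)
    next
      case False
      then show ?thesis using d(1)[of t] that by (simp add: F'_def[abs_def])
    qed
    show "integrable ?M b" by (rule b)
    show "0 \<le> b t" if "t \<in> {0..T}" for t by (rule b(2)[OF that])
    show "l > 0" "m > 0" by (rule lm)+
    show "F' t (l *\<^sub>R (x + y)) \<le> m * (F' t x + F' t y)" if "t \<in> {0..T}" for t x y
      using P(3)[of t x y] that by (simp add: F'_def)
    show "integrable ?M (\<lambda>t. \<bar>b1 t\<bar>)" using b1 by simp
    show "0 \<le> \<bar>b1 t\<bar>" for t by simp
    show "filterlim (\<lambda>x. LINT t|?M. F' t x) at_top at_infinity"
    proof -
      have "(LINT t|?M. F' t x) = (LINT t|?M. F t x)" for x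
        by (rule integral_cong_AE[OF F'm F_meas[rule_format]]) (rule AE_lebesgue_onI[OF N], auto simp: F'_def)
      then show ?thesis using F_coercive by simp
    qed
    show "\<exists>C. \<forall>t\<in>{0..T}. \<forall>x. F' t x \<le> \<bar>b1 t\<bar> * (C + \<phi> (k *\<^sub>R x))" if k: "k > 0" for k
    proof -
      obtain C :: real where C: "C > 0" "\<And>x. \<phi>0 x \<le> ereal C + ereal (\<phi> (k *\<^sub>R x))"
        using \<phi>0(2) k unfolding much_less_def by blast
      have "F' t x \<le> \<bar>b1 t\<bar> * ((C + 1) + \<phi> (k *\<^sub>R x))" if t: "t \<in> {0..T}" for t x
      proof (cases "t \<in> N")
        case True
        then show ?thesis using C by (simp add: F'_def)
      next
        case False
        \<comment> \<open>\<open>\<phi>0\<close> is nonnegative and bounded by a finite quantity, so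
          its extended real value is a real number.\<close>
        obtain r where r: "\<phi>0 x = ereal r" "r \<ge> 0" "r \<le> C + \<phi> (k *\<^sub>R x)"
          using C(2)[of x] \<phi>0(1) unfolding G_function_def by (cases "\<phi>0 x") (auto, metis ereal_less_eq(5))
        have "F t x \<le> b1 t * (r + 1)" using P(4)[of t x] False t r(1) by (simp add: one_ereal_def)
        also have "\<dots> \<le> \<bar>b1 t\<bar> * ((C + 1) + \<phi> (k *\<^sub>R x))" using r by (intro mult_mono) auto
        finally show ?thesis using False t by (simp add: F'_def)
      qed
      then show ?thesis by blast
    qed
    show "\<exists>C\<ge>0. \<forall>t\<in>{0..T}. \<forall>x\<in>ball 0 R. \<forall>y\<in>ball 0 R.
      \<bar>F' t x\<bar> \<le> C * b t \<and> \<bar>F' t x - F' t y\<bar> \<le> C * b t * norm (x - y)" for R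
    proof -
      obtain K where K: "K > 0" "\<And>x. x \<in> ball 0 R \<Longrightarrow> \<bar>c x\<bar> \<le> K"
        using c[OF bounded_ball[of 0 R]] unfolding bounded_pos by auto
      \<comment> \<open>One \<open>K\<close> bounds the value at a nearby dense point, the other the
        Lipschitz error over a distance below 1.\<close>
      have "\<bar>F' t x\<bar> \<le> (2 * K) * b t \<and> \<bar>F' t x - F' t y\<bar> \<le> (2 * K) * b t * norm (x - y)"
        if t: "t \<in> {0..T}" and xy: "x \<in> ball 0 R" "y \<in> ball 0 R" for t x y
      proof (cases "t \<in> N")
        case True
        then show ?thesis using K b(2)[OF t] by (simp add: F'_def)
      next
        case False
        then have tN: "t \<in> {0..T} - N" using t by simp
        have sub: "\<bar>F t z\<bar> + norm \<xi> \<le> K * b t" if "z \<in> D" "z \<in> ball 0 R" "\<And>v. \<xi> \<bullet> v \<le> d t z v" for z \<xi>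
        proof -
          have "\<bar>F t z\<bar> + norm \<xi> \<le> c z * b t" using that d(2)[OF tN, of z] by (intro P(5)[OF tN]) auto
          also have "\<dots> \<le> K * b t" using K(2)[OF that(2)] b(2)[OF t] by (intro mult_right_mono) auto
          finally show ?thesis .
        qed
        have lip: "\<bar>F t x - F t y\<bar> \<le> K * b t * norm (x - y)" if "x \<in> ball 0 R" "y \<in> ball 0 R" for x y
        proof (rule regular_derivative_lipschitz[OF d(1)[OF tN] locally_lipschitz_continuous[OF P(1)[OF tN]] clD open_ball convex_ball _ that])
          show "norm \<xi> \<le> K * b t" if "z \<in> D" "z \<in> ball 0 R" "\<And>v. \<xi> \<bullet> v \<le> d t z v" for z \<xi>
            using sub[OF that] by linarith
        qed
        have "\<bar>F t x\<bar> \<le> (2 * K) * b t"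
        proof -
          have "0 < min 1 (R - norm x)" using xy by simp
          then obtain z where z: "z \<in> D" "dist z x < min 1 (R - norm x)" using near by blast
          have zR: "z \<in> ball 0 R" using z(2) norm_triangle_ineq2[of z x] by (simp add: dist_norm)
          obtain \<xi> where \<xi>: "\<And>v. \<xi> \<bullet> v \<le> d t z v" using regular_derivative_subgradient[OF d(1)[OF tN]] by blast
          have "\<bar>F t z\<bar> \<le> K * b t" using sub[OF z(1) zR \<xi>] norm_ge_zero[of \<xi>] by linarith
          moreover have "\<bar>F t x - F t z\<bar> \<le> K * b t * norm (x - z)" by (rule lip[OF xy(1) zR])
          moreover have "K * b t * norm (x - z) \<le> K * b t * 1"
            using z(2) K b(2)[OF t] by (intro mult_left_mono) (auto simp: dist_norm norm_minus_commute)
          ultimately show ?thesis by linarith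
        qed
        moreover have "K * b t * norm (x - y) \<le> (2 * K) * b t * norm (x - y)"
          using K b(2)[OF t] by (intro mult_right_mono) auto
        ultimately show ?thesis using lip[OF xy] tN by (simp add: F'_def)
      qed
      moreover have "2 * K \<ge> 0" using K by simp
      ultimately show ?thesis by blast
    qed
  qed
  show ?thesis
    by (rule minimizer_solves[OF N]) (auto simp: F'_def d(2))
qed

end
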